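(* Let $X$ be a separable Banach space and let $n$ be an integer with $2<n<\dim X$ (where $\dim X=\infty$ is allowed). Then there exist a $\sigma$-directionally porous set $Q\subset X$ and a $\Gamma_n$-null set $N\subset X$ such that $X=Q\cup N$.
   Context: Banach spaces are real; $B(x,r)$ denotes the open ball with centre $x$ and radius $r$. A set $P\subset X$ is directionally porous if there exists $0<\rho<1$ such that for all $x\in P$ there exists $v\in X$ with $\|v\|=1$ such that for every $\delta>0$ there exists $t\in\mathbb{R}$ with $0<|t|<\delta$ and $B(x+tv,\rho|t|)\cap P=\varnothing$. A set is $\sigma$-directionally porous if it is a union of countably many directionally porous sets. A $C^1$ surface of dimension $n$ in $X$ is a $C^1$ map $f\colon[0,1]^n\to X$. The space $\Gamma_n(X)$ of all such surfaces is equipped with the norm $\|f\|_{C^1}=\max(\|f\|_\infty,\|\partial f/\partial x_1\|_\infty,\ldots,\|\partial f/\partial x_n\|_\infty)$, where $\|\cdot\|_\infty$ is the supremum norm. A subset of a metric space is residual if its complement is meager (of first category). A set $N\subset X$ is $\Gamma_n$-null if $\mathcal{H}^n(f([0,1]^n)\cap N)=0$ for residually many $f\in\Gamma_n(X)$, where $\mathcal{H}^n$ is $n$-dimensional Hausdorff measure; that is, the set of $f\in\Gamma_n(X)$ with this property is residual in $\Gamma_n(X)$. *)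

theory Defs
  imports "HOL-Analysis.Analysis"
begin

section \<open>Directionally porous sets\<close>

definition directionally_porous :: "'a::real_normed_vector set \<Rightarrow> bool" where
  "directionally_porous P \<longleftrightarrow>
     (\<exists>\<rho>. 0 < \<rho> \<and> \<rho> < 1 \<and>
        (\<forall>x\<in>P. \<exists>v. norm v = 1 \<and>
           (\<forall>\<delta>>0. \<exists>t::real. 0 < \<bar>t\<bar> \<and> \<bar>t\<bar> < \<delta> \<and>
              ball (x + t *\<^sub>R v) (\<rho> * \<bar>t\<bar>) \<inter> P = {})))"

definition sigma_directionally_porous :: "'a::real_normed_vector set \<Rightarrow> bool" where
  "sigma_directionally_porous Q \<longleftrightarrow>
     (\<exists>\<P>. countable \<P> \<and> (\<forall>P\<in>\<P>. directionally_porous P) \<and> Q = \<Union>\<P>)"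


section \<open>Meager and residual sets\<close>

definition nowhere_dense_in :: "'b topology \<Rightarrow> 'b set \<Rightarrow> bool" where
  "nowhere_dense_in T S \<longleftrightarrow> S \<subseteq> topspace T \<and> T interior_of (T closure_of S) = {}"

definition meager_in :: "'b topology \<Rightarrow> 'b set \<Rightarrow> bool" where
  "meager_in T S \<longleftrightarrow>
     (\<exists>\<A>. countable \<A> \<and> (\<forall>A\<in>\<A>. nowhere_dense_in T A) \<and> S = \<Union>\<A>)"

definition residual_in :: "'b topology \<Rightarrow> 'b set \<Rightarrow> bool" where
  "residual_in T S \<longleftrightarrow> S \<subseteq> topspace T \<and> meager_in T (topspace T - S)"


section \<open>Hausdorff measure\<close>

text \<open>
  The diameter is extended-valued, because the real-valued \<^const>\<open>diameter\<close> is unspecified on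
  unbounded sets. The empty set contributes nothing to a cover, also when \<open>n = 0\<close>. The
  normalising factor makes the \<open>n\<close>-dimensional measure agree with Lebesgue measure on
  Euclidean \<open>n\<close>-space.
\<close>

definition ediameter :: "'a::metric_space set \<Rightarrow> ennreal" where
  "ediameter S = (SUP x\<in>S. SUP y\<in>S. ennreal (dist x y))"

definition hausdorff_content :: "nat \<Rightarrow> real \<Rightarrow> 'a::metric_space set \<Rightarrow> ennreal" where
  "hausdorff_content n \<delta> A =
     (INF U \<in> {U :: nat \<Rightarrow> 'a set. A \<subseteq> (\<Union>k. U k) \<and> (\<forall>k. ediameter (U k) \<le> ennreal \<delta>)}.
        \<Sum>k. (if U k = {} then 0
             else ennreal (unit_ball_vol (real n) / 2 ^ n) * ediameter (U k) ^ n))"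

definition hausdorff_measure :: "nat \<Rightarrow> 'a::metric_space set \<Rightarrow> ennreal" where
  "hausdorff_measure n A = (SUP \<delta>\<in>{0<..}. hausdorff_content n \<delta> A)"


section \<open>The space of $C^1$ surfaces\<close>

text \<open>The dimension \<open>n\<close> of a surface is the cardinality of the index type \<open>'n\<close>.\<close>

definition cube :: "(real ^ 'n::finite) set" where
  "cube = {x. \<forall>i. 0 \<le> x $ i \<and> x $ i \<le> 1}"

text \<open>On the boundary of the cube, derivatives are taken relative to the cube.\<close>

definition C1_on_cube :: "(real ^ 'n::finite \<Rightarrow> 'a::real_normed_vector) \<Rightarrow> bool" where
  "C1_on_cube f \<longleftrightarrow>
     (\<exists>f' :: real ^ 'n \<Rightarrow> (real ^ 'n) \<Rightarrow>\<^sub>L 'a.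
        (\<forall>x\<in>cube. (f has_derivative blinfun_apply (f' x)) (at x within cube)) \<and>
        continuous_on cube f')"

definition partial_deriv ::
    "'n \<Rightarrow> (real ^ 'n::finite \<Rightarrow> 'a::real_normed_vector) \<Rightarrow> real ^ 'n \<Rightarrow> 'a" where
  "partial_deriv i f x =
     vector_derivative (\<lambda>t. f (x + t *\<^sub>R axis i 1))
       (at 0 within {t. x + t *\<^sub>R axis i 1 \<in> cube})"

definition sup_norm :: "(real ^ 'n::finite \<Rightarrow> 'a::real_normed_vector) \<Rightarrow> real" where
  "sup_norm f = (SUP x\<in>cube. norm (f x))"

definition C1_norm :: "(real ^ 'n::finite \<Rightarrow> 'a::real_normed_vector) \<Rightarrow> real" where
  "C1_norm f = Max (insert (sup_norm f) (range (\<lambda>i. sup_norm (partial_deriv i f))))"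

text \<open>
  A map defined on the cube is represented by a total function that is \<^const>\<open>undefined\<close> outside
  the cube, so that a surface is determined by its values on the cube.
\<close>

definition C1_surfaces :: "(real ^ 'n::finite \<Rightarrow> 'a::real_normed_vector) set" where
  "C1_surfaces = {f \<in> extensional cube. C1_on_cube f}"

text \<open>
  The default value \<open>0\<close> for non-surfaces is needed because \<^locale>\<open>Metric_space\<close> demands
  nonnegativity and symmetry for all arguments, also those outside the carrier.
\<close>

definition C1_dist ::
    "(real ^ 'n::finite \<Rightarrow> 'a::real_normed_vector) \<Rightarrow> (real ^ 'n \<Rightarrow> 'a) \<Rightarrow> real" where
  "C1_dist f g =
     (if f \<in> C1_surfaces \<and> g \<in> C1_surfaces then C1_norm (\<lambda>x. f x - g x) else 0)"

lemma cube_eq_cbox: "(cube :: (real ^ 'n::finite) set) = cbox 0 1"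
  by (auto simp: cube_def mem_box_cart)

lemma zero_in_cube: "0 \<in> (cube :: (real ^ 'n::finite) set)"
  by (simp add: cube_def)

lemma C1_on_cube_diff:
  assumes "C1_on_cube f" "C1_on_cube g"
  shows "C1_on_cube (\<lambda>x. f x - g x)"
proof -
  obtain f' g' where
    "\<And>x. x \<in> cube \<Longrightarrow> (f has_derivative blinfun_apply (f' x)) (at x within cube)"
    "continuous_on cube f'"
    "\<And>x. x \<in> cube \<Longrightarrow> (g has_derivative blinfun_apply (g' x)) (at x within cube)"
    "continuous_on cube g'"
    using assms unfolding C1_on_cube_def by blast
  then have "\<forall>x\<in>cube. ((\<lambda>x. f x - g x) has_derivative blinfun_apply (f' x - g' x)) (at x within cube)"
    "continuous_on cube (\<lambda>x. f' x - g' x)"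
    by (auto simp: minus_blinfun.rep_eq intro!: has_derivative_diff continuous_on_diff)
  then show ?thesis
    unfolding C1_on_cube_def by (intro exI[of _ "\<lambda>x. f' x - g' x"] conjI)
qed

lemma partial_deriv_eq:
  fixes f :: "real ^ 'n::finite \<Rightarrow> 'a::real_normed_vector"
  assumes f: "(f has_derivative f') (at x within cube)" and x: "x \<in> cube"
  shows "partial_deriv i f x = f' (axis i 1)"
proof -
  define S where "S = {t::real. x + t *\<^sub>R axis i 1 \<in> cube}"
  have S: "S = cbox (- (x $ i)) (1 - x $ i)"
  proof (intro equalityI subsetI)
    fix t assume "t \<in> S"
    then have "0 \<le> (x + t *\<^sub>R axis i 1) $ i \<and> (x + t *\<^sub>R axis i 1) $ i \<le> 1"
      unfolding S_def cube_def by blast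
    then show "t \<in> cbox (- (x $ i)) (1 - x $ i)"
      by (auto simp: axis_def)
  next
    fix t assume "t \<in> cbox (- (x $ i)) (1 - x $ i)"
    then show "t \<in> S"
      using x by (auto simp: S_def cube_def axis_def)
  qed
  have lin: "((\<lambda>t. x + t *\<^sub>R axis i 1) has_derivative (\<lambda>t. t *\<^sub>R axis i 1)) (at 0 within S)"
    by (auto intro!: derivative_eq_intros)
  have "(f has_derivative f') (at (x + 0 *\<^sub>R axis i 1) within (\<lambda>t. x + t *\<^sub>R axis i 1) ` S)"
    using f by (auto simp: S_def intro: has_derivative_subset)
  from has_derivative_in_compose[OF lin this]
  have "((\<lambda>t. f (x + t *\<^sub>R axis i 1)) has_derivative (\<lambda>t. f' (t *\<^sub>R axis i 1))) (at 0 within S)" .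
  then have d: "((\<lambda>t. f (x + t *\<^sub>R axis i 1)) has_vector_derivative f' (axis i 1)) (at 0 within S)"
    by (simp add: has_vector_derivative_def linear_scale[OF has_derivative_linear[OF f]])
  have "- (x $ i) < 1 - x $ i" "0 \<in> cbox (- (x $ i)) (1 - x $ i)"
    using x by (auto simp: cube_def)
  then show ?thesis
    unfolding partial_deriv_def S_def[symmetric]
    using d unfolding S by (rule vector_derivative_within_cbox)
qed

lemma C1_on_cube_bounded:
  fixes f :: "real ^ 'n::finite \<Rightarrow> 'a::real_normed_vector"
  assumes "C1_on_cube f"
  shows "bdd_above ((\<lambda>x. norm (f x)) ` cube)"
    and "bdd_above ((\<lambda>x. norm (partial_deriv i f x)) ` cube)"
proof -
  obtain f' where
    d: "\<And>x. x \<in> cube \<Longrightarrow> (f has_derivative blinfun_apply (f' x)) (at x within cube)"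
    and c: "continuous_on cube f'"
    using assms unfolding C1_on_cube_def by blast
  have "continuous_on cube f"
    by (rule has_derivative_continuous_on[OF d])
  then have "compact ((\<lambda>x. norm (f x)) ` cube)"
    by (auto simp: cube_eq_cbox intro!: compact_continuous_image continuous_on_norm)
  then show "bdd_above ((\<lambda>x. norm (f x)) ` cube)"
    by (simp add: bounded_imp_bdd_above compact_imp_bounded)
  have "continuous_on cube (\<lambda>x. blinfun_apply (f' x) (axis i 1))"
    using c by (intro continuous_intros)
  then have "compact ((\<lambda>x. norm (blinfun_apply (f' x) (axis i 1))) ` cube)"
    by (auto simp: cube_eq_cbox intro!: compact_continuous_image continuous_on_norm)
  moreover have "(\<lambda>x. norm (blinfun_apply (f' x) (axis i 1))) ` cube
      = (\<lambda>x. norm (partial_deriv i f x)) ` cube"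
    by (intro image_cong refl) (simp add: partial_deriv_eq[OF d])
  ultimately show "bdd_above ((\<lambda>x. norm (partial_deriv i f x)) ` cube)"
    by (simp add: bounded_imp_bdd_above compact_imp_bounded)
qed

lemma partial_deriv_diff:
  assumes "C1_on_cube f" "C1_on_cube g" "x \<in> cube"
  shows "partial_deriv i (\<lambda>x. f x - g x) x = partial_deriv i f x - partial_deriv i g x"
proof -
  obtain f' g' where *:
    "(f has_derivative blinfun_apply (f' x)) (at x within cube)"
    "(g has_derivative blinfun_apply (g' x)) (at x within cube)"
    using assms unfolding C1_on_cube_def by blast
  show ?thesis
    using partial_deriv_eq[OF has_derivative_diff[OF *] assms(3)]
      partial_deriv_eq[OF *(1) assms(3)] partial_deriv_eq[OF *(2) assms(3)] by simp
qed

lemma C1_norm_le_iff: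
  assumes "C1_on_cube f"
  shows "C1_norm f \<le> c \<longleftrightarrow>
    (\<forall>x\<in>cube. norm (f x) \<le> c \<and> (\<forall>i. norm (partial_deriv i f x) \<le> c))"
proof -
  have ne: "cube \<noteq> {}"
    using zero_in_cube by blast
  have "sup_norm f \<le> c \<longleftrightarrow> (\<forall>x\<in>cube. norm (f x) \<le> c)"
    unfolding sup_norm_def by (rule cSUP_le_iff[OF ne C1_on_cube_bounded(1)[OF assms]])
  moreover have "sup_norm (partial_deriv i f) \<le> c \<longleftrightarrow> (\<forall>x\<in>cube. norm (partial_deriv i f x) \<le> c)"
    for i
    unfolding sup_norm_def by (rule cSUP_le_iff[OF ne C1_on_cube_bounded(2)[OF assms]])
  moreover have "C1_norm f \<le> c \<longleftrightarrow> sup_norm f \<le> c \<and> (\<forall>i. sup_norm (partial_deriv i f) \<le> c)"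
    unfolding C1_norm_def by (subst Max_le_iff) auto
  ultimately show ?thesis
    by blast
qed

lemma C1_dist_le_iff:
  assumes "f \<in> C1_surfaces" "g \<in> C1_surfaces"
  shows "C1_dist f g \<le> c \<longleftrightarrow>
    (\<forall>x\<in>cube. norm (f x - g x) \<le> c \<and>
       (\<forall>i. norm (partial_deriv i f x - partial_deriv i g x) \<le> c))"
proof -
  have "C1_on_cube f" "C1_on_cube g"
    using assms by (auto simp: C1_surfaces_def)
  then show ?thesis
    using assms by (simp add: C1_dist_def C1_norm_le_iff C1_on_cube_diff partial_deriv_diff)
qed

lemma Metric_space_C1:
  "Metric_space (C1_surfaces :: (real ^ 'n::finite \<Rightarrow> 'a::real_normed_vector) set) C1_dist"
proof
  fix f g h :: "real ^ 'n \<Rightarrow> 'a"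
  have nonneg: "0 \<le> C1_dist f g" for f g :: "real ^ 'n \<Rightarrow> 'a"
  proof (cases "f \<in> C1_surfaces \<and> g \<in> C1_surfaces")
    case True
    then have "norm (f 0 - g 0) \<le> C1_dist f g"
      using C1_dist_le_iff[of f g "C1_dist f g"] zero_in_cube by auto
    then show ?thesis
      by (rule order_trans[OF norm_ge_zero])
  qed (auto simp: C1_dist_def)
  show "0 \<le> C1_dist f g"
    by (rule nonneg)
  have le: "C1_dist f g \<le> C1_dist g f" for f g :: "real ^ 'n \<Rightarrow> 'a"
  proof (cases "f \<in> C1_surfaces \<and> g \<in> C1_surfaces")
    case True
    then show ?thesis
      using C1_dist_le_iff[of f g "C1_dist g f"] C1_dist_le_iff[of g f "C1_dist g f"]
      by (simp add: norm_minus_commute)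
  qed (auto simp: C1_dist_def)
  show "C1_dist f g = C1_dist g f"
    by (intro antisym le)
  show "C1_dist f g = 0 \<longleftrightarrow> f = g" if "f \<in> C1_surfaces" "g \<in> C1_surfaces"
  proof
    assume "C1_dist f g = 0"
    then have "\<forall>x\<in>cube. f x = g x"
      using C1_dist_le_iff[OF that, of 0] by simp
    then show "f = g"
      using that by (auto simp: C1_surfaces_def intro: extensionalityI)
  next
    assume "f = g"
    then have "C1_dist f g \<le> 0"
      using C1_dist_le_iff[OF that, of 0] by simp
    then show "C1_dist f g = 0"
      using nonneg[of f g] by simp
  qed
  show "C1_dist f h \<le> C1_dist f g + C1_dist g h"
    if "f \<in> C1_surfaces" "g \<in> C1_surfaces" "h \<in> C1_surfaces"
    using C1_dist_le_iff[OF that(1,2), of "C1_dist f g"]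
      C1_dist_le_iff[OF that(2,3), of "C1_dist g h"]
    by (subst C1_dist_le_iff[OF that(1,3)])
       (intro ballI conjI allI norm_diff_triangle_le, auto)
qed

definition C1_topology :: "(real ^ 'n::finite \<Rightarrow> 'a::real_normed_vector) topology" where
  "C1_topology = Metric_space.mtopology C1_surfaces C1_dist"

definition Gamma_null :: "'n::finite itself \<Rightarrow> 'a::real_normed_vector set \<Rightarrow> bool" where
  "Gamma_null (_ :: 'n itself) N \<longleftrightarrow>
     residual_in C1_topology
       {f \<in> C1_surfaces :: (real ^ 'n \<Rightarrow> 'a) set.
          hausdorff_measure CARD('n) (f ` cube \<inter> N) = 0}"

end

theory Submission
  imports Defs
begin

text \<open>
  A bounded linear surjection \<open>X \<rightarrow> real ^ 'n \<times> real\<close> with a bounded right inverse (Hahn--Banach)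
  reduces everything to surfaces in \<open>real ^ 'n \<times> real\<close>. For a dense sequence of hyperplanes
  \<open>z = p\<^sub>k \<bullet> y + q\<^sub>k\<close> one puts small holes at finitely many scales \<open>2 ^ (- j)\<close> beside the \<open>k\<close>-th
  hyperplane: at height about \<open>4 \<cdot> 2 ^ (- j)\<close>, over a grid of mesh \<open>2 ^ k \<cdot> 2 ^ (- j)\<close>. A typical surface is, near
  most of its points and for infinitely many \<open>k\<close>, so close to the \<open>k\<close>-th hyperplane that almost
  every point has a hole beside it; enough scales are used for the sparse holes to be beside
  almost everything. So a typical surface lies almost entirely in the porous set of
  points that avoid all late holes but have infinitely many holes beside them, provided that the
  holes themselves meet the surface in summable measure.

  This last point holds for every \<open>C\<^sup>1\<close> graph and is where \<open>n > 2\<close> enters. A graph that is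
  flat meets the holes of only one scale. To meet those of many scales it has to oscillate, and
  for \<open>n > 2\<close> the Dirichlet energy spent this way dominates the measure of the holes met. The
  energies spent at different hyperplanes add up, as in an orthogonal martingale
  decomposition of the gradient. The bound is obtained from a calibration, a vector field \<open>S (y, z)\<close> with
  \<open>div\<^sub>y S - \<bar>\<partial>\<^sub>z S\<bar>\<^sup>2 / 64\<close> at least the number of holes at \<open>(y, z)\<close> up to constants: integrating the
  divergence of \<open>S (y, u y)\<close> gives the bound for the graph of \<open>u\<close>.
\<close>

section \<open>Bounded linear functionals\<close>

text \<open>The numbers come from completing a square: with \<open>W = \<partial>\<^sub>z S\<close>
  one has \<open>W \<bullet> \<nabla>u \<ge> - \<bar>W\<bar>\<^sup>2 / 64 - 16
  \<bar>\<nabla>u\<bar>\<^sup>2\<close>, with equality at \<open>\<nabla>u = - W / 32\<close>. The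
  obstacle is that calibrations of successive hyperplanes do not simply add, since the square of
  \<open>W\<close> produces cross terms. Before the field for slope \<open>p\<close> is added, the
  old field is therefore sheared so that \<open>W = - 32 p\<close> near the new hyperplane; the
  cross term then cancels exactly the divergence caused by the tilt of the new field. What remains
  is Hardy's inequality at the holes: the divergence of
  \<open>y / (1 + \<bar>y\<bar>\<^sup>2)\<close> is at least
  \<open>(n - 2) / (1 + \<bar>y\<bar>\<^sup>2)\<close>. Making this field periodic with frequency
  \<open>\<omega>\<close> costs a constant \<open>\<omega>\<^sup>2 / 2\<close>, and these costs must
  be summable over \<open>k\<close>. Hence the mesh grows with \<open>k\<close>, the holes become
  sparse, and many scales are needed. The scales of a hyperplane are chosen after all earlier ones,
  fine enough that the shear hardly changes the earlier weights.\<close>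

definition sublinear :: "('a::real_vector \<Rightarrow> real) \<Rightarrow> bool" where
  "sublinear p \<longleftrightarrow> (\<forall>x y. p (x + y) \<le> p x + p y) \<and> (\<forall>c x. 0 \<le> c \<longrightarrow> p (c *\<^sub>R x) = c * p x)"

text \<open>The standard reduction of a sublinear functional in the direction \<open>y\<close>: it
  stays below \<open>p\<close>, and its value at \<open>- y\<close> is at most \<open>- p y\<close>,
  so a functional that it cannot lower is odd along \<open>y\<close>.\<close>

definition lower_along :: "'a::real_vector \<Rightarrow> ('a \<Rightarrow> real) \<Rightarrow> 'a \<Rightarrow> real" where
  "lower_along y p x = (INF t\<in>{0..}. p (x + t *\<^sub>R y) - t * p y)"

lemma sublinear_add: "sublinear p \<Longrightarrow> p (x + y) \<le> p x + p y"
  by (simp add: sublinear_def)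

lemma sublinear_scale: "sublinear p \<Longrightarrow> 0 \<le> c \<Longrightarrow> p (c *\<^sub>R x) = c * p x"
  by (simp add: sublinear_def)

lemma sublinear_zero: "sublinear p \<Longrightarrow> p 0 = 0"
  using sublinear_scale[of p 0 0] by simp

lemma sublinear_uminus: "sublinear p \<Longrightarrow> - p (- x) \<le> p x"
  using sublinear_add[of p x "- x"] sublinear_zero[of p] by simp

lemma lower_along_bound:
  assumes "sublinear p" "0 \<le> t"
  shows "- p (- x) \<le> p (x + t *\<^sub>R y) - t * p y"
  using sublinear_add[OF assms(1), of "x + t *\<^sub>R y" "- x"] sublinear_scale[OF assms, of y] by simp

lemma lower_along_le:
  assumes "sublinear p" "0 \<le> t"
  shows "lower_along y p x \<le> p (x + t *\<^sub>R y) - t * p y"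
  unfolding lower_along_def
  by (rule cINF_lower[OF bdd_belowI2[of _ "- p (- x)"]]) (use assms lower_along_bound in auto)

lemma lower_along_greatest:
  assumes "\<And>t. 0 \<le> t \<Longrightarrow> b \<le> p (x + t *\<^sub>R y) - t * p y"
  shows "b \<le> lower_along y p x"
  unfolding lower_along_def by (rule cINF_greatest) (use assms in auto)

lemma sublinear_lower_along:
  assumes p: "sublinear p"
  shows "sublinear (lower_along y p)"
proof -
  have add: "lower_along y p (x + x') \<le> lower_along y p x + lower_along y p x'" for x x'
  proof -
    have "lower_along y p (x + x') - lower_along y p x \<le> lower_along y p x'"
    proof (rule lower_along_greatest)
      fix t :: real assume t: "0 \<le> t"
      have "lower_along y p (x + x') - (p (x' + t *\<^sub>R y) - t * p y) \<le> lower_along y p x"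
      proof (rule lower_along_greatest)
        fix s :: real assume s: "0 \<le> s"
        have "lower_along y p (x + x') \<le> p (x + x' + (s + t) *\<^sub>R y) - (s + t) * p y"
          by (rule lower_along_le) (use p s t in auto)
        moreover have "p (x + x' + (s + t) *\<^sub>R y) \<le> p (x + s *\<^sub>R y) + p (x' + t *\<^sub>R y)"
          using sublinear_add[OF p, of "x + s *\<^sub>R y" "x' + t *\<^sub>R y"] by (simp add: algebra_simps)
        ultimately show "lower_along y p (x + x') - (p (x' + t *\<^sub>R y) - t * p y)
            \<le> p (x + s *\<^sub>R y) - s * p y"
          by (simp add: algebra_simps)
      qed
      then show "lower_along y p (x + x') - lower_along y p x \<le> p (x' + t *\<^sub>R y) - t * p y"
        by simp
    qed
    then show ?thesis by simp
  qed
  have le: "lower_along y p (c *\<^sub>R x) \<le> c * lower_along y p x" if "0 < c" for c x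
  proof -
    have "lower_along y p (c *\<^sub>R x) / c \<le> lower_along y p x"
    proof (rule lower_along_greatest)
      fix t :: real assume t: "0 \<le> t"
      have "lower_along y p (c *\<^sub>R x) \<le> p (c *\<^sub>R x + (c * t) *\<^sub>R y) - (c * t) * p y"
        by (rule lower_along_le) (use p t that in auto)
      also have "p (c *\<^sub>R x + (c * t) *\<^sub>R y) = c * p (x + t *\<^sub>R y)"
        using sublinear_scale[OF p, of c "x + t *\<^sub>R y"] that by (simp add: algebra_simps)
      finally show "lower_along y p (c *\<^sub>R x) / c \<le> p (x + t *\<^sub>R y) - t * p y"
        using that by (simp add: field_simps)
    qed
    then show ?thesis
      using that by (simp add: field_simps)
  qed
  have "lower_along y p (c *\<^sub>R x) = c * lower_along y p x" if "0 \<le> c" for c x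
  proof (cases "c = 0")
    case True
    have "lower_along y p 0 = (INF t\<in>{0::real..}. 0)"
      unfolding lower_along_def by (intro INF_cong refl) (simp add: sublinear_scale[OF p])
    with True show ?thesis by simp
  next
    case False
    then have c: "0 < c" using that by simp
    have "lower_along y p ((1 / c) *\<^sub>R (c *\<^sub>R x)) \<le> (1 / c) * lower_along y p (c *\<^sub>R x)"
      using c by (intro le) simp
    then have "c * lower_along y p x \<le> lower_along y p (c *\<^sub>R x)"
      using c by (simp add: field_simps)
    then show ?thesis
      using le[OF c] by (simp add: antisym)
  qed
  with add show ?thesis
    unfolding sublinear_def by blast
qed

text \<open>A minimal sublinear functional below a given one coincides with each of its own
  \<open>lower_along\<close> reductions, hence is odd, hence linear.\<close>
theorem exists_linear_below_sublinear:
  assumes p0: "sublinear p0"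
  obtains p where "linear p" "\<And>x. p x \<le> p0 x"
proof -
  define A where "A = {p. sublinear p \<and> p \<le> p0}"
  have "\<exists>m\<in>A. \<forall>a\<in>A. a \<le> m \<longrightarrow> a = m"
  proof (rule predicate_Zorn)
    show "partial_order_on A (relation_of (\<lambda>x y. y \<le> x) A)"
      by (rule partial_order_on_relation_ofI) auto
    fix C assume C: "C \<in> Chains (relation_of (\<lambda>x y. y \<le> x) A)"
    then have CA: "C \<subseteq> A" and tot: "\<And>a b. a \<in> C \<Longrightarrow> b \<in> C \<Longrightarrow> a \<le> b \<or> b \<le> a"
      by (auto simp: Chains_def relation_of_def)
    show "\<exists>u\<in>A. \<forall>a\<in>C. u \<le> a"
    proof (cases "C = {}")
      case True
      then show ?thesis using p0 by (auto simp: A_def)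
    next
      case ne: False
      define u where "u x = (INF a\<in>C. a x)" for x
      have bdd: "bdd_below ((\<lambda>a. a x) ` C)" for x
      proof (rule bdd_belowI2)
        fix a assume "a \<in> C"
        then have "sublinear a" "a (- x) \<le> p0 (- x)"
          using CA by (auto simp: A_def le_fun_def)
        then show "- p0 (- x) \<le> a x"
          using sublinear_uminus[of a x] by linarith
      qed
      have u_le: "u x \<le> a x" if "a \<in> C" for a x
        unfolding u_def using that by (rule cINF_lower[OF bdd])
      have u_gr: "b \<le> u x" if "\<And>a. a \<in> C \<Longrightarrow> b \<le> a x" for b x
        unfolding u_def using ne that by (rule cINF_greatest)
      have sub: "sublinear a" if "a \<in> C" for a
        using that CA by (auto simp: A_def)
      have "u (x + y) \<le> u x + u y" for x y
      proof -
        have "u (x + y) - u x \<le> u y"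
        proof (rule u_gr)
          fix a assume a: "a \<in> C"
          have "u (x + y) - a y \<le> u x"
          proof (rule u_gr)
            fix b assume b: "b \<in> C"
            obtain d where d: "d \<in> C" "d \<le> a" "d \<le> b"
              using tot[OF a b] a b by blast
            have "u (x + y) \<le> d x + d y"
              using u_le[OF d(1)] sublinear_add[OF sub[OF d(1)]] order_trans by blast
            also have "\<dots> \<le> b x + a y"
              using d(2,3) by (intro add_mono) (auto simp: le_fun_def)
            finally show "u (x + y) - a y \<le> b x" by simp
          qed
          then show "u (x + y) - u x \<le> a y" by simp
        qed
        then show ?thesis by simp
      qed
      moreover have "u (c *\<^sub>R x) = c * u x" if c: "0 \<le> c" for c x
      proof (cases "c = 0")
        case True
        have "u 0 = (INF a\<in>C. 0)"
          unfolding u_def by (intro INF_cong refl) (simp add: sublinear_zero sub)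
        with True ne show ?thesis by simp
      next
        case False
        then have c: "0 < c" using c by simp
        show ?thesis
        proof (rule antisym)
          have "u (c *\<^sub>R x) / c \<le> u x"
            by (rule u_gr) (use u_le[of _ "c *\<^sub>R x"] c sub in \<open>force simp: sublinear_scale field_simps\<close>)
          then show "u (c *\<^sub>R x) \<le> c * u x" using c by (simp add: field_simps)
          show "c * u x \<le> u (c *\<^sub>R x)"
            by (rule u_gr) (use u_le[of _ x] c sub in \<open>simp add: sublinear_scale\<close>)
        qed
      qed
      ultimately have "sublinear u" by (simp add: sublinear_def)
      moreover have "u \<le> p0"
      proof (rule le_funI)
        fix x
        obtain a where "a \<in> C" using ne by blast
        moreover from this have "a x \<le> p0 x"
          using CA by (auto simp: A_def le_fun_def)
        ultimately show "u x \<le> p0 x"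
          using u_le[of a x] by linarith
      qed
      ultimately show ?thesis
        using u_le by (auto simp: A_def le_fun_def)
    qed
  qed
  then obtain p where p: "sublinear p" "p \<le> p0"
    and min: "\<And>a. sublinear a \<Longrightarrow> a \<le> p \<Longrightarrow> a = p"
    unfolding A_def using order_trans by blast
  have odd: "p (- y) = - p y" for y
  proof -
    have "lower_along y p \<le> p"
      using lower_along_le[OF p(1), of 0 y] by (auto simp: le_fun_def)
    then have "lower_along y p = p"
      by (intro min sublinear_lower_along p(1))
    then have "p (- y) \<le> - p y"
      using lower_along_le[OF p(1), of 1 y "- y"] sublinear_zero[OF p(1)] by simp
    moreover have "- p (- y) \<le> p y"
      by (rule sublinear_uminus[OF p(1)])
    ultimately show ?thesis by simp
  qed
  have "linear p"
  proof
    show "p (x + y) = p x + p y" for x y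
      using sublinear_add[OF p(1), of x y] sublinear_add[OF p(1), of "- x" "- y"]
        odd[of x] odd[of y] odd[of "x + y"] by simp
    show "p (c *\<^sub>R x) = c *\<^sub>R p x" for c x
    proof (cases "0 \<le> c")
      case True
      then show ?thesis by (simp add: sublinear_scale[OF p(1)])
    next
      case False
      then show ?thesis
        using sublinear_scale[OF p(1), of "- c" x] odd[of "c *\<^sub>R x"] by simp
    qed
  qed
  then show ?thesis
    using that p(2) by (auto simp: le_fun_def)
qed

text \<open>Starting from the norm reduced along \<open>e\<close>, rather than from the norm, forces
  \<open>p (- e) \<le> - norm e\<close>. The linear functional below it is then bounded by the norm
  and positive at \<open>e\<close>, and dividing by \<open>p e\<close> normalises it.\<close>

theorem exists_bounded_linear_functional:
  fixes e :: "'a::real_normed_vector"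
  assumes "e \<noteq> 0"
  obtains \<psi> :: "'a \<Rightarrow> real" where "bounded_linear \<psi>" "\<psi> e = 1"
proof -
  have norm: "sublinear (norm :: 'a \<Rightarrow> real)"
    by (auto simp: sublinear_def norm_triangle_ineq)
  obtain p where p: "linear p" "\<And>x. p x \<le> lower_along e norm x"
    using exists_linear_below_sublinear[OF sublinear_lower_along[OF norm]] by blast
  have le: "p x \<le> norm x" for x
    using p(2)[of x] lower_along_le[OF norm, of 0 e x] by simp
  have "p (- e) \<le> - norm e"
    using p(2)[of "- e"] lower_along_le[OF norm, of 1 e "- e"] by simp
  then have pe: "p e > 0"
    using assms linear_neg[OF p(1), of e] by (smt (verit) zero_less_norm_iff)
  have "bounded_linear p"
  proof (rule bounded_linear_intro[where K = 1])
    show "norm (p x) \<le> norm x * 1" for x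
      using le[of x] le[of "- x"] linear_neg[OF p(1), of x] by (auto simp: abs_le_iff)
  qed (simp_all add: linear_add[OF p(1)] linear_scale[OF p(1)])
  then have "bounded_linear (\<lambda>x. p x / p e)"
    by (intro bounded_linear_divide[THEN bounded_linear_compose]) 
  then show ?thesis
    using that[of "\<lambda>x. p x / p e"] pe by simp
qed

lemma exists_biorthogonal_system:
  fixes dummy :: "'a::real_normed_vector itself"
  assumes "\<And>B :: 'a set. finite B \<Longrightarrow> card B < m \<Longrightarrow> span B \<noteq> UNIV"
  shows "\<exists>(e :: nat \<Rightarrow> 'a) (\<phi> :: nat \<Rightarrow> 'a \<Rightarrow> real). (\<forall>i<m. bounded_linear (\<phi> i)) \<and>
    (\<forall>i<m. \<forall>j<m. \<phi> i (e j) = (if i = j then 1 else 0 :: real))"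
  using assms
proof (induction m)
  case 0
  then show ?case by auto
next
  case (Suc m)
  then obtain e :: "nat \<Rightarrow> 'a" and \<phi> where \<phi>: "\<And>i. i < m \<Longrightarrow> bounded_linear (\<phi> i)"
    and dual: "\<And>i j. i < m \<Longrightarrow> j < m \<Longrightarrow> \<phi> i (e j) = (if i = j then 1 else 0 :: real)"
    by (metis less_SucI)
  have "card (e ` {..<m}) < Suc m"
    using card_image_le[of "{..<m}" e] by simp
  then obtain x where x: "x \<notin> span (e ` {..<m})"
    using Suc.prems[of "e ` {..<m}"] by blast
  \<comment> \<open>Removing the components seen by the old functionals makes \<open>v\<close>
    invisible to them; it is nonzero because \<open>x\<close> is outside the span of the old
    vectors.\<close>
  define v where "v = x - (\<Sum>i<m. \<phi> i x *\<^sub>R e i)"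
  have "(\<Sum>i<m. \<phi> i x *\<^sub>R e i) \<in> span (e ` {..<m})"
    by (intro span_sum span_scale span_base) auto
  with x have "v \<noteq> 0" unfolding v_def by auto
  then obtain \<psi> :: "'a \<Rightarrow> real" where \<psi>: "bounded_linear \<psi>" "\<psi> v = 1"
    using exists_bounded_linear_functional by blast
  have \<phi>v: "\<phi> i v = 0" if "i < m" for i
  proof -
    interpret bounded_linear "\<phi> i" by (rule \<phi>[OF that])
    have "(\<Sum>j<m. \<phi> j x * \<phi> i (e j)) = (\<Sum>j<m. if j = i then \<phi> j x else 0)"
      using that by (intro sum.cong) (auto simp: dual)
    also have "\<dots> = \<phi> i x" using that by simp
    finally show ?thesis by (simp add: v_def diff sum scaleR)
  qed
  \<comment> \<open>Conversely, the new functional is corrected to vanish on the old vectors. Its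
    value 1 at \<open>v\<close> survives, since every old \<open>\<phi> j\<close> kills
    \<open>v\<close>.\<close>
  define \<phi>' where "\<phi>' i = (if i = m then (\<lambda>x. \<psi> x - (\<Sum>j<m. \<psi> (e j) * \<phi> j x)) else \<phi> i)" for i
  define e' where "e' i = (if i = m then v else e i)" for i
  have "bounded_linear (\<lambda>x. \<psi> x - (\<Sum>j<m. \<psi> (e j) * \<phi> j x))"
    by (intro bounded_linear_sub \<psi> bounded_linear_sum bounded_linear_const_mult \<phi>) auto
  then have "\<forall>i<Suc m. bounded_linear (\<phi>' i)"
    by (auto simp: \<phi>'_def \<phi> less_Suc_eq)
  moreover have "\<phi>' i (e' j) = (if i = j then 1 else 0)" if "i < Suc m" "j < Suc m" for i j
  proof -
    have "(\<Sum>k<m. \<psi> (e k) * \<phi> k (e j)) = (\<Sum>k<m. if k = j then \<psi> (e k) else 0)" if "j < m"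
      using that by (intro sum.cong) (auto simp: dual)
    then show ?thesis
      using that \<psi>(2) by (auto simp: \<phi>'_def e'_def \<phi>v dual less_Suc_eq)
  qed
  ultimately show ?case by blast
qed

text \<open>With \<open>n + 1\<close> biorthogonal pairs, \<open>\<pi>\<close> collects the
  functionals and \<open>\<sigma>\<close> combines the vectors. Through \<open>\<sigma>\<close> a
  surface can later be moved so that its projection changes in a prescribed way.\<close>

lemma exists_projection:
  assumes "\<And>B :: 'a::real_normed_vector set. finite B \<Longrightarrow> card B \<le> CARD('n::finite) \<Longrightarrow> span B \<noteq> UNIV"
  obtains \<pi> :: "'a::real_normed_vector \<Rightarrow> (real ^ 'n::finite) \<times> real" and \<sigma>
  where "bounded_linear \<pi>" "bounded_linear \<sigma>" "\<And>v. \<pi> (\<sigma> v) = v"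
proof -
  define n where "n = CARD('n)"
  obtain e :: "nat \<Rightarrow> 'a" and \<phi> where \<phi>: "\<And>i. i < Suc n \<Longrightarrow> bounded_linear (\<phi> i)"
    and dual: "\<And>i j. i < Suc n \<Longrightarrow> j < Suc n \<Longrightarrow> \<phi> i (e j) = (if i = j then 1 else 0 :: real)"
    using exists_biorthogonal_system[where m = "Suc n" and 'a = 'a] assms
    unfolding n_def less_Suc_eq_le by blast
  obtain h :: "'n \<Rightarrow> nat" where h: "bij_betw h UNIV {0..<n}"
    unfolding n_def using ex_bij_betw_finite_nat[of "UNIV :: 'n set"] by auto
  have hn: "h i < n" for i using h by (auto simp: bij_betw_def)
  have hinj: "h i = h j \<longleftrightarrow> i = j" for i j
    using h by (auto simp: bij_betw_def inj_on_def)
  define \<pi> where "\<pi> x = ((\<chi> i. \<phi> (h i) x) :: real ^ 'n, \<phi> n x)" for x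
  define \<sigma> where "\<sigma> v = (\<Sum>i\<in>UNIV. fst v $ i *\<^sub>R e (h i)) + snd v *\<^sub>R e n" for v :: "(real ^ 'n) \<times> real"
  have lam: "bounded_linear (\<lambda>x. (\<chi> i. \<phi> (h i) x) :: real ^ 'n)"
  proof -
    have "(\<lambda>x. (\<chi> i. \<phi> (h i) x) :: real ^ 'n) = (\<lambda>x. \<Sum>i\<in>UNIV. \<phi> (h i) x *\<^sub>R axis i 1)"
      by (auto simp: vec_eq_iff axis_def if_distrib cong: if_cong)
    moreover have "bounded_linear (\<lambda>x. \<Sum>i\<in>UNIV. \<phi> (h i) x *\<^sub>R (axis i 1 :: real ^ 'n))"
      by (intro bounded_linear_sum bounded_linear_scaleR_const \<phi>) (use hn less_SucI in blast)
    ultimately show ?thesis by simp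
  qed
  have "bounded_linear \<pi>"
    unfolding \<pi>_def by (intro bounded_linear_Pair lam \<phi>) simp
  moreover have "bounded_linear \<sigma>"
    unfolding \<sigma>_def
    by (intro bounded_linear_add bounded_linear_sum bounded_linear_scaleR_const bounded_linear_snd
        bounded_linear_compose[OF bounded_linear_vec_nth] bounded_linear_fst)
  moreover have "\<pi> (\<sigma> v) = v" for v
  proof -
    have \<phi>\<sigma>: "\<phi> m (\<sigma> v) = (\<Sum>i\<in>UNIV. fst v $ i * (if m = h i then 1 else 0)) + snd v * (if m = n then 1 else 0)"
      if "m < Suc n" for m
    proof -
      interpret bounded_linear "\<phi> m" by (rule \<phi>[OF that])
      show ?thesis
        unfolding \<sigma>_def using that hn less_SucI[OF hn] by (simp add: add sum scaleR dual)
    qed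
    have "(\<Sum>i\<in>UNIV. fst v $ i * (if h j = h i then 1 else 0)) = fst v $ j" for j
      by (simp add: hinj if_distrib cong: if_cong)
    moreover have "n \<noteq> h i" "h i \<noteq> n" for i
      using hn[of i] by auto
    ultimately show ?thesis
      by (auto simp: \<pi>_def prod_eq_iff vec_eq_iff \<phi>\<sigma> hn less_SucI)
  qed
  ultimately show ?thesis by (rule that)
qed

section \<open>Calibrations\<close>

definition pos_sq :: "real \<Rightarrow> real" where
  "pos_sq x = (max 0 x)\<^sup>2"

lemma pos_sq_nonneg: "0 \<le> pos_sq x"
  by (simp add: pos_sq_def)

lemma has_real_derivative_pos_sq: "(pos_sq has_real_derivative 2 * max 0 x) (at x)"
proof -
  consider "x < 0" | "x = 0" | "x > 0" by linarith
  then show ?thesis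
  proof cases
    case 1
    have "((\<lambda>_. 0) has_real_derivative 2 * max 0 x) (at x)"
      using 1 by auto
    then show ?thesis
      by (rule has_field_derivative_transform_within_open[of _ _ _ "{..<0}"])
        (use 1 in \<open>auto simp: pos_sq_def\<close>)
  next
    case 2
    have "((\<lambda>h. (pos_sq (0 + h) - pos_sq 0) / h) \<longlongrightarrow> 0) (at 0)"
    proof (rule Lim_null_comparison)
      show "\<forall>\<^sub>F h in at 0. norm ((pos_sq (0 + h) - pos_sq 0) / h) \<le> \<bar>h\<bar>"
        by (auto simp: pos_sq_def eventually_at_filter max_def power2_eq_square)
      show "((\<lambda>h::real. \<bar>h\<bar>) \<longlongrightarrow> 0) (at 0)"
        by (intro tendsto_rabs_zero tendsto_ident_at)
    qed
    then show ?thesis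
      using 2 by (simp add: DERIV_def)
  next
    case 3
    have "((\<lambda>y. y\<^sup>2) has_real_derivative 2 * max 0 x) (at x)"
      using 3 by (auto intro!: derivative_eq_intros)
    then show ?thesis
      by (rule has_field_derivative_transform_within_open[of _ _ _ "{0<..}"])
        (use 3 in \<open>auto simp: pos_sq_def\<close>)
  qed
qed

lemmas has_derivative_pos_sq [derivative_intros] =
  has_derivative_compose[OF _ has_real_derivative_pos_sq[THEN has_field_derivative_imp_has_derivative]]

lemma continuous_on_pos_sq [continuous_intros]:
  "continuous_on A f \<Longrightarrow> continuous_on A (\<lambda>x. pos_sq (f x))"
  unfolding pos_sq_def by (intro continuous_intros)

text \<open>A smoothed truncation: the identity on \<open>[-1,1]\<close>, constant outside \<open>[-2,2]\<close>.\<close>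
definition trunc :: "real \<Rightarrow> real" where
  "trunc s = s - pos_sq (s - 1) / 2 + pos_sq (s - 2) / 2 + pos_sq (- s - 1) / 2 - pos_sq (- s - 2) / 2"

definition trunc' :: "real \<Rightarrow> real" where
  "trunc' s = 1 - max 0 (s - 1) + max 0 (s - 2) - max 0 (- s - 1) + max 0 (- s - 2)"

lemma has_derivative_trunc [derivative_intros]:
  assumes "(f has_derivative f') (at x within S)"
  shows "((\<lambda>x. trunc (f x)) has_derivative (\<lambda>v. trunc' (f x) * f' v)) (at x within S)"
  unfolding trunc_def trunc'_def
  by (auto intro!: derivative_eq_intros assms simp: algebra_simps)

lemma continuous_on_trunc' [continuous_intros]:
  "continuous_on A f \<Longrightarrow> continuous_on A (\<lambda>x. trunc' (f x))"
  unfolding trunc'_def by (intro continuous_intros)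

lemma trunc'_bounds: "0 \<le> trunc' s" "trunc' s \<le> 1"
  by (auto simp: trunc'_def max_def)

lemma trunc'_eq_1: "\<bar>s\<bar> \<le> 1 \<Longrightarrow> trunc' s = 1"
  by (auto simp: trunc'_def max_def)

lemma abs_trunc_le: "\<bar>trunc s\<bar> \<le> 2"
proof -
  have up: "trunc s \<le> 2 \<and> 0 \<le> trunc s" if "0 \<le> s" for s
  proof -
    consider "s \<le> 1" | "1 \<le> s" "s \<le> 2" | "2 \<le> s" using that by linarith
    then show ?thesis
    proof cases
      case 2
      have "(s - 1)\<^sup>2 \<le> 1\<^sup>2" using 2 by (intro power_mono) auto
      moreover have "trunc s = s - (s - 1)\<^sup>2 / 2"
        using 2 by (simp add: trunc_def pos_sq_def)
      ultimately show ?thesis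
        using 2 zero_le_power2[of "s - 1"] by (intro conjI; simp only: one_power2; linarith)
    next
      case 3
      then have "trunc s = 3 / 2"
        by (simp add: trunc_def pos_sq_def) (simp add: power2_eq_square field_simps)
      then show ?thesis by simp
    qed (use that in \<open>auto simp: trunc_def pos_sq_def\<close>)
  qed
  have "trunc (- s) = - trunc s"
    by (simp add: trunc_def)
  then show ?thesis
    using up[of s] up[of "- s"] by (cases "0 \<le> s") auto
qed

text \<open>Centred at 4 because the holes sit at height \<open>4 * 2 ^ (- j)\<close>. The outer
  square is there to control \<open>bump'\<close> by the root of \<open>bump\<close>, see
  \<open>bump'_sq_le\<close>.\<close>

definition bump :: "real \<Rightarrow> real" where
  "bump s = pos_sq (1 - (s - 4)\<^sup>2)"

definition bump' :: "real \<Rightarrow> real" where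
  "bump' s = - 4 * max 0 (1 - (s - 4)\<^sup>2) * (s - 4)"

lemma has_derivative_bump [derivative_intros]:
  assumes "(f has_derivative f') (at x within S)"
  shows "((\<lambda>x. bump (f x)) has_derivative (\<lambda>v. bump' (f x) * f' v)) (at x within S)"
  unfolding bump_def bump'_def
  by (auto intro!: derivative_eq_intros assms simp: algebra_simps)

lemma continuous_on_bump [continuous_intros]:
  "continuous_on A f \<Longrightarrow> continuous_on A (\<lambda>x. bump (f x))"
  unfolding bump_def by (intro continuous_intros)

lemma continuous_on_bump' [continuous_intros]:
  "continuous_on A f \<Longrightarrow> continuous_on A (\<lambda>x. bump' (f x))"
  unfolding bump'_def by (intro continuous_intros)

lemma bump_nonneg: "0 \<le> bump s"
  by (simp add: bump_def pos_sq_nonneg)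

lemma bump_le_1: "bump s \<le> 1"
proof -
  have "(max 0 (1 - (s - 4)\<^sup>2))\<^sup>2 \<le> 1\<^sup>2"
    by (intro power_mono) auto
  then show ?thesis by (simp add: bump_def pos_sq_def)
qed

lemma bump_support:
  assumes "s \<le> 3 \<or> 5 \<le> s"
  shows "bump s = 0" "bump' s = 0"
proof -
  have "1\<^sup>2 \<le> (s - 4)\<^sup>2"
    by (subst abs_le_square_iff[symmetric]) (use assms in auto)
  then show "bump s = 0" "bump' s = 0"
    by (auto simp: bump_def bump'_def pos_sq_def)
qed

text \<open>If \<open>g\<close> is the positive part of \<open>1 - (s - 4)\<^sup>2\<close>, then
  \<open>bump = g\<^sup>2\<close> and \<open>bump' = - 4 g (s - 4)\<close>, with
  \<open>\<bar>s - 4\<bar> \<le> 1\<close> on the support. So the vertical derivative of a layer can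
  be paid for by the gain of that layer.\<close>

lemma bump'_sq_le: "(bump' s)\<^sup>2 \<le> 16 * bump s"
proof (cases "1 - (s - 4)\<^sup>2 \<le> 0")
  case True
  then show ?thesis by (simp add: bump'_def bump_def pos_sq_def)
next
  case False
  then have "(s - 4)\<^sup>2 \<le> 1" by simp
  have "(bump' s)\<^sup>2 = 16 * bump s * (s - 4)\<^sup>2"
    by (simp add: bump'_def bump_def pos_sq_def power_mult_distrib)
  also have "\<dots> \<le> 16 * bump s * 1"
    using \<open>(s - 4)\<^sup>2 \<le> 1\<close> by (intro mult_left_mono) (auto simp: bump_nonneg)
  finally show ?thesis by simp
qed

lemma bump_ge:
  assumes "\<bar>s - 4\<bar> < 1 / 2"
  shows "1 / 2 \<le> bump s"
proof -
  have "(s - 4)\<^sup>2 \<le> (1 / 2)\<^sup>2"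
    by (subst abs_le_square_iff[symmetric]) (use assms in auto)
  then have "(3 / 4)\<^sup>2 \<le> (1 - (s - 4)\<^sup>2)\<^sup>2"
    by (intro power_mono) (auto simp: power2_eq_square)
  then show ?thesis
    using \<open>(s - 4)\<^sup>2 \<le> (1 / 2)\<^sup>2\<close> by (simp add: bump_def pos_sq_def power2_eq_square)
qed

lemma bump_lipschitz: "\<bar>bump s - bump t\<bar> \<le> 4 * \<bar>s - t\<bar>"
proof -
  have bnd: "\<bar>bump' x\<bar> \<le> 4" for x
  proof -
    have "(bump' x)\<^sup>2 \<le> 4\<^sup>2"
      using bump'_sq_le[of x] bump_le_1[of x] by simp
    then show ?thesis using abs_le_square_iff[of "bump' x" 4] by simp
  qed
  have "norm (bump s - bump t) \<le> 4 * norm (s - t)"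
  proof (rule field_differentiable_bound[of UNIV _ bump'])
    show "(bump has_real_derivative bump' z) (at z within UNIV)" for z
      using has_derivative_bump[OF has_derivative_ident, of z UNIV]
      by (simp add: has_field_derivative_def)
    show "norm (bump' z) \<le> 4" for z using bnd by simp
  qed auto
  then show ?thesis by simp
qed

section \<open>A periodic Hardy field\<close>

text \<open>A periodic substitute for \<open>\<bar>y\<bar>\<^sup>2\<close>, which is its limit as
  \<open>\<omega> \<rightarrow> 0\<close>. The period \<open>2 * pi / \<omega>\<close> will be the
  rescaled grid mesh.\<close>

definition lat :: "real \<Rightarrow> real ^ 'n::finite \<Rightarrow> real" where
  "lat \<omega> y = (\<Sum>i\<in>UNIV. 2 * (1 - cos (\<omega> * y $ i)) / \<omega>\<^sup>2)"

definition lat' :: "real \<Rightarrow> real ^ 'n::finite \<Rightarrow> real ^ 'n \<Rightarrow> real" where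
  "lat' \<omega> y v = (\<Sum>i\<in>UNIV. 2 * sin (\<omega> * y $ i) / \<omega> * v $ i)"

text \<open>Half the gradient of \<open>lat \<omega>\<close>, hence the periodic substitute for the
  field \<open>y\<close>.\<close>

definition swirl :: "real \<Rightarrow> real ^ 'n::finite \<Rightarrow> real ^ 'n" where
  "swirl \<omega> y = (\<Sum>i\<in>UNIV. (sin (\<omega> * y $ i) / \<omega>) *\<^sub>R axis i 1)"

definition swirl' :: "real \<Rightarrow> real ^ 'n::finite \<Rightarrow> real ^ 'n \<Rightarrow> real ^ 'n" where
  "swirl' \<omega> y v = (\<Sum>i\<in>UNIV. (cos (\<omega> * y $ i) * v $ i) *\<^sub>R axis i 1)"

text \<open>A periodic version of the field \<open>y / (1 + \<bar>y\<bar>\<^sup>2)\<close>, whose divergence dominates its squared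
  norm when \<open>n > 2\<close> (Hardy's inequality).\<close>
definition cell :: "real \<Rightarrow> real ^ 'n::finite \<Rightarrow> real ^ 'n" where
  "cell \<omega> y = (1 / (1 + lat \<omega> y)) *\<^sub>R swirl \<omega> y"

definition cell' :: "real \<Rightarrow> real ^ 'n::finite \<Rightarrow> real ^ 'n \<Rightarrow> real ^ 'n" where
  "cell' \<omega> y v = (1 / (1 + lat \<omega> y)) *\<^sub>R swirl' \<omega> y v - (lat' \<omega> y v / (1 + lat \<omega> y)\<^sup>2) *\<^sub>R swirl \<omega> y"

lemma sum_scaleR_axis: "(\<Sum>i\<in>UNIV. c i *\<^sub>R axis i (1::real)) = (\<chi> i. c i)"
  by (auto simp: vec_eq_iff axis_def if_distrib cong: if_cong)

lemma lat_nonneg: "0 \<le> lat \<omega> y"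
  unfolding lat_def by (intro sum_nonneg) auto

lemma has_derivative_vec_nth' [derivative_intros]:
  "(f has_derivative f') F \<Longrightarrow> ((\<lambda>x. f x $ i) has_derivative (\<lambda>v. f' v $ i)) F"
  by (rule bounded_linear.has_derivative[OF bounded_linear_vec_nth])

lemma has_derivative_cell [derivative_intros]:
  assumes "\<omega> \<noteq> 0" "(f has_derivative f') (at x within S)"
  shows "((\<lambda>x. cell \<omega> (f x)) has_derivative (\<lambda>v. cell' \<omega> (f x) (f' v))) (at x within S)"
proof -
  have lat: "((\<lambda>x. lat \<omega> (f x)) has_derivative (\<lambda>v. lat' \<omega> (f x) (f' v))) (at x within S)"
    unfolding lat_def lat'_def using assms(1)
    by (auto intro!: derivative_eq_intros assms(2) simp: power2_eq_square field_simps)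
  have swirl: "((\<lambda>x. swirl \<omega> (f x)) has_derivative (\<lambda>v. swirl' \<omega> (f x) (f' v))) (at x within S)"
    unfolding swirl_def swirl'_def using assms(1)
    by (auto intro!: derivative_eq_intros assms(2) simp: field_simps)
  have "1 + lat \<omega> (f x) \<noteq> 0"
    using lat_nonneg[of \<omega> "f x"] by linarith
  then show ?thesis
    unfolding cell_def cell'_def
    by (auto intro!: derivative_eq_intros lat swirl simp: power2_eq_square field_simps)
qed

lemma continuous_on_cell [continuous_intros]:
  fixes f :: "'b::t2_space \<Rightarrow> real ^ 'n::finite"
  assumes f: "continuous_on A f" shows "continuous_on A (\<lambda>x. cell \<omega> (f x))"
    and continuous_on_cell': "continuous_on A (\<lambda>x. cell' \<omega> (f x) v)"
proof -
  have nth: "continuous_on A (\<lambda>x. \<omega> * f x $ i)" for i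
    by (intro continuous_on_mult continuous_on_const continuous_on_component f)
  note trig = continuous_on_cos[OF nth] continuous_on_sin[OF nth]
  have lat: "continuous_on A (\<lambda>x. lat \<omega> (f x))" "continuous_on A (\<lambda>x. lat' \<omega> (f x) v)"
    unfolding lat_def lat'_def divide_inverse
    by (intro continuous_on_sum continuous_on_mult continuous_on_diff continuous_on_const trig)+
  have swirl: "continuous_on A (\<lambda>x. swirl \<omega> (f x))" "continuous_on A (\<lambda>x. swirl' \<omega> (f x) v)"
    unfolding swirl_def swirl'_def divide_inverse
    by (intro continuous_on_sum continuous_on_mult continuous_on_scaleR continuous_on_const trig)+
  have "1 + lat \<omega> y \<noteq> 0" for y :: "real ^ 'n"
    using lat_nonneg[of \<omega> y] by linarith
  then show "continuous_on A (\<lambda>x. cell \<omega> (f x))" "continuous_on A (\<lambda>x. cell' \<omega> (f x) v)"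
    unfolding cell_def cell'_def by (intro continuous_intros lat swirl; simp)+
qed

declare continuous_on_cell' [continuous_intros]

lemma swirl_nth: "swirl \<omega> y $ i = sin (\<omega> * y $ i) / \<omega>"
  by (simp add: swirl_def sum_scaleR_axis)

lemma norm_swirl_le:
  assumes "\<omega> \<noteq> 0"
  shows "(norm (swirl \<omega> y))\<^sup>2 \<le> lat \<omega> y"
proof -
  have "(norm (swirl \<omega> y))\<^sup>2 = (\<Sum>i\<in>UNIV. (sin (\<omega> * y $ i))\<^sup>2 / \<omega>\<^sup>2)"
    by (simp add: norm_vec_def L2_set_def sum_nonneg swirl_nth power_divide)
  also have "\<dots> \<le> lat \<omega> y"
    unfolding lat_def
  proof (intro sum_mono divide_right_mono)
    fix i
    have "(sin (\<omega> * y $ i))\<^sup>2 = (1 - cos (\<omega> * y $ i)) * (1 + cos (\<omega> * y $ i))"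
      by (simp add: sin_squared_eq power2_eq_square algebra_simps)
    also have "\<dots> \<le> (1 - cos (\<omega> * y $ i)) * 2"
      by (intro mult_left_mono) auto
    finally show "(sin (\<omega> * y $ i))\<^sup>2 \<le> 2 * (1 - cos (\<omega> * y $ i))" by simp
  qed simp
  finally show ?thesis .
qed

lemma norm_cell_le:
  assumes "\<omega> \<noteq> 0"
  shows "(norm (cell \<omega> y))\<^sup>2 \<le> 1 / (1 + lat \<omega> y)" "norm (cell \<omega> y) \<le> 1"
proof -
  define q where "q = lat \<omega> y"
  have q: "0 \<le> q" unfolding q_def by (rule lat_nonneg)
  have "(norm (cell \<omega> y))\<^sup>2 = (norm (swirl \<omega> y))\<^sup>2 / (1 + q)\<^sup>2"
    by (simp add: cell_def q_def power_divide)
  also have "\<dots> \<le> (1 + q) / (1 + q)\<^sup>2"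
    using norm_swirl_le[OF assms, of y] by (intro divide_right_mono) (auto simp: q_def)
  also have "\<dots> = 1 / (1 + q)"
    using q by (simp add: power2_eq_square)
  finally show le: "(norm (cell \<omega> y))\<^sup>2 \<le> 1 / (1 + lat \<omega> y)" by (simp add: q_def)
  also have "\<dots> \<le> 1\<^sup>2" using q by (simp add: q_def)
  finally show "norm (cell \<omega> y) \<le> 1"
    by (rule power2_le_imp_le) simp
qed

text \<open>With \<open>q = lat \<omega> y\<close> the divergence is the sum of the cosines over
  \<open>1 + q\<close>, minus \<open>2 \<bar>swirl\<bar>\<^sup>2 / (1 + q)\<^sup>2\<close>. The
  cosines sum to \<open>n - \<omega>\<^sup>2 q / 2\<close>, and
  \<open>\<bar>swirl\<bar>\<^sup>2 \<le> 1 + q\<close>, so the main term is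
  \<open>(n - 2) / (1 + q)\<close>; this is where the dimension hypothesis acts. Some loss is
  inevitable, because a periodic divergence has mean zero.\<close>

lemma divergence_cell_ge:
  fixes y :: "real ^ 'n::finite"
  assumes \<omega>: "\<omega> \<noteq> 0" and n: "2 < CARD('n)"
  shows "1 / (1 + lat \<omega> y) - \<omega>\<^sup>2 / 2 \<le> (\<Sum>i\<in>UNIV. cell' \<omega> y (axis i 1) $ i)"
proof -
  define q where "q = lat \<omega> y"
  have q: "0 \<le> q" unfolding q_def by (rule lat_nonneg)
  have lat': "lat' \<omega> y (axis i 1) = 2 * swirl \<omega> y $ i" for i
    by (simp add: lat'_def axis_def swirl_nth if_distrib cong: if_cong)
  have swirl': "swirl' \<omega> y (axis i 1) $ i = cos (\<omega> * y $ i)" for i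
    by (simp add: swirl'_def sum_scaleR_axis)
  have cosum: "(\<Sum>i\<in>UNIV. cos (\<omega> * y $ i)) = real CARD('n) - \<omega>\<^sup>2 * q / 2"
    using \<omega> by (simp add: q_def lat_def sum_divide_distrib[symmetric] sum_distrib_left[symmetric]
        sum_subtractf field_simps)
  have "(\<Sum>i\<in>UNIV. cell' \<omega> y (axis i 1) $ i)
      = (\<Sum>i\<in>UNIV. cos (\<omega> * y $ i)) / (1 + q) - 2 * (norm (swirl \<omega> y))\<^sup>2 / (1 + q)\<^sup>2"
    by (simp add: cell'_def lat' swirl' q_def sum_subtractf sum_divide_distrib norm_vec_def
        L2_set_def sum_nonneg sum_distrib_left mult.assoc power2_eq_square)
  also have "\<dots> \<ge> (real CARD('n) - \<omega>\<^sup>2 * q / 2) / (1 + q) - 2 * (1 + q) / (1 + q)\<^sup>2"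
    unfolding cosum using norm_swirl_le[OF \<omega>, of y] q
    by (intro diff_left_mono divide_right_mono mult_left_mono) (auto simp: q_def)
  also have "2 * (1 + q) / (1 + q)\<^sup>2 = 2 / (1 + q)"
    using q by (simp only: power2_eq_square) (simp add: divide_simps)
  also have "(real CARD('n) - \<omega>\<^sup>2 * q / 2) / (1 + q) - 2 / (1 + q)
      = (real CARD('n) - 2) / (1 + q) - (\<omega>\<^sup>2 / 2) * (q / (1 + q))"
    by (simp add: diff_divide_distrib)
  also have "\<dots> \<ge> 1 / (1 + q) - (\<omega>\<^sup>2 / 2) * 1"
    using n q by (intro diff_mono divide_right_mono mult_left_mono) auto
  finally show ?thesis by (simp add: q_def)
qed

section \<open>Layers beside one hyperplane\<close>

definition offset :: "real ^ 'n::finite \<Rightarrow> real \<Rightarrow> (real ^ 'n) \<times> real \<Rightarrow> real" where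
  "offset p q x = snd x - p \<bullet> fst x - q"

lemma has_derivative_offset [derivative_intros]:
  "(offset p q has_derivative (\<lambda>v. snd v - p \<bullet> fst v)) (at x within S)"
  unfolding offset_def[abs_def] by (auto intro!: derivative_eq_intros)

lemma continuous_on_offset [continuous_intros]:
  "continuous_on A f \<Longrightarrow> continuous_on A (\<lambda>x. offset p q (f x))"
  unfolding offset_def by (intro continuous_intros)

text \<open>The factor \<open>1 / 2 ^ j\<close> compensates the rescaling: derivatives have the same
  order at every scale, while the field itself becomes small.\<close>

definition layer :: "real ^ 'n::finite \<Rightarrow> real \<Rightarrow> real \<Rightarrow> nat \<Rightarrow> (real ^ 'n) \<times> real \<Rightarrow> real ^ 'n" where
  "layer p q \<omega> j x = (bump (2 ^ j * offset p q x) / 2 ^ j) *\<^sub>R cell \<omega> (2 ^ j *\<^sub>R fst x)"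

definition layer' :: "real ^ 'n::finite \<Rightarrow> real \<Rightarrow> real \<Rightarrow> nat \<Rightarrow> (real ^ 'n) \<times> real \<Rightarrow> (real ^ 'n) \<times> real \<Rightarrow> real ^ 'n" where
  "layer' p q \<omega> j x v =
     (bump' (2 ^ j * offset p q x) * (snd v - p \<bullet> fst v)) *\<^sub>R cell \<omega> (2 ^ j *\<^sub>R fst x)
     + bump (2 ^ j * offset p q x) *\<^sub>R cell' \<omega> (2 ^ j *\<^sub>R fst x) (fst v)"

text \<open>Half of the divergence gain of a layer; the other half covers the quarter lost to the
  square of the vertical derivative.\<close>

definition weight :: "real ^ 'n::finite \<Rightarrow> real \<Rightarrow> real \<Rightarrow> nat \<Rightarrow> (real ^ 'n) \<times> real \<Rightarrow> real" where
  "weight p q \<omega> j x = bump (2 ^ j * offset p q x) / (2 * (1 + lat \<omega> (2 ^ j *\<^sub>R fst x)))"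

lemma cell'_scaleR: "cell' \<omega> y (c *\<^sub>R v) = c *\<^sub>R cell' \<omega> y v"
proof -
  have "swirl' \<omega> y (c *\<^sub>R v) = c *\<^sub>R swirl' \<omega> y v"
    by (simp add: swirl'_def scaleR_sum_right mult.left_commute)
  moreover have "lat' \<omega> y (c *\<^sub>R v) = c * lat' \<omega> y v"
    by (simp add: lat'_def sum_distrib_left mult.left_commute)
  ultimately show ?thesis
    by (simp add: cell'_def scaleR_diff_right)
qed

lemma has_derivative_layer:
  assumes "\<omega> \<noteq> 0"
  shows "(layer p q \<omega> j has_derivative layer' p q \<omega> j x) (at x)"
proof -
  have b: "((\<lambda>x. bump (2 ^ j * offset p q x) / 2 ^ j) has_derivative
      (\<lambda>v. bump' (2 ^ j * offset p q x) * (snd v - p \<bullet> fst v))) (at x)"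
    by (auto intro!: derivative_eq_intros)
  have "((\<lambda>x. 2 ^ j *\<^sub>R fst x) has_derivative (\<lambda>v. 2 ^ j *\<^sub>R fst v)) (at x)"
    by (auto intro!: derivative_eq_intros)
  from has_derivative_scaleR[OF b has_derivative_cell[OF assms this]] show ?thesis
    unfolding layer_def[abs_def] layer'_def[abs_def]
    by (rule has_derivative_eq_rhs) (simp add: fun_eq_iff cell'_scaleR)
qed

lemma continuous_on_layer': "continuous_on A (\<lambda>x. layer' p q \<omega> j x v)"
  unfolding layer'_def by (intro continuous_intros)

lemma weight_nonneg: "0 \<le> weight p q \<omega> j x"
  unfolding weight_def
  by (intro divide_nonneg_nonneg mult_nonneg_nonneg add_nonneg_nonneg bump_nonneg lat_nonneg) auto

text \<open>Only the height is varied because a shear moves points vertically. The constant grows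
  with \<open>j\<close>, which forces later hyperplanes to use finer scales.\<close>

lemma weight_lipschitz: "\<bar>weight p q \<omega> j (y, z) - weight p q \<omega> j (y, z')\<bar> \<le> 4 * 2 ^ j * \<bar>z - z'\<bar>"
proof -
  define d where "d = 2 * (1 + lat \<omega> ((2::real) ^ j *\<^sub>R y))"
  have d: "1 \<le> d" using lat_nonneg[of \<omega> "(2::real) ^ j *\<^sub>R y"] by (simp add: d_def)
  define s where "s = 2 ^ j * offset p q (y, z)"
  define s' where "s' = 2 ^ j * offset p q (y, z')"
  have "\<bar>weight p q \<omega> j (y, z) - weight p q \<omega> j (y, z')\<bar> = \<bar>bump s - bump s'\<bar> / d"
    using d by (simp add: weight_def s_def s'_def d_def diff_divide_distrib[symmetric])
  also have "\<dots> \<le> \<bar>bump s - bump s'\<bar>"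
    using d by (simp add: divide_le_eq) (metis abs_ge_zero mult_left_mono mult.right_neutral)
  also have "\<dots> \<le> 4 * \<bar>s - s'\<bar>" by (rule bump_lipschitz)
  also have "s - s' = 2 ^ j * (z - z')" by (simp add: s_def s'_def offset_def algebra_simps)
  finally show ?thesis by (simp add: abs_mult)
qed

text \<open>The supports of the layers are disjoint, because \<open>bump\<close> lives on \<open>[3,5]\<close> and \<open>5 < 2 \<sqdot> 3\<close>.\<close>
lemma at_most_one_layer:
  obtains k where "\<And>j. j \<noteq> k \<Longrightarrow> bump (2 ^ j * s) = 0 \<and> bump' (2 ^ j * s) = 0"
proof (cases "\<exists>k. 3 < 2 ^ k * s \<and> 2 ^ k * s < 5")
  case False
  then show ?thesis
    using that[of undefined] bump_support by (metis not_le)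
next
  case True
  then obtain k where k: "3 < 2 ^ k * s" "2 ^ k * s < 5" by blast
  have s: "0 < s" using k(1) by (smt (verit) mult_nonneg_nonpos zero_le_power)
  show ?thesis
  proof (rule that)
    fix j assume "j \<noteq> k"
    have "2 ^ j * s \<le> 3 \<or> 5 \<le> 2 ^ j * s"
    proof (cases "j < k")
      case True
      have "2 * 2 ^ j * s \<le> 2 ^ k * s"
        using s True power_increasing[of "Suc j" k "2::real"] by (intro mult_right_mono) auto
      with k show ?thesis by linarith
    next
      case False
      have "2 * 2 ^ k * s \<le> 2 ^ j * s"
        using s False \<open>j \<noteq> k\<close> power_increasing[of "Suc k" j "2::real"] by (intro mult_right_mono) auto
      with k show ?thesis by linarith
    qed
    then show "bump (2 ^ j * s) = 0 \<and> bump' (2 ^ j * s) = 0"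
      using bump_support by blast
  qed
qed

text \<open>For a scalar function \<open>u\<close> on \<open>real ^ 'n\<close>, the divergence of \<open>y \<mapsto> S (y, u y)\<close> is the sum below
  plus \<open>S' (y, u y) (0, 1) \<bullet> \<nabla>u\<close>. The last condition therefore says that
  \<open>\<psi> - e \<le> div + 16 \<bar>\<nabla>u\<bar>\<^sup>2\<close> whatever \<open>\<nabla>u\<close> is.\<close>
definition calibration ::
    "((real ^ 'n::finite) \<times> real \<Rightarrow> real ^ 'n) \<Rightarrow> ((real ^ 'n) \<times> real \<Rightarrow> (real ^ 'n) \<times> real \<Rightarrow> real ^ 'n) \<Rightarrow>
     ((real ^ 'n) \<times> real \<Rightarrow> real) \<Rightarrow> real \<Rightarrow> real \<Rightarrow> bool" where
  "calibration S S' \<psi> e M \<longleftrightarrow>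
     (\<forall>x. (S has_derivative S' x) (at x)) \<and> (\<forall>v. continuous_on UNIV (\<lambda>x. S' x v)) \<and>
     (\<forall>x. norm (S x) \<le> M) \<and>
     (\<forall>x. \<psi> x - e \<le> (\<Sum>i\<in>UNIV. S' x (axis i 1, 0) $ i) - (norm (S' x (0, 1)))\<^sup>2 / 64)"

text \<open>Near the graph of \<open>y \<mapsto> p \<bullet> y + q\<close> the field is replaced by the constant one whose optimal slope
  is \<open>p\<close>. The identity behind \<open>calibration_shear\<close> is
  \<open>G\<^sub>1 = G + (2\<theta> - \<theta>\<^sup>2) \<bar>W + 32p\<bar>\<^sup>2 / 64\<close>.\<close>
definition shear ::
    "((real ^ 'n::finite) \<times> real \<Rightarrow> real ^ 'n) \<Rightarrow> real ^ 'n \<Rightarrow> real \<Rightarrow> real \<Rightarrow> (real ^ 'n) \<times> real \<Rightarrow> real ^ 'n" where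
  "shear S p q \<tau> x = S (fst x, snd x - \<tau> * trunc (offset p q x / \<tau>))
     - (32 * \<tau> * trunc (offset p q x / \<tau>)) *\<^sub>R p"

definition shear' ::
    "((real ^ 'n::finite) \<times> real \<Rightarrow> (real ^ 'n) \<times> real \<Rightarrow> real ^ 'n) \<Rightarrow> real ^ 'n \<Rightarrow> real \<Rightarrow> real \<Rightarrow>
      (real ^ 'n) \<times> real \<Rightarrow> (real ^ 'n) \<times> real \<Rightarrow> real ^ 'n" where
  "shear' S' p q \<tau> x v =
     S' (fst x, snd x - \<tau> * trunc (offset p q x / \<tau>))
       (fst v, snd v - trunc' (offset p q x / \<tau>) * (snd v - p \<bullet> fst v))
     - (32 * trunc' (offset p q x / \<tau>) * (snd v - p \<bullet> fst v)) *\<^sub>R p"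

lemma has_derivative_shear:
  assumes S: "\<And>x. (S has_derivative S' x) (at x)" and \<tau>: "0 < \<tau>"
  shows "(shear S p q \<tau> has_derivative shear' S' p q \<tau> x) (at x)"
proof -
  have off: "((\<lambda>x. offset p q x / \<tau>) has_derivative (\<lambda>v. (snd v - p \<bullet> fst v) / \<tau>)) (at x)"
    using \<tau> by (auto intro!: derivative_eq_intros)
  have tr: "((\<lambda>x. \<tau> * trunc (offset p q x / \<tau>)) has_derivative
      (\<lambda>v. trunc' (offset p q x / \<tau>) * (snd v - p \<bullet> fst v))) (at x)"
    by (rule has_derivative_eq_rhs[OF has_derivative_mult_right[OF has_derivative_trunc[OF off]]])
      (use \<tau> in simp)
  have "((\<lambda>x. (fst x, snd x - \<tau> * trunc (offset p q x / \<tau>))) has_derivative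
      (\<lambda>v. (fst v, snd v - trunc' (offset p q x / \<tau>) * (snd v - p \<bullet> fst v)))) (at x)"
    by (intro has_derivative_Pair has_derivative_diff tr bounded_linear_imp_has_derivative
        bounded_linear_fst bounded_linear_snd)
  from has_derivative_compose[OF this S]
  have 1: "((\<lambda>x. S (fst x, snd x - \<tau> * trunc (offset p q x / \<tau>))) has_derivative
      (\<lambda>v. S' (fst x, snd x - \<tau> * trunc (offset p q x / \<tau>))
        (fst v, snd v - trunc' (offset p q x / \<tau>) * (snd v - p \<bullet> fst v)))) (at x)" .
  have 2: "((\<lambda>x. (32 * (\<tau> * trunc (offset p q x / \<tau>))) *\<^sub>R p) has_derivative
      (\<lambda>v. (32 * (trunc' (offset p q x / \<tau>) * (snd v - p \<bullet> fst v))) *\<^sub>R p)) (at x)"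
    by (intro has_derivative_scaleR_left has_derivative_mult_right tr)
  show ?thesis
    using has_derivative_diff[OF 1 2]
    unfolding shear_def[abs_def] shear'_def[abs_def] by (simp add: mult.assoc)
qed

lemma continuous_on_shear':
  assumes S: "\<And>x. (S has_derivative S' x) (at x)" and cont: "\<And>v. continuous_on UNIV (\<lambda>x. S' x v)"
    and \<tau>: "0 < \<tau>"
  shows "continuous_on UNIV (\<lambda>x. shear' S' p q \<tau> x v)"
proof -
  define g where "g x = (fst x, snd x - \<tau> * trunc (offset p q x / \<tau>))" for x
  have "continuous_on UNIV (\<lambda>x. trunc (offset p q x / \<tau>))"
    unfolding trunc_def using \<tau> by (intro continuous_intros) auto
  then have g: "continuous_on UNIV g"
    unfolding g_def by (intro continuous_intros)
  have comp: "continuous_on UNIV (\<lambda>x. S' (g x) w)" for w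
    using continuous_on_compose2[OF cont[of w] g] by auto
  \<comment> \<open>The direction fed to \<open>S'\<close> depends on the point as well, so its
    vertical part is split off before continuity for fixed directions is applied.\<close>
  have lin: "S' y (a, b) = S' y (a, 0) + b *\<^sub>R S' y (0, 1)" for y a b
    using linear_add[OF has_derivative_linear[OF S], of y "(a, 0)" "(0, b)"]
      linear_scale[OF has_derivative_linear[OF S], of y b "(0, 1)"] by simp
  have "continuous_on UNIV (\<lambda>x. trunc' (offset p q x / \<tau>))"
    using \<tau> by (intro continuous_intros) auto
  then show ?thesis
    unfolding shear'_def g_def[symmetric] by (subst lin) (intro continuous_intros comp; use \<tau> in simp)
qed

lemma norm_shear_le:
  assumes "\<And>x. norm (S x) \<le> M" "0 < \<tau>"
  shows "norm (shear S p q \<tau> x) \<le> M + 64 * \<tau> * norm p"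
proof -
  have "norm ((32 * \<tau> * trunc (offset p q x / \<tau>)) *\<^sub>R p) = 32 * \<tau> * norm p * \<bar>trunc (offset p q x / \<tau>)\<bar>"
    using assms(2) by (simp add: abs_mult)
  also have "\<dots> \<le> 32 * \<tau> * norm p * 2"
    using assms(2) by (intro mult_left_mono abs_trunc_le) auto
  finally show ?thesis
    unfolding shear_def by (intro order_trans[OF norm_triangle_ineq4]) (use assms(1) in \<open>simp add: add_mono\<close>)
qed

text \<open>The number 32 makes \<open>p\<close> the optimal slope \<open>- W / 32\<close> of the
  completed square, so the correction in the identity is nonnegative for every
  \<open>\<theta>\<close> in \<open>[0, 1]\<close>. The second claim makes the cross term in
  \<open>calibration_step\<close> explicit.\<close>

lemma calibration_shear:
  fixes p :: "real ^ 'n::finite" and q :: real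
  assumes cal: "calibration S S' \<psi> e M" and \<tau>: "0 < \<tau>"
  defines "D \<equiv> \<lambda>x. \<Sum>i\<in>UNIV. shear' S' p q \<tau> x (axis i 1, 0) $ i"
    and "W \<equiv> \<lambda>x. shear' S' p q \<tau> x (0, 1)"
  shows "\<psi> (fst x, snd x - \<tau> * trunc (offset p q x / \<tau>)) - e \<le> D x - (norm (W x))\<^sup>2 / 64"
    and "\<bar>offset p q x\<bar> \<le> \<tau> \<Longrightarrow> W x = - 32 *\<^sub>R p"
proof -
  define \<theta> where "\<theta> = trunc' (offset p q x / \<tau>)"
  define y where "y = (fst x, snd x - \<tau> * trunc (offset p q x / \<tau>))"
  define a where "a = S' y (0, 1)"
  have S: "(S has_derivative S' x) (at x)" for x
    using cal unfolding calibration_def by blast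
  have lin: "S' y (v, b) = S' y (v, 0) + b *\<^sub>R a" for v b
    using linear_add[OF has_derivative_linear[OF S], of y "(v, 0)" "(0, b)"]
      linear_scale[OF has_derivative_linear[OF S], of y b "(0, 1)"] by (simp add: a_def)
  have zero: "S' y (0, 0) = 0"
    using linear_0[OF has_derivative_linear[OF S], of y] by (simp add: zero_prod_def)
  have W: "W x = (1 - \<theta>) *\<^sub>R a - (32 * \<theta>) *\<^sub>R p"
    using lin[of 0 "1 - \<theta>"] zero by (simp add: W_def shear'_def y_def[symmetric] \<theta>_def[symmetric])
  have "shear' S' p q \<tau> x (axis i 1, 0) $ i
      = S' y (axis i 1, 0) $ i + \<theta> * (a $ i * p $ i) + 32 * \<theta> * (p $ i * p $ i)" for i
    using lin[of "axis i 1" "\<theta> * p $ i"]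
    by (simp add: shear'_def y_def[symmetric] \<theta>_def[symmetric] inner_axis algebra_simps)
  then have D: "D x = (\<Sum>i\<in>UNIV. S' y (axis i 1, 0) $ i) + \<theta> * (a \<bullet> p) + 32 * \<theta> * (p \<bullet> p)"
    by (simp add: D_def sum.distrib sum_distrib_left inner_vec_def)
  have key: "\<theta> * (a \<bullet> p) + 32 * \<theta> * (p \<bullet> p) - (norm (W x))\<^sup>2 / 64
      = (2 * \<theta> - \<theta>\<^sup>2) * (norm (a + 32 *\<^sub>R p))\<^sup>2 / 64 - (norm a)\<^sup>2 / 64"
    unfolding W power2_norm_eq_inner
    by (simp add: inner_simps inner_commute[of p a] power2_eq_square field_simps)
  have "0 \<le> \<theta> * (2 - \<theta>)"
    using trunc'_bounds[of "offset p q x / \<tau>"] unfolding \<theta>_def by (intro mult_nonneg_nonneg) auto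
  then have "0 \<le> (2 * \<theta> - \<theta>\<^sup>2) * (norm (a + 32 *\<^sub>R p))\<^sup>2 / 64"
    by (intro divide_nonneg_nonneg mult_nonneg_nonneg) (auto simp: power2_eq_square algebra_simps)
  moreover have "\<psi> y - e \<le> (\<Sum>i\<in>UNIV. S' y (axis i 1, 0) $ i) - (norm a)\<^sup>2 / 64"
    using cal unfolding calibration_def a_def by blast
  ultimately show "\<psi> (fst x, snd x - \<tau> * trunc (offset p q x / \<tau>)) - e \<le> D x - (norm (W x))\<^sup>2 / 64"
    using D key by (simp add: y_def)
  assume "\<bar>offset p q x\<bar> \<le> \<tau>"
  then have "\<theta> = 1"
    unfolding \<theta>_def using \<tau> by (intro trunc'_eq_1) (simp add: abs_divide)
  then show "W x = - 32 *\<^sub>R p"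
    by (simp add: W)
qed

text \<open>The field is sheared first, then the layers are added. On the support of the one active
  layer \<open>W = - 32 p\<close>, and the cross term of
  \<open>\<bar>b' c - 32 p\<bar>\<^sup>2 / 64\<close> cancels the tilt term
  \<open>- b' (p \<bullet> c)\<close> of the divergence. The cell contributes at least
  \<open>b Q - \<omega>\<^sup>2 / 2\<close>, the vertical derivative costs at most
  \<open>b Q / 4\<close>, and \<open>b Q / 2\<close> is claimed.\<close>

lemma calibration_step:
  fixes p :: "real ^ 'n::finite"
  assumes cal: "calibration S S' \<psi> e M" and n: "2 < CARD('n)" and \<omega>: "\<omega> \<noteq> 0"
    and J: "finite J" "\<And>j. j \<in> J \<Longrightarrow> m \<le> j"
    and lip: "\<And>y z z'. \<bar>\<psi> (y, z) - \<psi> (y, z')\<bar> \<le> l * \<bar>z - z'\<bar>"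
  defines "r \<equiv> (1 / 2 :: real) ^ m"
  shows "\<exists>S1 S1'. calibration S1 S1' (\<lambda>x. \<psi> x + (\<Sum>j\<in>J. weight p q \<omega> j x))
    (e + \<omega>\<^sup>2 / 2 + 10 * l * r) (M + 320 * r * norm p + r)"
proof -
  \<comment> \<open>Layers with \<open>j \<ge> m\<close> live at offsets below
    \<open>5 * 2 ^ (- j) \<le> 5 r\<close>, hence where the shear is complete.\<close>
  define \<tau> where "\<tau> = 5 * r"
  have \<tau>: "0 < \<tau>" by (simp add: \<tau>_def r_def)
  have S: "\<And>x. (S has_derivative S' x) (at x)" "\<And>v. continuous_on UNIV (\<lambda>x. S' x v)" "\<And>x. norm (S x) \<le> M"
    using cal unfolding calibration_def by blast+
  define S1 where "S1 x = shear S p q \<tau> x + (\<Sum>j\<in>J. layer p q \<omega> j x)" for x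
  define S1' where "S1' x v = shear' S' p q \<tau> x v + (\<Sum>j\<in>J. layer' p q \<omega> j x v)" for x v
  have "(S1 has_derivative S1' x) (at x)" for x
    unfolding S1_def[abs_def] S1'_def[abs_def]
    by (intro has_derivative_add has_derivative_sum has_derivative_shear has_derivative_layer S \<tau> \<omega>)
  moreover have "continuous_on UNIV (\<lambda>x. S1' x v)" for v
    unfolding S1'_def
    by (intro continuous_on_add continuous_on_sum continuous_on_shear'[OF S(1,2) \<tau>] continuous_on_layer')
  moreover have "norm (S1 x) \<le> M + 320 * r * norm p + r"
    and "\<psi> x + (\<Sum>j\<in>J. weight p q \<omega> j x) - (e + \<omega>\<^sup>2 / 2 + 10 * l * r)
      \<le> (\<Sum>i\<in>UNIV. S1' x (axis i 1, 0) $ i) - (norm (S1' x (0, 1)))\<^sup>2 / 64" for x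
  proof -
    obtain k where k: "\<And>j. j \<noteq> k \<Longrightarrow> bump (2 ^ j * offset p q x) = 0 \<and> bump' (2 ^ j * offset p q x) = 0"
      using at_most_one_layer[of "offset p q x"] by blast
    have single: "(\<Sum>j\<in>J. h j) = (if k \<in> J then h k else 0)" if "\<And>j. j \<noteq> k \<Longrightarrow> h j = 0"
      for h :: "nat \<Rightarrow> 'b::comm_monoid_add"
      using J(1) that by (subst sum.mono_neutral_right[of J "J \<inter> {k}"]) auto
    have l0: "layer p q \<omega> j x = 0" "layer' p q \<omega> j x v = 0" "weight p q \<omega> j x = 0" if "j \<noteq> k" for j v
      using k[OF that] by (auto simp: layer_def layer'_def weight_def)
    define b where "b = bump (2 ^ k * offset p q x)"
    define b' where "b' = bump' (2 ^ k * offset p q x)"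
    define c where "c = cell \<omega> ((2::real) ^ k *\<^sub>R fst x)"
    define Q where "Q = 1 / (1 + lat \<omega> ((2::real) ^ k *\<^sub>R fst x))"
    have Q: "0 \<le> Q" using lat_nonneg[of \<omega> "(2::real) ^ k *\<^sub>R fst x"] by (simp add: Q_def)
    have b: "0 \<le> b" "b \<le> 1" by (auto simp: b_def bump_nonneg bump_le_1)
    have rm: "(1 / 2 :: real) ^ k \<le> r" if "k \<in> J"
      unfolding r_def using J(2)[OF that] by (intro power_decreasing) auto
    have nl: "norm (\<Sum>j\<in>J. layer p q \<omega> j x) \<le> r"
    proof (cases "k \<in> J")
      case True
      have "norm (layer p q \<omega> k x) = b * norm c * (1 / 2) ^ k"
        using b by (simp add: layer_def b_def c_def abs_mult power_divide)
      also have "\<dots> \<le> (1 * 1) * r"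
        using rm[OF True] b norm_cell_le(2)[OF \<omega>] by (intro mult_mono) (auto simp: c_def)
      finally show ?thesis using True by (simp add: single l0)
    qed (simp add: single l0 r_def)
    show "norm (S1 x) \<le> M + 320 * r * norm p + r"
      unfolding S1_def using norm_shear_le[where S = S, OF S(3) \<tau>, where x = x and p = p and q = q] nl
      by (intro order_trans[OF norm_triangle_ineq]) (simp add: \<tau>_def)
    define D where "D = (\<Sum>i\<in>UNIV. shear' S' p q \<tau> x (axis i 1, 0) $ i)"
    define W where "W = shear' S' p q \<tau> x (0, 1)"
    \<comment> \<open>The shear evaluates \<open>\<psi>\<close> at a height moved by at most
      \<open>2 \<tau> = 10 r\<close>.\<close>
    have "\<bar>\<psi> (fst x, snd x) - \<psi> (fst x, snd x - \<tau> * trunc (offset p q x / \<tau>))\<bar>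
        \<le> l * \<bar>\<tau> * trunc (offset p q x / \<tau>)\<bar>"
      using lip[of "fst x" "snd x" "snd x - \<tau> * trunc (offset p q x / \<tau>)"] by simp
    also have "\<dots> \<le> l * (\<tau> * 2)"
    proof -
      have "0 \<le> l" using lip[of 0 0 1] by (simp add: order_trans[OF abs_ge_zero])
      then show ?thesis
        using \<tau> abs_trunc_le by (intro mult_left_mono) (auto simp: abs_mult)
    qed
    finally have G: "\<psi> x - (e + 10 * l * r) \<le> D - (norm W)\<^sup>2 / 64"
      using calibration_shear(1)[OF cal \<tau>, where x = x and p = p and q = q] by (simp add: D_def W_def \<tau>_def)
    show "\<psi> x + (\<Sum>j\<in>J. weight p q \<omega> j x) - (e + \<omega>\<^sup>2 / 2 + 10 * l * r)
      \<le> (\<Sum>i\<in>UNIV. S1' x (axis i 1, 0) $ i) - (norm (S1' x (0, 1)))\<^sup>2 / 64"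
    proof (cases "k \<in> J \<and> (b \<noteq> 0 \<or> b' \<noteq> 0)")
      case False
      then have "layer' p q \<omega> k x v = 0" "weight p q \<omega> k x = 0" if "k \<in> J" for v
        using that by (auto simp: layer'_def weight_def b_def b'_def)
      then have z: "(\<Sum>j\<in>J. layer' p q \<omega> j x v) = 0" "(\<Sum>j\<in>J. weight p q \<omega> j x) = 0" for v
        by (auto simp: single l0)
      show ?thesis
        using G zero_le_power2[of \<omega>] unfolding S1'_def z D_def W_def add_0_right by linarith
    next
      case True
      then have kJ: "k \<in> J" by simp
      have "3 < 2 ^ k * offset p q x \<and> 2 ^ k * offset p q x < 5"
        using True bump_support unfolding b_def b'_def by (metis not_le)
      moreover from this have "0 < offset p q x"
        by (intro zero_less_mult_pos[of "2 ^ k" "offset p q x"]) auto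
      ultimately have "0 < offset p q x" "offset p q x < 5 * (1 / 2) ^ k"
        by (auto simp: field_simps power_divide)
      then have "\<bar>offset p q x\<bar> \<le> \<tau>"
        using rm[OF kJ] by (simp add: \<tau>_def)
      then have W: "W = - 32 *\<^sub>R p"
        unfolding W_def by (rule calibration_shear(2)[OF cal \<tau>])
      define d where "d = (\<Sum>i\<in>UNIV. cell' \<omega> ((2::real) ^ k *\<^sub>R fst x) (axis i 1) $ i)"
      have "weight p q \<omega> k x = b * Q / 2"
        unfolding weight_def b_def Q_def by (simp only: times_divide_eq_right mult_1_right divide_divide_eq_left mult.commute)
      then have L: "(\<Sum>j\<in>J. layer' p q \<omega> j x v) = layer' p q \<omega> k x v" "(\<Sum>j\<in>J. weight p q \<omega> j x) = b * Q / 2" for v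
        using kJ by (simp_all add: single l0)
      have cell0: "cell' \<omega> z 0 = 0" for z :: "real ^ 'n"
        using cell'_scaleR[of \<omega> z 0 0] by simp
      have Wn: "S1' x (0, 1) = b' *\<^sub>R c - 32 *\<^sub>R p"
        using W unfolding S1'_def L W_def by (simp add: layer'_def b'_def c_def cell0)
      have Dn: "(\<Sum>i\<in>UNIV. S1' x (axis i 1, 0) $ i) = D - b' * (p \<bullet> c) + b * d"
      proof -
        have "layer' p q \<omega> k x (axis i 1, 0) $ i
            = b * cell' \<omega> ((2::real) ^ k *\<^sub>R fst x) (axis i 1) $ i - b' * (p $ i * c $ i)" for i
          by (simp add: layer'_def b_def b'_def c_def inner_axis)
        then show ?thesis
          unfolding S1'_def L D_def d_def
          by (simp add: sum.distrib sum_subtractf sum_distrib_left inner_vec_def)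
      qed
      have "b'\<^sup>2 * (norm c)\<^sup>2 \<le> (16 * b) * Q"
        using bump'_sq_le[of "2 ^ k * offset p q x"] norm_cell_le(1)[OF \<omega>, of "(2::real) ^ k *\<^sub>R fst x"] b
        by (intro mult_mono) (auto simp: b_def b'_def c_def Q_def)
      then have 1: "(norm (b' *\<^sub>R c))\<^sup>2 / 64 \<le> b * Q / 4"
        by (simp add: power_mult_distrib)
      have "b * (Q - \<omega>\<^sup>2 / 2) \<le> b * d"
        unfolding d_def Q_def using b divergence_cell_ge[OF \<omega> n] by (intro mult_left_mono) auto
      moreover have "b * (\<omega>\<^sup>2 / 2) \<le> \<omega>\<^sup>2 / 2"
        using mult_right_mono[OF b(2), of "\<omega>\<^sup>2 / 2"] by simp
      ultimately have 2: "b * Q - \<omega>\<^sup>2 / 2 \<le> b * d"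
        by (simp add: right_diff_distrib)
      have 3: "(norm (b' *\<^sub>R c - 32 *\<^sub>R p))\<^sup>2 = (norm (b' *\<^sub>R c))\<^sup>2 - 64 * (b' * (p \<bullet> c)) + (norm W)\<^sup>2"
        unfolding W power2_norm_eq_inner by (simp add: inner_simps inner_commute[of c p] algebra_simps)
      have "0 \<le> b * Q" using b Q by simp
      then show ?thesis
        unfolding Wn Dn L 3 using G 1 2 by (simp add: field_simps)
    qed
  qed
  ultimately have "calibration S1 S1' (\<lambda>x. \<psi> x + (\<Sum>j\<in>J. weight p q \<omega> j x))
    (e + \<omega>\<^sup>2 / 2 + 10 * l * r) (M + 320 * r * norm p + r)"
    unfolding calibration_def by blast
  then show ?thesis by blast
qed

section \<open>Grids of holes\<close>

text \<open>In units of \<open>2 ^ (- j)\<close> the mesh is \<open>2 ^ N\<close> and the tolerance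
  is \<open>\<delta>\<close>, coordinatewise. The tolerances \<open>1 / (4n)\<close>,
  \<open>1 / (2n)\<close> and \<open>1 / n\<close> belong to affine models, to rims met by nearby
  surfaces, and to holes; each step leaves room for one perturbation.\<close>

definition near_grid :: "nat \<Rightarrow> nat \<Rightarrow> real \<Rightarrow> real ^ 'n::finite \<Rightarrow> bool" where
  "near_grid N j \<delta> y \<longleftrightarrow> (\<forall>i. \<exists>l::int. \<bar>y $ i - of_int l * (2 ^ N / 2 ^ j)\<bar> < \<delta> / 2 ^ j)"

definition hole :: "real ^ 'n::finite \<Rightarrow> real \<Rightarrow> nat \<Rightarrow> nat set \<Rightarrow> ((real ^ 'n) \<times> real) set" where
  "hole p q N J = {x. \<exists>j\<in>J. near_grid N j (1 / CARD('n)) (fst x) \<and> \<bar>2 ^ j * offset p q x - 4\<bar> < 1 / 2}"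

definition rim :: "real ^ 'n::finite \<Rightarrow> real \<Rightarrow> nat \<Rightarrow> nat set \<Rightarrow> ((real ^ 'n) \<times> real) set" where
  "rim p q N J = {x. \<exists>j\<in>J. near_grid N j (1 / (2 * CARD('n))) (fst x) \<and> \<bar>2 ^ j * offset p q x\<bar> < 1 / 4}"

text \<open>Gives \<open>cell\<close> the period \<open>2 ^ N\<close> in rescaled coordinates, which
  is the mesh of \<open>near_grid N\<close>.\<close>

definition frequency :: "nat \<Rightarrow> real" where
  "frequency N = 2 * pi / 2 ^ N"

lemma near_grid_perturb:
  assumes "near_grid N j \<delta> y" "\<And>i. \<bar>y' $ i - y $ i\<bar> \<le> \<epsilon> / 2 ^ j"
  shows "near_grid N j (\<delta> + \<epsilon>) y'"
  unfolding near_grid_def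
proof
  fix i
  obtain l :: int where l: "\<bar>y $ i - of_int l * (2 ^ N / 2 ^ j)\<bar> < \<delta> / 2 ^ j"
    using assms(1) unfolding near_grid_def by blast
  have "\<bar>y' $ i - of_int l * (2 ^ N / 2 ^ j)\<bar> < \<delta> / 2 ^ j + \<epsilon> / 2 ^ j"
    using l assms(2)[of i] by linarith
  then show "\<exists>l::int. \<bar>y' $ i - of_int l * (2 ^ N / 2 ^ j)\<bar> < (\<delta> + \<epsilon>) / 2 ^ j"
    by (auto simp: add_divide_distrib)
qed

lemma open_near_grid: "open {y. near_grid N j \<delta> y}"
proof -
  have eq: "{y. near_grid N j \<delta> y} = (\<Inter>i. \<Union>l::int. {y. \<bar>y $ i - of_int l * (2 ^ N / 2 ^ j)\<bar> < \<delta> / 2 ^ j})"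
    unfolding near_grid_def by auto
  have "open {y :: real ^ 'n. \<bar>y $ i - c\<bar> < d}" for i c d
    by (intro open_Collect_less continuous_intros)
  then show ?thesis
    unfolding eq by (intro open_INT open_UN ballI) auto
qed

lemma open_hole: "open (hole p q N J)"
proof -
  have eq: "hole p q N J = (\<Union>j\<in>J. (fst -` {y. near_grid N j (1 / CARD('a)) y}) \<inter> {x. \<bar>2 ^ j * offset p q x - 4\<bar> < 1 / 2})"
    unfolding hole_def by auto
  show ?thesis
    unfolding eq
    by (intro open_UN ballI open_Int open_vimage open_near_grid continuous_intros open_Collect_less)
qed

lemma one_minus_cos_le: "2 * (1 - cos t) \<le> (t::real)\<^sup>2"
proof -
  have "\<bar>sin (t / 2)\<bar>\<^sup>2 \<le> \<bar>t / 2\<bar>\<^sup>2"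
    by (intro power_mono abs_sin_x_le_abs_x) simp
  moreover have "cos t = 1 - 2 * (sin (t / 2))\<^sup>2"
    using cos_double_sin[of "t / 2"] by simp
  ultimately show ?thesis
    by (simp add: power_divide)
qed

text \<open>By periodicity each coordinate may be replaced by its rescaled deviation
  \<open>t\<close> from the grid. Since \<open>2 (1 - cos s) \<le> s\<^sup>2\<close> and
  \<open>t\<^sup>2 \<le> 1 / n\<close>, the \<open>n\<close> terms add up to at most 1.\<close>

lemma lat_le_1:
  fixes y :: "real ^ 'n::finite"
  assumes "near_grid N j (1 / CARD('n)) y"
  shows "lat (frequency N) (2 ^ j *\<^sub>R y) \<le> 1"
proof -
  define \<omega> where "\<omega> = frequency N"
  have \<omega>: "0 < \<omega>" by (simp add: \<omega>_def frequency_def)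
  have le: "2 * (1 - cos (\<omega> * (2 ^ j *\<^sub>R y) $ i)) / \<omega>\<^sup>2 \<le> 1 / CARD('n)" for i
  proof -
    obtain l :: int where l: "\<bar>y $ i - of_int l * (2 ^ N / 2 ^ j)\<bar> < 1 / CARD('n) / 2 ^ j"
      using assms unfolding near_grid_def by blast
    define t where "t = 2 ^ j * (y $ i - of_int l * (2 ^ N / 2 ^ j))"
    have "\<bar>t\<bar> = 2 ^ j * \<bar>y $ i - of_int l * (2 ^ N / 2 ^ j)\<bar>"
      unfolding t_def abs_mult by simp
    also have "\<dots> \<le> 2 ^ j * (1 / CARD('n) / 2 ^ j)"
      using l by (intro mult_left_mono) auto
    finally have t: "\<bar>t\<bar> \<le> 1 / CARD('n)" by simp
    have "\<omega> * (2 ^ j *\<^sub>R y) $ i = \<omega> * t + 2 * pi * of_int l"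
      by (simp add: t_def \<omega>_def frequency_def field_simps)
    then have "cos (\<omega> * (2 ^ j *\<^sub>R y) $ i) = cos (\<omega> * t)"
      using cos_int_2pin[of l] sin_int_2pin[of l] by (simp add: cos_add)
    then have "2 * (1 - cos (\<omega> * (2 ^ j *\<^sub>R y) $ i)) / \<omega>\<^sup>2 \<le> (\<omega> * t)\<^sup>2 / \<omega>\<^sup>2"
      using one_minus_cos_le[of "\<omega> * t"] by (intro divide_right_mono) auto
    also have "\<dots> = \<bar>t\<bar> * \<bar>t\<bar>"
      using \<omega> by (simp add: power2_eq_square)
    also have "\<dots> \<le> 1 * (1 / CARD('n))"
    proof -
      have "(1::real) / CARD('n) \<le> 1" by simp
      with t show ?thesis by (intro mult_mono; linarith)
    qed
    finally show ?thesis by simp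
  qed
  have "lat \<omega> (2 ^ j *\<^sub>R y) \<le> (\<Sum>i\<in>(UNIV :: 'n set). 1 / CARD('n))"
    unfolding lat_def by (intro sum_mono le)
  then show ?thesis by (simp add: \<omega>_def)
qed

lemma weight_hole_ge:
  assumes "x \<in> hole p q N J" "finite J"
  shows "1 / 8 \<le> (\<Sum>j\<in>J. weight p q (frequency N) j x)"
proof -
  obtain j where j: "j \<in> J" "near_grid N j (1 / CARD('a)) (fst x)" "\<bar>2 ^ j * offset p q x - 4\<bar> < 1 / 2"
    using assms(1) unfolding hole_def by blast
  have "1 / 2 / (2 * (1 + 1)) \<le> weight p q (frequency N) j x"
    unfolding weight_def using bump_ge[OF j(3)] lat_le_1[OF j(2)] lat_nonneg[of "frequency N" "(2::real) ^ j *\<^sub>R fst x"]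
    by (intro frac_le mult_left_mono add_left_mono) auto
  also have "\<dots> \<le> (\<Sum>j\<in>J. weight p q (frequency N) j x)"
    using j(1) assms(2) by (intro member_le_sum weight_nonneg)
  finally show ?thesis by simp
qed

section \<open>Almost every point is near the grid at some late scale\<close>

text \<open>Some multiple of \<open>L\<close> lies in \<open>[u, u + L)\<close>. The
  half-neighbourhood on its right is used if it fits, and otherwise the one on its left fits because
  \<open>h \<le> L\<close>.\<close>

lemma interval_near_multiple:
  fixes u L h :: real
  assumes "0 < L" "0 < h" "h \<le> L"
  obtains c where "u \<le> c" "c + h / 2 \<le> u + L" "\<And>x. c < x \<Longrightarrow> x < c + h / 2 \<Longrightarrow> \<exists>l::int. \<bar>x - of_int l * L\<bar> < h"
proof -
  define l where "l = \<lceil>u / L\<rceil>"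
  have "u / L \<le> of_int l" "of_int l - 1 < u / L"
    using ceiling_correct[of "u / L"] by (simp_all add: l_def)
  then have "of_int l * L \<ge> u" "of_int l * L < u + L"
    using assms(1) pos_less_divide_eq[of L "of_int l - 1" u]
    by (simp_all add: pos_divide_le_eq left_diff_distrib)
  then show ?thesis
    using that[of "of_int l * L"] that[of "of_int l * L - h / 2"] assms
    by (cases "of_int l * L + h / 2 \<le> u + L") (force simp: abs_if intro: exI[of _ l])+
qed

lemma measure_box_cart:
  fixes a b :: "real ^ 'n::finite"
  assumes "\<And>i. a $ i \<le> b $ i"
  shows "measure lebesgue (box a b) = (\<Prod>i\<in>UNIV. b $ i - a $ i)"
    and "measure lebesgue (cbox a b) = (\<Prod>i\<in>UNIV. b $ i - a $ i)"
proof -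
  have le: "a \<bullet> e \<le> b \<bullet> e" if "e \<in> Basis" for e
    using that assms by (auto simp: Basis_vec_def inner_axis)
  have ne: "cbox a b \<noteq> {}"
    using assms by (auto simp: interval_ne_empty_cart)
  show "measure lebesgue (cbox a b) = (\<Prod>i\<in>UNIV. b $ i - a $ i)"
    using content_cbox_cart[OF ne] by simp
  moreover have "measure lebesgue (box a b) = measure lebesgue (cbox a b)"
    using le by simp
  ultimately show "measure lebesgue (box a b) = (\<Prod>i\<in>UNIV. b $ i - a $ i)" by simp
qed

lemma cube_contains_near_grid:
  fixes u v :: "real ^ 'n::finite"
  assumes side: "\<And>i. v $ i - u $ i = 2 ^ N / 2 ^ j" and \<delta>: "0 < \<delta>" "\<delta> \<le> 1"
  obtains C where "C \<subseteq> box u v" "C \<in> lmeasurable" "\<And>y. y \<in> C \<Longrightarrow> near_grid N j \<delta> y"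
    "measure lebesgue C = (\<delta> / 2 ^ Suc N) ^ CARD('n) * measure lebesgue (cbox u v)"
proof -
  have "\<delta> \<le> 2 ^ N"
    using \<delta>(2) order_trans[OF _ one_le_power[of "2::real" N]] by simp
  then have "\<delta> / 2 ^ j \<le> 2 ^ N / 2 ^ j"
    by (simp add: divide_right_mono)
  then have "\<exists>c. u $ i \<le> c \<and> c + \<delta> / 2 ^ j / 2 \<le> u $ i + 2 ^ N / 2 ^ j \<and>
      (\<forall>x. c < x \<longrightarrow> x < c + \<delta> / 2 ^ j / 2 \<longrightarrow> (\<exists>l::int. \<bar>x - of_int l * (2 ^ N / 2 ^ j)\<bar> < \<delta> / 2 ^ j))" for i
    using interval_near_multiple[of "2 ^ N / 2 ^ j" "\<delta> / 2 ^ j" "u $ i"] \<delta>(1)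
    by (metis divide_pos_pos zero_less_numeral zero_less_power)
  then obtain c where c: "\<And>i. u $ i \<le> c i" "\<And>i. c i + \<delta> / 2 ^ j / 2 \<le> u $ i + 2 ^ N / 2 ^ j"
    "\<And>i x. c i < x \<Longrightarrow> x < c i + \<delta> / 2 ^ j / 2 \<Longrightarrow> \<exists>l::int. \<bar>x - of_int l * (2 ^ N / 2 ^ j)\<bar> < \<delta> / 2 ^ j"
    by metis
  define a :: "real ^ 'n" where "a = (\<chi> i. c i)"
  define b :: "real ^ 'n" where "b = (\<chi> i. c i + \<delta> / 2 ^ j / 2)"
  show ?thesis
  proof (rule that)
    show "box a b \<subseteq> box u v"
    proof
      fix x assume x: "x \<in> box a b"
      have "u $ i < x $ i \<and> x $ i < v $ i" for i
        using x c(1,2)[of i] side[of i] by (auto simp: mem_box_cart a_def b_def dest!: spec[of _ i])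
      then show "x \<in> box u v" by (simp add: mem_box_cart)
    qed
    show "box a b \<in> lmeasurable" by simp
    show "near_grid N j \<delta> y" if "y \<in> box a b" for y
      using that c(3) by (auto simp: near_grid_def mem_box_cart a_def b_def)
    have le: "u $ i \<le> v $ i" for i
      using side[of i] by (simp add: diff_eq_eq)
    have "measure lebesgue (box a b) = (\<delta> / 2 ^ j / 2) ^ CARD('n)"
      using \<delta>(1) by (subst measure_box_cart(1)) (simp_all add: a_def b_def)
    moreover have "measure lebesgue (cbox u v) = (2 ^ N / 2 ^ j) ^ CARD('n)"
      using le by (subst measure_box_cart(2)) (simp_all add: side)
    ultimately show "measure lebesgue (box a b) = (\<delta> / 2 ^ Suc N) ^ CARD('n) * measure lebesgue (cbox u v)"
      by (simp add: power_mult_distrib[symmetric] mult.commute)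
  qed
qed

text \<open>The dyadic covering lemma for a gauge whose balls have radius at most
  \<open>s / 2\<close> and, at points of \<open>U\<close>, stay inside \<open>U\<close>. It serves
  both the density argument below and the estimate of Hausdorff measure.\<close>

lemma cover_by_small_cubes:
  fixes Z U :: "(real ^ 'n::finite) set"
  assumes Z: "Z \<subseteq> cbox a b" "Z \<subseteq> U" and ab: "box a b \<noteq> {}" and U: "open U" and s: "0 < s"
  obtains \<D> where "countable \<D>" "\<Union>\<D> \<subseteq> cbox a b" "\<Union>\<D> \<subseteq> U" "Z \<subseteq> \<Union>\<D>"
    "pairwise (\<lambda>A B. interior A \<inter> interior B = {}) \<D>"
    "\<And>D. D \<in> \<D> \<Longrightarrow> \<exists>u v k. D = cbox u v \<and> (\<forall>i. u $ i < v $ i \<and> v $ i - u $ i = (b $ i - a $ i) / 2 ^ k)"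
    "\<And>D x y. D \<in> \<D> \<Longrightarrow> x \<in> D \<Longrightarrow> y \<in> D \<Longrightarrow> dist x y < s"
proof -
  have "\<exists>r. 0 < r \<and> r \<le> s / 2 \<and> (x \<in> U \<longrightarrow> ball x r \<subseteq> U)" for x
  proof (cases "x \<in> U")
    case True
    then obtain r where "0 < r" "ball x r \<subseteq> U"
      using U by (meson open_contains_ball)
    then have "0 < min r (s / 2)" "min r (s / 2) \<le> s / 2" "ball x (min r (s / 2)) \<subseteq> U"
      using s by auto
    then show ?thesis by blast
  next
    case False
    then show ?thesis using s by (intro exI[of _ "s / 2"]) simp
  qed
  then obtain r where r: "\<And>x. 0 < r x" "\<And>x. r x \<le> s / 2" "\<And>x. x \<in> U \<Longrightarrow> ball x (r x) \<subseteq> U"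
    by metis
  define g where "g x = ball x (r x)" for x
  have "gauge g"
    using r(1) by (auto simp: gauge_def g_def)
  from covering_lemma[OF Z(1) ab this] obtain \<D> where \<D>: "countable \<D>" "\<Union>\<D> \<subseteq> cbox a b"
    "\<And>K. K \<in> \<D> \<Longrightarrow> interior K \<noteq> {} \<and> (\<exists>c d. K = cbox c d)"
    "pairwise (\<lambda>A B. interior A \<inter> interior B = {}) \<D>"
    "\<And>K. K \<in> \<D> \<Longrightarrow> \<exists>x\<in>Z \<inter> K. K \<subseteq> g x"
    "\<And>u v. cbox u v \<in> \<D> \<Longrightarrow> \<exists>k. \<forall>i\<in>Basis. v \<bullet> i - u \<bullet> i = (b \<bullet> i - a \<bullet> i) / 2 ^ k"
    "Z \<subseteq> \<Union>\<D>"
    by metis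
  show ?thesis
  proof (rule that[OF \<D>(1,2) _ \<D>(7,4)])
    show "\<Union>\<D> \<subseteq> U"
      using \<D>(5) Z(2) r(3) unfolding g_def by blast
    fix D assume D: "D \<in> \<D>"
    have "interior D \<noteq> {} \<and> (\<exists>u v. D = cbox u v)"
      using \<D>(3) D by blast
    then obtain u v where uv: "D = cbox u v" and ne: "box u v \<noteq> {}"
      by (metis interior_cbox)
    obtain k where k: "\<And>i. i \<in> Basis \<Longrightarrow> v \<bullet> i - u \<bullet> i = (b \<bullet> i - a \<bullet> i) / 2 ^ k"
      using \<D>(6) D uv by blast
    have "v $ i - u $ i = (b $ i - a $ i) / 2 ^ k" for i
    proof -
      have "axis i (1::real) \<in> Basis" by (auto simp: Basis_vec_def)
      from k[OF this] show ?thesis by (simp add: inner_axis)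
    qed
    moreover have "u $ i < v $ i" for i
      using ne by (simp add: interval_ne_empty_cart)
    ultimately show "\<exists>u v k. D = cbox u v \<and> (\<forall>i. u $ i < v $ i \<and> v $ i - u $ i = (b $ i - a $ i) / 2 ^ k)"
      using uv by blast
    fix x y assume "x \<in> D" "y \<in> D"
    moreover obtain z where "D \<subseteq> ball z (r z)"
      using \<D>(5)[OF D] unfolding g_def by blast
    ultimately have "dist z x < r z" "dist z y < r z" by auto
    then show "dist x y < s"
      using r(2)[of z] dist_triangle3[of x y z] by simp
  qed
qed

text \<open>A density argument. The side of a small dyadic cube is the mesh of some scale
  \<open>j \<ge> a\<close>, so a fixed fraction \<open>\<kappa>\<close> of the cube is near that
  grid and misses the set \<open>E\<close> in question. Covering \<open>E\<close> by such cubes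
  inside an open set barely larger than \<open>E\<close> shows that \<open>\<kappa>\<close> times
  the measure of \<open>E\<close> is arbitrarily small.\<close>

lemma negligible_off_grid:
  fixes \<delta> :: real and a N K :: nat
  assumes \<delta>: "0 < \<delta>" "\<delta> \<le> 1"
  shows "negligible {y \<in> cbox (\<chi> i. - (2 ^ K)) (\<chi> i. 2 ^ K) :: (real ^ 'n::finite) set. \<forall>j\<ge>a. \<not> near_grid N j \<delta> y}"
proof -
  define lo :: "real ^ 'n" where "lo = (\<chi> i. - (2 ^ K))"
  define hi :: "real ^ 'n" where "hi = (\<chi> i. 2 ^ K)"
  define E where "E = {y \<in> cbox lo hi. \<forall>j\<ge>a. \<not> near_grid N j \<delta> y}"
  have "E = cbox lo hi - (\<Union>j\<in>{a..}. {y. near_grid N j \<delta> y})"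
    by (auto simp: E_def)
  then have "closed E"
    by (simp only:) (intro closed_Diff closed_cbox open_UN ballI open_near_grid)
  moreover have "bounded E"
    by (rule bounded_subset[OF bounded_cbox[of lo hi]]) (auto simp: E_def)
  ultimately have E: "E \<in> lmeasurable"
    by (simp add: compact_eq_bounded_closed lmeasurable_compact)
  define \<kappa> where "\<kappa> = (\<delta> / 2 ^ Suc N) ^ CARD('n)"
  have \<kappa>: "0 < \<kappa>" using \<delta>(1) by (simp add: \<kappa>_def)
  have bound: "\<kappa> * (measure lebesgue E - e) \<le> e" if e: "0 < e" for e
  proof -
    obtain U where U: "open U" "E \<subseteq> U" "U - E \<in> lmeasurable" "emeasure lebesgue (U - E) < ennreal e"
      using sets_lebesgue_outer_open[OF fmeasurableD[OF E] e] by metis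
    have mU: "measure lebesgue (U - E) < e"
      using U(3,4) e by (simp add: emeasure_eq_measure2 ennreal_less_iff)
    \<comment> \<open>Half of the mesh at scale \<open>a\<close>: a dyadic cube of smaller diameter
      must have the mesh of a scale \<open>j \<ge> a\<close> as its side.\<close>
    define s :: real where "s = 2 ^ N / 2 ^ Suc a"
    have s: "0 < s" by (simp add: s_def)
    have "E \<subseteq> cbox lo hi" by (auto simp: E_def)
    moreover have "box lo hi \<noteq> {}"
    proof -
      have "- (2 ^ K) < (2::real) ^ K"
        using zero_less_power[of "2::real" K] by linarith
      then show ?thesis
        by (simp add: lo_def hi_def interval_ne_empty_cart)
    qed
    ultimately obtain \<D> where \<D>: "countable \<D>" "\<Union>\<D> \<subseteq> cbox lo hi" "\<Union>\<D> \<subseteq> U" "E \<subseteq> \<Union>\<D>"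
      "pairwise (\<lambda>A B. interior A \<inter> interior B = {}) \<D>"
      "\<And>D. D \<in> \<D> \<Longrightarrow> \<exists>u v k. D = cbox u v \<and> (\<forall>i. u $ i < v $ i \<and> v $ i - u $ i = (hi $ i - lo $ i) / 2 ^ k)"
      "\<And>D x y. D \<in> \<D> \<Longrightarrow> x \<in> D \<Longrightarrow> y \<in> D \<Longrightarrow> dist x y < s"
      using cover_by_small_cubes[OF _ U(2) _ U(1) s] by metis
    have "\<exists>C. C \<subseteq> interior D \<and> C \<in> lmeasurable \<and> C \<inter> E = {} \<and> measure lebesgue C = \<kappa> * measure lebesgue D"
      if D: "D \<in> \<D>" for D
    proof -
      obtain u v n where uv: "D = cbox u v" "\<And>i. u $ i < v $ i" "\<And>i. v $ i - u $ i = (hi $ i - lo $ i) / 2 ^ n"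
        using \<D>(6)[OF D] by blast
      have side: "v $ i - u $ i = 2 ^ Suc K / 2 ^ n" for i
        using uv(3)[of i] by (simp add: lo_def hi_def)
      have "u \<in> D" "v \<in> D"
        using uv(2) by (auto simp: uv(1) mem_box_cart less_imp_le)
      then have "dist u v < s" by (rule \<D>(7)[OF D])
      moreover have "(2::real) ^ Suc K / 2 ^ n \<le> dist u v"
        using component_le_norm_cart[of "v - u" undefined] side[of undefined]
        by (simp add: dist_norm norm_minus_commute)
      ultimately have lt: "(2::real) ^ Suc K / 2 ^ n < 2 ^ N / 2 ^ Suc a"
        by (simp add: s_def)
      obtain j where j: "a \<le> j" "(2::real) ^ Suc K / 2 ^ n = 2 ^ N / 2 ^ j"
      proof -
        have "(2::real) ^ (Suc K + Suc a) < 2 ^ (N + n)"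
          using lt by (simp add: power_add field_simps)
        then have lt': "Suc K + Suc a < N + n"
          by (rule power_less_imp_less_exp[rotated]) simp
        have "Suc K + (N + n - Suc K) = N + n"
          using lt' by simp
        then have "(2::real) ^ Suc K * 2 ^ (N + n - Suc K) = 2 ^ N * 2 ^ n"
          by (simp only: power_add[symmetric])
        then have "(2::real) ^ Suc K / 2 ^ n = 2 ^ N / 2 ^ (N + n - Suc K)"
          by (subst frac_eq_eq) simp_all
        then show ?thesis using that[of "N + n - Suc K"] lt' by simp
      qed
      obtain C where "C \<subseteq> box u v" "C \<in> lmeasurable" "\<And>y. y \<in> C \<Longrightarrow> near_grid N j \<delta> y"
        "measure lebesgue C = \<kappa> * measure lebesgue (cbox u v)"
        using cube_contains_near_grid[of v u N j \<delta>] side j(2) \<delta> unfolding \<kappa>_def by metis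
      then show ?thesis
        using j(1) unfolding uv(1) by (intro exI[of _ C]) (auto simp: E_def interior_cbox)
    qed
    then obtain C where C: "\<And>D. D \<in> \<D> \<Longrightarrow> C D \<subseteq> interior D" "\<And>D. D \<in> \<D> \<Longrightarrow> C D \<in> lmeasurable"
      "\<And>D. D \<in> \<D> \<Longrightarrow> C D \<inter> E = {}" "\<And>D. D \<in> \<D> \<Longrightarrow> measure lebesgue (C D) = \<kappa> * measure lebesgue D"
      by metis
    have meas: "D \<in> lmeasurable" if "D \<in> \<D>" for D
      using \<D>(6)[OF that] by auto
    have UD: "\<Union>D' \<in> lmeasurable" if "D' \<subseteq> \<D>" for D'
    proof (rule bounded_set_imp_lmeasurable)
      show "bounded (\<Union>D')"
        using \<D>(2) that by (intro bounded_subset[OF bounded_cbox[of lo hi]]) blast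
      show "\<Union>D' \<in> sets lebesgue"
        using that \<D>(1) meas by (intro sets.countable_Union) (auto intro: countable_subset fmeasurableD)
    qed
    obtain D' where D': "D' \<subseteq> \<D>" "finite D'" "measure lebesgue (\<Union>\<D>) - e < measure lebesgue (\<Union>D')"
    proof (rule measure_countable_Union_approachable[OF \<D>(1) e meas])
      show "measure lebesgue (\<Union>D') \<le> measure lebesgue (\<Union>\<D>)" if "D' \<subseteq> \<D>" for D'
        using that UD by (intro measure_mono_fmeasurable) (auto intro: fmeasurableD)
    qed auto
    have "measure lebesgue E \<le> measure lebesgue (\<Union>\<D>)"
      using \<D>(4) UD[of \<D>] E by (intro measure_mono_fmeasurable) (auto intro: fmeasurableD)
    then have "\<kappa> * (measure lebesgue E - e) \<le> \<kappa> * measure lebesgue (\<Union>D')"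
      using D'(3) \<kappa> by (intro mult_left_mono) auto
    also have "\<dots> \<le> \<kappa> * (\<Sum>D\<in>D'. measure lebesgue D)"
      using measure_UNION_le[of D' "\<lambda>D. D" lebesgue] D'(1,2) meas \<kappa>
      by (intro mult_left_mono) (auto intro: fmeasurableD)
    also have "\<dots> = (\<Sum>D\<in>D'. measure lebesgue (C D))"
      using D'(1) C(4) by (simp add: sum_distrib_left subset_iff)
    also have "\<dots> = measure lebesgue (\<Union>D\<in>D'. C D)"
    proof (rule measure_UNION'[symmetric])
      show "pairwise (\<lambda>i j. disjnt (C i) (C j)) D'"
        using \<D>(5) C(1) D'(1) unfolding pairwise_def disjnt_def by blast
    qed (use D' C(2) in auto)
    also have "\<dots> \<le> measure lebesgue (U - E)"
    proof (rule measure_mono_fmeasurable[OF _ _ U(3)])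
      show "(\<Union>D\<in>D'. C D) \<subseteq> U - E"
        using C(1,3) \<D>(3) D'(1) interior_subset by blast
      show "(\<Union>D\<in>D'. C D) \<in> sets lebesgue"
        using D' C(2) by (intro sets.finite_UN) (auto intro: fmeasurableD)
    qed
    also have "\<dots> \<le> e" using mU by simp
    finally show ?thesis .
  qed
  have "\<kappa> * measure lebesgue E \<le> 0"
  proof (rule field_le_epsilon)
    fix e :: real assume e: "0 < e"
    define e' where "e' = e / (1 + \<kappa>)"
    have "0 < e'" using e \<kappa> by (simp add: e'_def)
    from bound[OF this] have "\<kappa> * measure lebesgue E \<le> (1 + \<kappa>) * e'"
      by (simp add: algebra_simps)
    also have "\<dots> = e" using \<kappa> by (simp add: e'_def)
    finally show "\<kappa> * measure lebesgue E \<le> 0 + e" by simp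
  qed
  then have "measure lebesgue E = 0"
    using \<kappa> measure_nonneg[of lebesgue E] by (simp add: mult_le_0_iff)
  then have "negligible E"
    using E by (simp add: negligible_iff_measure)
  then show ?thesis
    by (simp add: E_def lo_def hi_def)
qed

text \<open>As \<open>b\<close> grows the sets decrease to the null set of
  \<open>negligible_off_grid\<close>. So finitely many scales suffice, starting as late as
  desired.\<close>

lemma measure_off_grid_small:
  fixes \<delta> \<epsilon> :: real and a N K :: nat
  assumes \<delta>: "0 < \<delta>" "\<delta> \<le> 1" and \<epsilon>: "0 < \<epsilon>"
  obtains b where "measure lebesgue {y \<in> cbox (\<chi> i. - (2 ^ K)) (\<chi> i. 2 ^ K) :: (real ^ 'n::finite) set.
    \<forall>j\<in>{a..b}. \<not> near_grid N j \<delta> y} < \<epsilon>"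
proof -
  define B :: "(real ^ 'n) set" where "B = cbox (\<chi> i. - (2 ^ K)) (\<chi> i. 2 ^ K)"
  define F where "F b = {y \<in> B. \<forall>j\<in>{a..b}. \<not> near_grid N j \<delta> y}" for b
  have F: "F b \<in> lmeasurable" for b
  proof -
    have "F b = B - (\<Union>j\<in>{a..b}. {y. near_grid N j \<delta> y})"
      by (auto simp: F_def)
    moreover have "open (\<Union>j\<in>{a..b}. {y :: real ^ 'n. near_grid N j \<delta> y})"
      by (intro open_UN ballI open_near_grid)
    then have "(\<Union>j\<in>{a..b}. {y :: real ^ 'n. near_grid N j \<delta> y}) \<in> sets lebesgue"
      by (intro sets_completionI_sets) simp
    ultimately show ?thesis
      unfolding B_def by (simp only:) (intro fmeasurable_Diff lmeasurable_cbox)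
  qed
  have lim: "(\<lambda>b. measure lebesgue (F b)) \<longlonglongrightarrow> measure lebesgue (\<Inter>b. F b)"
  proof (rule Lim_measure_decseq)
    show "range F \<subseteq> sets lebesgue"
      using F by (blast intro: fmeasurableD)
    show "decseq F"
      by (rule decseq_SucI) (fastforce simp: F_def)
    show "emeasure lebesgue (F b) \<noteq> \<infinity>" for b
      using fmeasurableD2[OF F] by simp
  qed
  have Inter: "(\<Inter>b. F b) = {y \<in> B. \<forall>j\<ge>a. \<not> near_grid N j \<delta> y}"
  proof (intro equalityI subsetI)
    fix y assume y: "y \<in> (\<Inter>b. F b)"
    have "\<not> near_grid N j \<delta> y" if "a \<le> j" for j
    proof -
      have "y \<in> F j" using y by blast
      then show ?thesis using that by (simp add: F_def)
    qed
    moreover have "y \<in> B" using y by (simp add: F_def)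
    ultimately show "y \<in> {y \<in> B. \<forall>j\<ge>a. \<not> near_grid N j \<delta> y}" by simp
  qed (simp add: F_def)
  have "measure lebesgue {y \<in> B. \<forall>j\<ge>a. \<not> near_grid N j \<delta> y} = 0"
    unfolding B_def by (rule negligible_imp_measure0[OF negligible_off_grid[OF \<delta>]])
  with lim have "(\<lambda>b. measure lebesgue (F b)) \<longlonglongrightarrow> 0"
    unfolding Inter by (simp only:)
  from eventually_happens[OF order_tendstoD(2)[OF this \<epsilon>]]
  obtain b where "measure lebesgue (F b) < \<epsilon>"
    by (meson sequentially_bot)
  then show ?thesis
    unfolding F_def B_def by (rule that)
qed

section \<open>Energy bound on graphs\<close>

lemma integrable_continuous_compact_support:
  fixes f :: "'a::euclidean_space \<Rightarrow> real"
  assumes "continuous_on UNIV f" "compact C" "\<And>x. x \<notin> C \<Longrightarrow> f x = 0"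
  shows "integrable lborel f"
proof -
  have "integrable lborel (\<lambda>x. indicator C x *\<^sub>R f x)"
    using assms by (intro borel_integrable_compact) (auto intro: continuous_on_subset)
  moreover have "(\<lambda>x. indicator C x *\<^sub>R f x) = f"
    using assms(3) by (auto simp: fun_eq_iff indicator_def)
  ultimately show ?thesis by simp
qed

lemma has_derivative_zero_outside_closed:
  assumes "(f has_derivative f') (at x)" "closed C" "\<And>x. x \<notin> C \<Longrightarrow> f x = 0" "x \<notin> C"
  shows "f' = (\<lambda>_. 0)"
proof -
  have "((\<lambda>_. 0) has_derivative (\<lambda>_. 0)) (at x)"
    by simp
  then have "(f has_derivative (\<lambda>_. 0)) (at x)"
    by (rule has_derivative_transform_within_open[of _ _ _ _ "- C"]) (use assms in auto)
  with assms(1) show ?thesis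
    by (rule has_derivative_unique)
qed

text \<open>By translation invariance the difference quotients have integral zero.\<close>
lemma integral_derivative_compact_support:
  fixes f :: "'a::euclidean_space \<Rightarrow> real"
  assumes d: "\<And>x. (f has_derivative f' x) (at x)" and cont: "continuous_on UNIV (\<lambda>x. f' x e)"
    and C: "compact C" "\<And>x. x \<notin> C \<Longrightarrow> f x = 0"
  shows "integrable lborel (\<lambda>x. f' x e)" "(\<integral>x. f' x e \<partial>lborel) = 0"
proof -
  have zero: "f' x e = 0" if "x \<notin> C" for x
    using has_derivative_zero_outside_closed[OF d compact_imp_closed[OF C(1)] C(2) that] by simp
  show int: "integrable lborel (\<lambda>x. f' x e)"
    by (rule integrable_continuous_compact_support[OF cont C(1) zero])
  have fcont: "continuous_on UNIV f"
    using d by (meson continuous_at_imp_continuous_on has_derivative_continuous)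
  have fint: "integrable lborel f"
    by (rule integrable_continuous_compact_support[OF fcont C])
  have "bounded ((\<lambda>x. f' x e) ` C)"
    using C(1) cont by (intro compact_imp_bounded compact_continuous_image) (auto intro: continuous_on_subset)
  then obtain B0 where B0: "\<And>x. x \<in> C \<Longrightarrow> norm (f' x e) \<le> B0"
    unfolding bounded_iff by auto
  define B where "B = max B0 0"
  have B: "0 \<le> B" "\<bar>f' x e\<bar> \<le> B" for x
    using B0[of x] zero[of x] by (cases "x \<in> C"; force simp: B_def)+
  have lip: "\<bar>f (x + h *\<^sub>R e) - f x\<bar> \<le> B * h" if "0 \<le> h" for x h
  proof -
    have der: "((\<lambda>t. f (x + t *\<^sub>R e)) has_real_derivative f' (x + t *\<^sub>R e) e) (at t within {0..h})" for t
    proof -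
      have "((\<lambda>t. x + t *\<^sub>R e) has_derivative (\<lambda>s. s *\<^sub>R e)) (at t within {0..h})"
        by (auto intro!: derivative_eq_intros)
      from has_derivative_compose[OF this d] show ?thesis
        unfolding has_field_derivative_def
        by (rule has_derivative_eq_rhs)
          (simp add: fun_eq_iff linear_scale[OF has_derivative_linear[OF d]] mult.commute)
    qed
    have "norm (f (x + h *\<^sub>R e) - f (x + 0 *\<^sub>R e)) \<le> B * norm (h - 0)"
      by (rule field_differentiable_bound[of "{0..h}", OF _ der]) (use that B in auto)
    then show ?thesis using that by simp
  qed
  \<comment> \<open>All points from which a step \<open>t e\<close> with
    \<open>0 \<le> t \<le> 1\<close> reaches \<open>C\<close>. Outside \<open>D\<close> the
    difference quotients vanish, so \<open>B\<close> times the indicator of \<open>D\<close>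
    dominates them.\<close>
  define D where "D = (\<lambda>(x, t). x - t *\<^sub>R e) ` (C \<times> {0..1::real})"
  have "compact D"
    unfolding D_def
    by (intro compact_continuous_image compact_Times C(1) compact_Icc)
      (auto simp: case_prod_beta intro!: continuous_intros)
  have outside: "f (x + h *\<^sub>R e) - f x = 0" if "x \<notin> D" "0 \<le> h" "h \<le> 1" for x h
  proof -
    have "x \<notin> C" "x + h *\<^sub>R e \<notin> C"
      using that unfolding D_def by (force intro: image_eqI[of _ _ "(x, 0)"], force intro: image_eqI[of _ _ "(x + h *\<^sub>R e, h)"])
    then show ?thesis by (simp add: C(2))
  qed
  define h where "h n = 1 / real (Suc n)" for n
  have h: "0 < h n" "h n \<le> 1" for n by (auto simp: h_def)
  have h0: "h \<longlonglongrightarrow> 0"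
    unfolding h_def using LIMSEQ_inverse_real_of_nat by (simp add: inverse_eq_divide)
  have mean0: "(\<integral>x. (f (x + h n *\<^sub>R e) - f x) / h n \<partial>lborel) = 0" for n
  proof -
    have "integrable lborel (\<lambda>x. f (x + h n *\<^sub>R e))" and "(\<integral>x. f (x + h n *\<^sub>R e) \<partial>lborel) = (\<integral>x. f x \<partial>lborel)"
    proof -
      have m: "(\<lambda>x. h n *\<^sub>R e + x) \<in> borel \<rightarrow>\<^sub>M borel" by simp
      have fb: "f \<in> borel_measurable borel" using fcont by (rule borel_measurable_continuous_onI)
      have "integrable (distr lborel borel (\<lambda>x. h n *\<^sub>R e + x)) f"
        using fint by (simp add: lborel_distr_plus)
      then show "integrable lborel (\<lambda>x. f (x + h n *\<^sub>R e))"
        using fb by (subst (asm) integrable_distr_eq) (auto simp: add.commute)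
      have "(\<integral>x. f x \<partial>distr lborel borel (\<lambda>x. h n *\<^sub>R e + x)) = (\<integral>x. f x \<partial>lborel)"
        by (simp add: lborel_distr_plus)
      then show "(\<integral>x. f (x + h n *\<^sub>R e) \<partial>lborel) = (\<integral>x. f x \<partial>lborel)"
        using fb by (subst (asm) integral_distr) (auto simp: add.commute)
    qed
    with fint show ?thesis by simp
  qed
  have "(\<lambda>n. \<integral>x. (f (x + h n *\<^sub>R e) - f x) / h n \<partial>lborel) \<longlonglongrightarrow> (\<integral>x. f' x e \<partial>lborel)"
  proof (rule integral_dominated_convergence[where w = "\<lambda>x. B * indicator D x"])
    show "(\<lambda>x. f' x e) \<in> borel_measurable lborel"
      using cont by (simp add: borel_measurable_continuous_onI)
    show "(\<lambda>x. (f (x + h n *\<^sub>R e) - f x) / h n) \<in> borel_measurable lborel" for n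
    proof -
      have "continuous_on UNIV (\<lambda>x. (f (x + h n *\<^sub>R e) - f x) / h n)"
        using h(1)[of n] by (intro continuous_intros continuous_on_compose2[OF fcont]) auto
      then show ?thesis by (simp add: borel_measurable_continuous_onI)
    qed
    show "integrable lborel (\<lambda>x. B * indicator D x)"
      using emeasure_compact_finite[OF \<open>compact D\<close>] \<open>compact D\<close>
      by (intro integrable_mult_right integrable_real_indicator) (auto simp: borel_compact)
    show "AE x in lborel. (\<lambda>n. (f (x + h n *\<^sub>R e) - f x) / h n) \<longlonglongrightarrow> f' x e"
    proof (rule AE_I2)
      fix x
      have "((\<lambda>t. x + t *\<^sub>R e) has_derivative (\<lambda>s. s *\<^sub>R e)) (at 0)"
        by (auto intro!: derivative_eq_intros)
      from has_derivative_compose[OF this d]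
      have "((\<lambda>t. f (x + t *\<^sub>R e)) has_real_derivative f' x e) (at 0)"
        unfolding has_field_derivative_def
        by (rule has_derivative_eq_rhs)
          (simp add: fun_eq_iff linear_scale[OF has_derivative_linear[OF d]] mult.commute)
      then have "((\<lambda>t. (f (x + t *\<^sub>R e) - f x) / t) \<longlongrightarrow> f' x e) (at 0)"
        by (simp add: DERIV_def)
      moreover have "filterlim h (at 0) sequentially"
        using h0 h(1) by (auto simp: filterlim_at intro!: always_eventually) (metis less_irrefl)
      ultimately show "(\<lambda>n. (f (x + h n *\<^sub>R e) - f x) / h n) \<longlonglongrightarrow> f' x e"
        by (rule filterlim_compose)
    qed
    show "AE x in lborel. norm ((f (x + h n *\<^sub>R e) - f x) / h n) \<le> B * indicator D x" for n
    proof (rule AE_I2)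
      fix x
      show "norm ((f (x + h n *\<^sub>R e) - f x) / h n) \<le> B * indicator D x"
        using lip[of "h n" x] outside[of x "h n"] h[of n]
        by (cases "x \<in> D") (auto simp: pos_divide_le_eq)
    qed
  qed
  then show "(\<integral>x. f' x e \<partial>lborel) = 0"
    unfolding mean0 by (simp add: LIMSEQ_const_iff)
qed

text \<open>The compactly supported field \<open>\<eta> y * S (y, u y)\<close> has divergence of
  integral zero. Its divergence contains \<open>W \<bullet> \<nabla>u\<close>, which is traded for
  the two quadratic terms; derivatives of \<open>\<eta>\<close> are controlled by the bound
  \<open>M\<close> on \<open>S\<close>. The right-hand side does not involve \<open>\<psi>\<close>,
  so it can bound arbitrarily long sums of weights.\<close>

lemma calibration_energy_bound:
  fixes u \<eta> :: "real ^ 'n::finite \<Rightarrow> real"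
  assumes cal: "calibration S S' \<psi> e M"
    and V: "open V" "\<And>y. y \<in> V \<Longrightarrow> (u has_derivative u' y) (at y)" "\<And>v. continuous_on V (\<lambda>y. u' y v)"
    and \<eta>: "\<And>y. (\<eta> has_derivative \<eta>' y) (at y)" "\<And>v. continuous_on UNIV (\<lambda>y. \<eta>' y v)" "\<And>y. 0 \<le> \<eta> y"
    and C: "compact C" "C \<subseteq> V" "\<And>y. y \<notin> C \<Longrightarrow> \<eta> y = 0"
    and f: "integrable lborel f" "\<And>y. f y \<le> \<eta> y * \<psi> (y, u y)"
  shows "(\<integral>y. f y \<partial>lborel) \<le> (\<integral>y. \<eta> y * (e + 16 * (\<Sum>i\<in>UNIV. (u' y (axis i 1))\<^sup>2)) \<partial>lborel)
    + (\<integral>y. M * (\<Sum>i\<in>UNIV. \<bar>\<eta>' y (axis i 1)\<bar>) \<partial>lborel)"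
proof -
  have S: "\<And>x. (S has_derivative S' x) (at x)" "\<And>v. continuous_on UNIV (\<lambda>x. S' x v)" "\<And>x. norm (S x) \<le> M"
    and ineq: "\<And>x. \<psi> x - e \<le> (\<Sum>i\<in>UNIV. S' x (axis i 1, 0) $ i) - (norm (S' x (0, 1)))\<^sup>2 / 64"
    using cal unfolding calibration_def by blast+
  have Slin: "linear (S' x)" for x by (rule has_derivative_linear[OF S(1)])
  have closedC: "closed C" by (rule compact_imp_closed[OF C(1)])
  have \<eta>'0: "\<eta>' y v = 0" if "y \<notin> C" for y v
    using has_derivative_zero_outside_closed[OF \<eta>(1) closedC C(3) that] by simp
  have \<eta>c: "continuous_on UNIV \<eta>"
    using \<eta>(1) by (meson continuous_at_imp_continuous_on has_derivative_continuous)
  have uc: "continuous_on V u"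
    using V(1,2) by (meson continuous_at_imp_continuous_on has_derivative_continuous)
  \<comment> \<open>\<open>u\<close> is only known on \<open>V\<close>, but each product has a
    factor vanishing off \<open>C \<subseteq> V\<close>, and the open sets \<open>V\<close> and
    \<open>- C\<close> cover the space.\<close>
  have extend: "continuous_on UNIV (\<lambda>y. \<beta> y * g y)"
    if "continuous_on V g" "continuous_on UNIV \<beta>" "\<And>y. y \<notin> C \<Longrightarrow> \<beta> y = 0" for g \<beta> :: "real ^ 'n \<Rightarrow> real"
  proof -
    have "continuous_on V (\<lambda>y. \<beta> y * g y)"
      using that by (intro continuous_intros) (auto intro: continuous_on_subset)
    moreover have "continuous_on (- C) (\<lambda>y. \<beta> y * g y)"
      by (rule continuous_on_eq[OF continuous_on_const[of _ 0]]) (simp add: that(3))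
    ultimately have "continuous_on (V \<union> - C) (\<lambda>y. \<beta> y * g y)"
      using V(1) closedC by (intro continuous_on_open_Un) auto
    moreover have "V \<union> - C = UNIV" using C(2) by auto
    ultimately show ?thesis by simp
  qed
  define F where "F i y = \<eta> y * S (y, u y) $ i" for i y
  define F' where "F' i y v = \<eta>' y v * S (y, u y) $ i + \<eta> y * S' (y, u y) (v, u' y v) $ i" for i y v
  have dF: "(F i has_derivative F' i y) (at y)" for i y
  proof (cases "y \<in> V")
    case True
    have "((\<lambda>y. (y, u y)) has_derivative (\<lambda>v. (v, u' y v))) (at y)"
      by (intro has_derivative_Pair has_derivative_ident V(2) True)
    from has_derivative_vec_nth'[OF has_derivative_compose[OF this S(1)], of i]
    have "((\<lambda>y. S (y, u y) $ i) has_derivative (\<lambda>v. S' (y, u y) (v, u' y v) $ i)) (at y)" .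
    from has_derivative_mult[OF \<eta>(1) this] show ?thesis
      unfolding F_def[abs_def] F'_def[abs_def] by (simp add: add.commute)
  next
    case False
    then have y: "y \<notin> C" using C(2) by auto
    have "((\<lambda>_. 0) has_derivative F' i y) (at y)"
      by (simp add: F'_def[abs_def] \<eta>'0[OF y] C(3)[OF y])
    then show ?thesis
      by (rule has_derivative_transform_within_open[of _ _ _ _ "- C"])
        (use closedC y in \<open>auto simp: F_def C(3)\<close>)
  qed
  have pair: "continuous_on V (\<lambda>y. (y, u y))"
    by (intro continuous_intros uc)
  have Sc: "continuous_on UNIV S"
    using S(1) by (meson continuous_at_imp_continuous_on has_derivative_continuous)
  have F'c: "continuous_on UNIV (\<lambda>y. F' i y v)" for i v
  proof -
    have lin: "S' x (v, t) $ i = S' x (v, 0) $ i + t * S' x (0, 1) $ i" for x t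
      using linear_add[OF Slin, of x "(v, 0)" "(0, t)"] linear_scale[OF Slin, of x t "(0, 1)"] by simp
    have comp: "continuous_on V (\<lambda>y. S' (y, u y) w)" for w
      by (rule continuous_on_compose2[OF S(2)[of w] pair]) auto
    have "continuous_on V (\<lambda>y. S' (y, u y) (v, 0) $ i + u' y v * S' (y, u y) (0, 1) $ i)"
      by (intro continuous_intros continuous_on_component comp V(3))
    then have "continuous_on V (\<lambda>y. S' (y, u y) (v, u' y v) $ i)"
      using lin[of _ "u' _ v"] by simp
    moreover have "continuous_on V (\<lambda>y. S (y, u y) $ i)"
      by (intro continuous_on_component continuous_on_compose2[OF Sc pair]) auto
    ultimately show ?thesis
      unfolding F'_def by (intro continuous_on_add extend \<eta>c \<eta>(2) C(3) \<eta>'0)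
  qed
  have F0: "F i y = 0" if "y \<notin> C" for i y
    using C(3)[OF that] by (simp add: F_def)
  note F'int = integral_derivative_compact_support[OF dF F'c C(1) F0]
  define g1 where "g1 y = \<eta> y * (e + 16 * (\<Sum>i\<in>UNIV. (u' y (axis i 1))\<^sup>2))" for y
  define g2 where "g2 y = M * (\<Sum>i\<in>UNIV. \<bar>\<eta>' y (axis i 1)\<bar>)" for y
  have "integrable lborel g1"
    unfolding g1_def
    by (rule integrable_continuous_compact_support[OF _ C(1)], rule extend)
      (auto intro!: continuous_intros V(3) \<eta>c simp: C(3))
  moreover have "integrable lborel g2"
    unfolding g2_def
    by (rule integrable_continuous_compact_support[OF _ C(1)]) (auto intro!: continuous_intros \<eta>(2) simp: \<eta>'0)
  moreover have "f y \<le> g1 y + g2 y + (\<Sum>i\<in>UNIV. F' i y (axis i 1))" for y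
  proof -
    define W where "W = S' (y, u y) (0, 1)"
    define D where "D = (\<Sum>i\<in>UNIV. S' (y, u y) (axis i 1, 0) $ i)"
    have lin: "S' (y, u y) (v, t) $ i = S' (y, u y) (v, 0) $ i + t * W $ i" for v t i
      using linear_add[OF Slin, of "(y, u y)" "(v, 0)" "(0, t)"] linear_scale[OF Slin, of "(y, u y)" t "(0, 1)"]
      by (simp add: W_def)
    have sF: "(\<Sum>i\<in>UNIV. F' i y (axis i 1))
        = (\<Sum>i\<in>UNIV. \<eta>' y (axis i 1) * S (y, u y) $ i) + \<eta> y * (D + (\<Sum>i\<in>UNIV. u' y (axis i 1) * W $ i))"
      by (simp add: F'_def lin[of _ "u' y _"] D_def sum.distrib sum_distrib_left distrib_left)
    have sq: "(norm W)\<^sup>2 = (\<Sum>i\<in>UNIV. (W $ i)\<^sup>2)"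
      by (simp add: norm_vec_def L2_set_def sum_nonneg)
    \<comment> \<open>The square behind the constants \<open>1 / 64\<close> and \<open>16\<close>;
      its mixed term has coefficient \<open>2 * (1 / 8) * 4 = 1\<close>.\<close>
    have "0 \<le> (\<Sum>i\<in>UNIV. (W $ i / 8 + 4 * u' y (axis i 1))\<^sup>2)"
      by (intro sum_nonneg) auto
    also have "\<dots> = (norm W)\<^sup>2 / 64 + (\<Sum>i\<in>UNIV. u' y (axis i 1) * W $ i) + 16 * (\<Sum>i\<in>UNIV. (u' y (axis i 1))\<^sup>2)"
      unfolding sq by (simp add: power2_sum power_mult_distrib power_divide sum.distrib sum_divide_distrib sum_distrib_left mult.commute)
    finally have "\<psi> (y, u y) \<le> e + 16 * (\<Sum>i\<in>UNIV. (u' y (axis i 1))\<^sup>2) + (D + (\<Sum>i\<in>UNIV. u' y (axis i 1) * W $ i))"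
      using ineq[of "(y, u y)"] by (simp add: W_def D_def)
    then have "\<eta> y * \<psi> (y, u y) \<le> g1 y + \<eta> y * (D + (\<Sum>i\<in>UNIV. u' y (axis i 1) * W $ i))"
      using mult_left_mono[OF _ \<eta>(3)[of y]] unfolding g1_def by (simp add: distrib_left[symmetric])
    moreover have "- (\<Sum>i\<in>UNIV. \<eta>' y (axis i 1) * S (y, u y) $ i) \<le> g2 y"
      unfolding g2_def sum_distrib_left sum_negf[symmetric]
    proof (rule sum_mono)
      fix i
      have "\<bar>S (y, u y) $ i\<bar> \<le> M"
        using component_le_norm_cart[of "S (y, u y)" i] S(3)[of "(y, u y)"] by linarith
      then have "\<bar>\<eta>' y (axis i 1)\<bar> * \<bar>S (y, u y) $ i\<bar> \<le> \<bar>\<eta>' y (axis i 1)\<bar> * M"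
        by (rule mult_left_mono) simp
      then show "- (\<eta>' y (axis i 1) * S (y, u y) $ i) \<le> M * \<bar>\<eta>' y (axis i 1)\<bar>"
        by (simp add: abs_mult[symmetric] mult.commute) 
    qed
    ultimately show ?thesis
      using f(2)[of y] unfolding sF by linarith
  qed
  ultimately have "(\<integral>y. f y \<partial>lborel) \<le> (\<integral>y. g1 y + g2 y + (\<Sum>i\<in>UNIV. F' i y (axis i 1)) \<partial>lborel)"
    using f(1) F'int(1) by (intro integral_mono) auto
  also have "\<dots> = (\<integral>y. g1 y \<partial>lborel) + (\<integral>y. g2 y \<partial>lborel)"
    using \<open>integrable lborel g1\<close> \<open>integrable lborel g2\<close> F'int by simp
  finally show ?thesis
    by (simp add: g1_def[abs_def] g2_def[abs_def])
qed

section \<open>Choice of the hyperplanes and of their scales\<close>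

text \<open>The pairing function lists every point of a countable dense set infinitely often, so
  each open set is visited at arbitrarily late indices.\<close>

lemma exists_dense_sequence:
  obtains s :: "nat \<Rightarrow> 'a::second_countable_topology"
  where "\<And>U m. open U \<Longrightarrow> U \<noteq> {} \<Longrightarrow> \<exists>k\<ge>m. s k \<in> U"
proof -
  obtain D :: "'a set" where D: "countable D" "\<And>U. open U \<Longrightarrow> U \<noteq> {} \<Longrightarrow> \<exists>d\<in>D. d \<in> U"
    using countable_dense_exists by blast
  show ?thesis
  proof (rule that[of "\<lambda>k. from_nat_into D (fst (prod_decode k))"])
    fix U :: "'a set" and m :: nat
    assume "open U" "U \<noteq> {}"
    then obtain d where d: "d \<in> D" "d \<in> U" using D(2) by blast
    obtain i where "from_nat_into D i = d"
      using from_nat_into_surj[OF D(1) d(1)] by blast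
    then show "\<exists>k\<ge>m. from_nat_into D (fst (prod_decode k)) \<in> U"
      using d(2) by (intro exI[of _ "prod_encode (i, m)"]) (simp add: le_prod_encode_2)
  qed
qed

lemma calibration_mono:
  assumes "calibration S S' \<psi> e M" "e \<le> e'" "M \<le> M'"
  shows "calibration S S' \<psi> e' M'"
  using assms unfolding calibration_def
  by (meson order_trans diff_left_mono)

text \<open>\<open>off_grid_small\<close> uses boxes that exhaust the space and summable bounds, so
  that Borel-Cantelli applies on every bounded region. In \<open>calibrated\<close> the constants
  are chosen before \<open>K\<close>; this uniformity bounds the contributions of all hyperplanes
  together.\<close>

locale hole_scheme =
  fixes p :: "nat \<Rightarrow> real ^ 'n::finite" and q :: "nat \<Rightarrow> real" and J :: "nat \<Rightarrow> nat set"
  assumes dense: "\<And>U m. open U \<Longrightarrow> U \<noteq> {} \<Longrightarrow> \<exists>k\<ge>m. (p k, q k) \<in> U"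
    and finite_J: "\<And>k. finite (J k)"
    and J_ge: "\<And>k j. j \<in> J k \<Longrightarrow> k \<le> j"
    and off_grid_small: "\<And>k. measure lebesgue {y \<in> cbox (\<chi> i. - (2 ^ k)) (\<chi> i. 2 ^ k) :: (real ^ 'n) set.
      \<forall>j\<in>J k. \<not> near_grid k j (1 / (4 * CARD('n))) y} < (1 / 2) ^ k"
    and calibrated: "\<exists>e M. \<forall>K. \<exists>S S'. calibration S S'
      (\<lambda>x. \<Sum>k<K. \<Sum>j\<in>J k. weight (p k) (q k) (frequency k) j x) e M"

text \<open>The recursion carries the accumulated weight together with a vertical Lipschitz
  constant, because that constant decides how fine the scales of the next hyperplane must
  be.\<close>

lemma exists_hole_scheme:
  assumes n: "2 < CARD('n::finite)"
  obtains p :: "nat \<Rightarrow> real ^ 'n" and q J where "hole_scheme p q J"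
proof -
  obtain s :: "nat \<Rightarrow> (real ^ 'n) \<times> real" where s: "\<And>U m. open U \<Longrightarrow> U \<noteq> {} \<Longrightarrow> \<exists>k\<ge>m. s k \<in> U"
    using exists_dense_sequence by blast
  define p where "p k = fst (s k)" for k
  define q where "q k = snd (s k)" for k
  define \<delta> :: real where "\<delta> = 1 / (4 * CARD('n))"
  have \<delta>: "0 < \<delta>" "\<delta> \<le> 1" using n by (auto simp: \<delta>_def)
  define H where "H k I x = (\<Sum>j\<in>I. weight (p k) (q k) (frequency k) j x)" for k I x
  define dE where "dE k = (frequency k)\<^sup>2 / 2 + (1 / 2) ^ k" for k
  define E where "E k = (\<Sum>i<k. dE i)" for k
  define M where "M k = (\<Sum>i<k. (1 / 2 :: real) ^ i)" for k
  define small where "small k I \<longleftrightarrow> finite I \<and> (\<forall>j\<in>I. k \<le> j) \<and>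
    measure lebesgue {y \<in> cbox (\<chi> i. - (2 ^ k)) (\<chi> i. 2 ^ k) :: (real ^ 'n) set.
      \<forall>j\<in>I. \<not> near_grid k j \<delta> y} < (1 / 2) ^ k" for k and I :: "nat set"
  \<comment> \<open>The clause for \<open>k = 0\<close> pins the starting function, so that the
    accumulated weight can afterwards be identified with the sum.\<close>
  define P where "P k st \<longleftrightarrow> (\<exists>S S'. calibration S S' (fst st) (E k) (M k)) \<and>
    (\<exists>l. \<forall>y z z'. \<bar>fst st (y, z) - fst st (y, z')\<bar> \<le> l * \<bar>z - z'\<bar>) \<and> (k = 0 \<longrightarrow> fst st = (\<lambda>_. 0))"
    for k and st :: "((real ^ 'n) \<times> real \<Rightarrow> real) \<times> nat set"
  define R where "R k st st' \<longleftrightarrow> small k (snd st') \<and> fst st' = (\<lambda>x. fst st x + H k (snd st') x)"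
    for k and st st' :: "((real ^ 'n) \<times> real \<Rightarrow> real) \<times> nat set"
  have "\<exists>f. \<forall>k. P k (f k) \<and> R k (f k) (f (Suc k))"
  proof (rule dependent_nat_choice)
    have "calibration (\<lambda>_. 0) (\<lambda>_ _. 0) (\<lambda>_ :: (real ^ 'n) \<times> real. 0) (E 0) (M 0)"
      by (simp add: calibration_def E_def M_def)
    then show "\<exists>st. P 0 st"
      unfolding P_def by (intro exI[of _ "(\<lambda>_. 0, {})"]) (auto intro: exI[of _ 0])
  next
    fix st k assume st: "P k st"
    then obtain S S' l where cal: "calibration S S' (fst st) (E k) (M k)"
      and l: "\<And>y z z'. \<bar>fst st (y, z) - fst st (y, z')\<bar> \<le> l * \<bar>z - z'\<bar>"
      unfolding P_def by blast
    have l0: "0 \<le> l"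
      using order_trans[OF abs_ge_zero l[of 0 0 1]] by simp
    \<comment> \<open>Collects the costs of \<open>calibration_step\<close> that are proportional to
      \<open>2 ^ (- m)\<close>: new layers, vertical shift of the old weights, and the term added
      along \<open>p\<close> by the shear. The choice of \<open>m\<close> makes their total at most
      \<open>2 ^ (- k)\<close>.\<close>
    define d where "d = 1 + 10 * l + 320 * norm (p k)"
    have d: "0 < d" unfolding d_def using l0 by (intro add_pos_nonneg) auto
    then have "0 < (1 / 2) ^ k / d" by simp
    then obtain m0 where m0: "(1 / 2 :: real) ^ m0 < (1 / 2) ^ k / d"
      using real_arch_pow_inv[of "(1 / 2) ^ k / d" "1 / 2"] by auto
    define m where "m = max m0 k"
    have "(1 / 2 :: real) ^ m \<le> (1 / 2) ^ m0"
      unfolding m_def by (intro power_decreasing) auto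
    also note m0
    finally have "(1 / 2 :: real) ^ m * d < (1 / 2) ^ k"
      using d by (simp only: pos_less_divide_eq)
    then have m: "(1 / 2 :: real) ^ m + 10 * l * (1 / 2) ^ m + 320 * (1 / 2) ^ m * norm (p k) \<le> (1 / 2) ^ k"
      by (simp add: d_def algebra_simps)
    obtain b where b: "measure lebesgue {y \<in> cbox (\<chi> i. - (2 ^ k)) (\<chi> i. 2 ^ k) :: (real ^ 'n) set.
      \<forall>j\<in>{m..b}. \<not> near_grid k j \<delta> y} < (1 / 2) ^ k"
    proof (rule measure_off_grid_small)
      show "0 < \<delta>" "\<delta> \<le> 1" by (fact \<delta>)+
      show "0 < (1 / 2 :: real) ^ k" by simp
    qed (rule that)
    define st' where "st' = ((\<lambda>x. fst st x + H k {m..b} x), {m..b})"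
    have fr: "frequency k \<noteq> 0" by (simp add: frequency_def)
    have "\<exists>S1 S1'. calibration S1 S1' (\<lambda>x. fst st x + H k {m..b} x)
        (E k + (frequency k)\<^sup>2 / 2 + 10 * l * (1 / 2) ^ m) (M k + 320 * (1 / 2) ^ m * norm (p k) + (1 / 2) ^ m)"
      unfolding H_def by (rule calibration_step[OF cal n fr finite_atLeastAtMost _ l]) simp
    then obtain S1 S1' where cal1: "calibration S1 S1' (\<lambda>x. fst st x + H k {m..b} x)
        (E k + (frequency k)\<^sup>2 / 2 + 10 * l * (1 / 2) ^ m) (M k + 320 * (1 / 2) ^ m * norm (p k) + (1 / 2) ^ m)"
      by blast
    have nonneg: "0 \<le> 10 * l * (1 / 2) ^ m" "0 \<le> 320 * (1 / 2) ^ m * norm (p k)" "0 \<le> (1 / 2 :: real) ^ m"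
      using l0 by auto
    have "calibration S1 S1' (\<lambda>x. fst st x + H k {m..b} x) (E (Suc k)) (M (Suc k))"
    proof (rule calibration_mono[OF cal1])
      show "E k + (frequency k)\<^sup>2 / 2 + 10 * l * (1 / 2) ^ m \<le> E (Suc k)"
        using m nonneg unfolding E_def dE_def sum.lessThan_Suc by linarith
      show "M k + 320 * (1 / 2) ^ m * norm (p k) + (1 / 2) ^ m \<le> M (Suc k)"
        using m nonneg unfolding M_def sum.lessThan_Suc by linarith
    qed
    moreover have "\<exists>l'. \<forall>y z z'. \<bar>fst st (y, z) + H k {m..b} (y, z) - (fst st (y, z') + H k {m..b} (y, z'))\<bar> \<le> l' * \<bar>z - z'\<bar>"
    proof (intro exI allI)
      fix y z z'
      have "\<bar>H k {m..b} (y, z) - H k {m..b} (y, z')\<bar>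
          \<le> (\<Sum>j\<in>{m..b}. \<bar>weight (p k) (q k) (frequency k) j (y, z) - weight (p k) (q k) (frequency k) j (y, z')\<bar>)"
        unfolding H_def sum_subtractf[symmetric] by (rule sum_abs)
      also have "\<dots> \<le> (\<Sum>j\<in>{m..b}. 4 * 2 ^ j * \<bar>z - z'\<bar>)"
        by (intro sum_mono weight_lipschitz)
      finally show "\<bar>fst st (y, z) + H k {m..b} (y, z) - (fst st (y, z') + H k {m..b} (y, z'))\<bar>
          \<le> (l + (\<Sum>j\<in>{m..b}. 4 * 2 ^ j)) * \<bar>z - z'\<bar>"
        using l[of y z z'] unfolding distrib_right sum_distrib_right by linarith
    qed
    ultimately have "P (Suc k) st'"
      unfolding P_def st'_def fst_conv by blast
    moreover have "R k st st'"
      unfolding R_def small_def st'_def using b by (auto simp: m_def)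
    ultimately show "\<exists>st'. P (Suc k) st' \<and> R k st st'" by blast
  qed
  then obtain f where f: "\<And>k. P k (f k)" "\<And>k. R k (f k) (f (Suc k))" by blast
  define J where "J k = snd (f (Suc k))" for k
  have fK: "fst (f K) = (\<lambda>x. \<Sum>k<K. H k (J k) x)" for K
  proof (induction K)
    case 0
    then show ?case using f(1)[of 0] by (simp add: P_def)
  next
    case (Suc K)
    then show ?case using f(2)[of K] by (simp add: R_def J_def)
  qed
  have "hole_scheme p q J"
  proof
    show "\<exists>k\<ge>m. (p k, q k) \<in> U" if "open U" "U \<noteq> {}" for U m
      using s[OF that, of m] by (simp add: p_def q_def)
    have J: "small k (J k)" for k
      using f(2)[of k] by (simp add: R_def J_def)
    show "finite (J k)" "measure lebesgue {y \<in> cbox (\<chi> i. - (2 ^ k)) (\<chi> i. 2 ^ k) :: (real ^ 'n) set.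
      \<forall>j\<in>J k. \<not> near_grid k j (1 / (4 * CARD('n))) y} < (1 / 2) ^ k" for k
      using J[of k] unfolding small_def \<delta>_def by blast+
    show "k \<le> j" if "j \<in> J k" for k j
      using J[of k] that unfolding small_def by blast
    have M: "summable (\<lambda>k. (1 / 2 :: real) ^ k)" by (simp add: summable_geometric)
    have dE: "summable dE"
    proof -
      \<comment> \<open>The periodicity losses form a geometric series because the mesh doubles with
        \<open>k\<close>.\<close>
      have "dE k = 2 * pi\<^sup>2 * (1 / 4) ^ k + (1 / 2) ^ k" for k
      proof -
        have "(2 ^ k)\<^sup>2 = (4::real) ^ k"
          by (simp add: power2_eq_square power_mult_distrib[symmetric])
        then show ?thesis
          by (simp add: dE_def frequency_def power_divide power_mult_distrib)
      qed
      then have "dE = (\<lambda>k. 2 * pi\<^sup>2 * (1 / 4) ^ k + (1 / 2) ^ k)" by blast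
      then show ?thesis
        by (simp add: summable_add summable_mult summable_geometric)
    qed
    have bd: "E K \<le> suminf dE" "M K \<le> (\<Sum>k. (1 / 2) ^ k)" for K
      unfolding E_def M_def by (intro sum_le_suminf dE M; simp add: dE_def)+
    show "\<exists>e M. \<forall>K. \<exists>S S'. calibration S S' (\<lambda>x. \<Sum>k<K. \<Sum>j\<in>J k. weight (p k) (q k) (frequency k) j x) e M"
    proof (rule exI, rule exI, rule allI)
      fix K
      obtain S S' where "calibration S S' (fst (f K)) (E K) (M K)"
        using f(1)[of K] unfolding P_def by blast
      then have "calibration S S' (fst (f K)) (suminf dE) (\<Sum>k. (1 / 2) ^ k)"
        using bd by (rule calibration_mono)
      then show "\<exists>S S'. calibration S S' (\<lambda>x. \<Sum>k<K. \<Sum>j\<in>J k. weight (p k) (q k) (frequency k) j x)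
          (suminf dE) (\<Sum>k. (1 / 2) ^ k)"
        unfolding fK H_def by blast
    qed
  qed
  then show ?thesis by (rule that)
qed

section \<open>Holes met by a graph\<close>

context hole_scheme
begin

definition H :: "nat \<Rightarrow> ((real ^ 'n) \<times> real) set" where
  "H k = hole (p k) (q k) k (J k)"

lemma open_H: "open (H k)"
  unfolding H_def by (rule open_hole)

text \<open>The energy bound has the same right-hand side \<open>A\<close> for all \<open>K\<close>,
  so the sets \<open>B k\<close> of points over which the graph runs in the \<open>k\<close>-th
  holes have summable measure. Borel-Cantelli concludes.\<close>

lemma graph_hits_finitely_many_holes:
  fixes u :: "real ^ 'n \<Rightarrow> real"
  assumes V: "open V" "y0 \<in> V" "\<And>y. y \<in> V \<Longrightarrow> (u has_derivative u' y) (at y)"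
    "\<And>v. continuous_on V (\<lambda>y. u' y v)"
  obtains r where "0 < r" "ball y0 r \<subseteq> V" "negligible {y \<in> ball y0 r. \<exists>\<^sub>\<infinity>k. (y, u y) \<in> H k}"
proof -
  obtain r0 where r0: "0 < r0" "cball y0 r0 \<subseteq> V"
    using V(1,2) by (meson open_contains_cball)
  define r where "r = r0 / 2"
  have r: "0 < r" "cball y0 (2 * r) \<subseteq> V" using r0 by (auto simp: r_def)
  \<comment> \<open>Supported in the closed ball of radius \<open>2 r\<close>, and at least
    \<open>c = (3 r\<^sup>2)\<^sup>2\<close> on the ball of radius \<open>r\<close>.\<close>
  define \<eta> where "\<eta> y = pos_sq (4 * r\<^sup>2 - (y - y0) \<bullet> (y - y0))" for y
  define \<eta>' where "\<eta>' y v = 2 * max 0 (4 * r\<^sup>2 - (y - y0) \<bullet> (y - y0)) * - (2 * ((y - y0) \<bullet> v))" for y v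
  have \<eta>: "(\<eta> has_derivative \<eta>' y) (at y)" for y
    unfolding \<eta>_def[abs_def] \<eta>'_def[abs_def]
    by (auto intro!: derivative_eq_intros simp: inner_commute)
  have \<eta>'c: "continuous_on UNIV (\<lambda>y. \<eta>' y v)" for v
    unfolding \<eta>'_def by (intro continuous_intros)
  have \<eta>0: "\<eta> y = 0" if "y \<notin> cball y0 (2 * r)" for y
  proof -
    have "2 * r < norm (y - y0)"
      using that by (simp add: dist_norm norm_minus_commute)
    then have "(2 * r)\<^sup>2 \<le> (norm (y - y0))\<^sup>2"
      using r by (intro power_mono) auto
    then show ?thesis
      by (simp add: \<eta>_def pos_sq_def power2_norm_eq_inner power_mult_distrib)
  qed
  define c where "c = (3 * r\<^sup>2)\<^sup>2"
  have c: "0 < c" using r by (simp add: c_def)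
  have \<eta>c: "c \<le> \<eta> y" if "y \<in> ball y0 r" for y
  proof -
    have "norm (y - y0) \<le> r"
      using that by (simp add: dist_norm norm_minus_commute)
    then have "(norm (y - y0))\<^sup>2 \<le> r\<^sup>2"
      by (intro power_mono) auto
    then show ?thesis
      unfolding c_def \<eta>_def pos_sq_def by (intro power_mono) (auto simp: power2_norm_eq_inner)
  qed
  obtain e M where cal: "\<And>K. \<exists>S S'. calibration S S'
      (\<lambda>x. \<Sum>k<K. \<Sum>j\<in>J k. weight (p k) (q k) (frequency k) j x) e M"
    using calibrated by blast
  define A where "A = (\<integral>y. \<eta> y * (e + 16 * (\<Sum>i\<in>UNIV. (u' y (axis i 1))\<^sup>2)) \<partial>lborel)
    + (\<integral>y. M * (\<Sum>i\<in>UNIV. \<bar>\<eta>' y (axis i 1)\<bar>) \<partial>lborel)"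
  define B where "B k = {y \<in> ball y0 r. (y, u y) \<in> H k}" for k
  have uc: "continuous_on V u"
    using V(1,3) by (meson continuous_at_imp_continuous_on has_derivative_continuous)
  have "open (B k)" for k
  proof -
    have "ball y0 r \<subseteq> V" using r by (auto simp: subset_iff)
    then have "continuous_on (ball y0 r) (\<lambda>y. (y, u y))"
      by (intro continuous_intros continuous_on_subset[OF uc])
    then have "open ((\<lambda>y. (y, u y)) -` H k \<inter> ball y0 r)"
      by (simp add: continuous_on_open_vimage open_H)
    moreover have "(\<lambda>y. (y, u y)) -` H k \<inter> ball y0 r = B k"
      by (auto simp: B_def)
    ultimately show ?thesis by simp
  qed
  then have Bb: "B k \<in> sets lborel" for k by simp
  have Bfin: "emeasure lborel (B k) < \<infinity>" for k
  proof (rule le_less_trans)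
    show "emeasure lborel (B k) \<le> emeasure lborel (ball y0 r)"
      by (intro emeasure_mono) (auto simp: B_def)
  qed (rule emeasure_lborel_ball_finite)
  have Bint: "integrable lborel (\<lambda>y. indicat_real (B k) y)" for k
    using Bb Bfin by (intro integrable_real_indicator) auto
  have sums: "(\<Sum>k<K. measure lborel (B k)) \<le> 8 * A / c" for K
  proof -
    obtain S S' where S: "calibration S S' (\<lambda>x. \<Sum>k<K. \<Sum>j\<in>J k. weight (p k) (q k) (frequency k) j x) e M"
      using cal by blast
    define f where "f y = (\<Sum>k<K. c / 8 * indicat_real (B k) y)" for y
    have "(\<integral>y. f y \<partial>lborel) \<le> A"
      unfolding A_def
    proof (rule calibration_energy_bound[OF S V(1,3,4) \<eta> \<eta>'c _ compact_cball r(2) \<eta>0])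
      show "integrable lborel f"
        unfolding f_def using Bint by (intro Bochner_Integration.integrable_sum integrable_mult_right)
      show "0 \<le> \<eta> y" for y by (simp add: \<eta>_def pos_sq_nonneg)
      show "f y \<le> \<eta> y * (\<Sum>k<K. \<Sum>j\<in>J k. weight (p k) (q k) (frequency k) j (y, u y))" for y
        unfolding f_def sum_distrib_left[of "\<eta> y" _ "{..<K}"]
      proof (rule sum_mono)
        fix k
        define w where "w = (\<Sum>j\<in>J k. weight (p k) (q k) (frequency k) j (y, u y))"
        have w: "0 \<le> w"
          unfolding w_def by (intro sum_nonneg weight_nonneg)
        have "c / 8 * indicat_real (B k) y \<le> \<eta> y * w"
        proof (cases "y \<in> B k")
          case True
          then have "1 / 8 \<le> w" "c \<le> \<eta> y"
            unfolding w_def using weight_hole_ge[OF _ finite_J] \<eta>c by (auto simp: B_def H_def)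
          then have "c * (1 / 8) \<le> \<eta> y * w"
            using c by (intro mult_mono) auto
          with True show ?thesis by simp
        next
          case False
          then show ?thesis
            using w by (simp add: \<eta>_def pos_sq_nonneg)
        qed
        then show "c / 8 * indicat_real (B k) y \<le> \<eta> y * (\<Sum>j\<in>J k. weight (p k) (q k) (frequency k) j (y, u y))"
          by (simp only: w_def)
      qed
    qed
    moreover have "(\<integral>y. f y \<partial>lborel) = c / 8 * (\<Sum>k<K. measure lborel (B k))"
    proof -
      have "(\<integral>y. f y \<partial>lborel) = (\<Sum>k<K. \<integral>y. c / 8 * indicat_real (B k) y \<partial>lborel)"
        unfolding f_def using Bint by (intro Bochner_Integration.integral_sum integrable_mult_right)
      also have "\<dots> = (\<Sum>k<K. c / 8 * measure lborel (B k))"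
        using Bb Bfin by (intro sum.cong refl) simp
      finally show ?thesis by (simp only: sum_distrib_left)
    qed
    ultimately show ?thesis
      using c by (simp add: pos_le_divide_eq mult.commute)
  qed
  have "summable (\<lambda>k. measure lborel (B k))"
    by (rule summableI_nonneg_bounded[OF _ sums]) simp
  from borel_cantelli_limsup1[OF Bb Bfin this] have "limsup B \<in> null_sets lborel" .
  moreover have "limsup B = {y \<in> ball y0 r. \<exists>\<^sub>\<infinity>k. (y, u y) \<in> H k}"
  proof -
    have "y \<in> limsup B \<longleftrightarrow> (\<exists>\<^sub>\<infinity>k. y \<in> B k)" for y
      unfolding limsup_INF_SUP INFM_nat_le by auto
    then show ?thesis
      unfolding B_def INFM_nat_le by blast
  qed
  ultimately have "negligible {y \<in> ball y0 r. \<exists>\<^sub>\<infinity>k. (y, u y) \<in> H k}"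
    by (simp add: negligible_iff_null_sets null_sets_completionI)
  moreover have "ball y0 r \<subseteq> V"
    using r by (auto simp: subset_iff)
  ultimately show ?thesis
    using r(1) that by blast
qed

end

section \<open>Surfaces meet finitely many holes\<close>

text \<open>Assembled from partial derivatives, so that it depends on \<open>f\<close> alone and
  inherits the bounds contained in \<open>C1_dist\<close>.\<close>

definition total_deriv :: "(real ^ 'n::finite \<Rightarrow> 'a::real_normed_vector) \<Rightarrow> real ^ 'n \<Rightarrow> real ^ 'n \<Rightarrow> 'a" where
  "total_deriv f x v = (\<Sum>i\<in>UNIV. v $ i *\<^sub>R partial_deriv i f x)"

lemma total_deriv_eq:
  assumes f: "(f has_derivative f') (at x within cube)" and x: "x \<in> cube"
  shows "total_deriv f x = f'"
proof
  fix v
  have lin: "linear f'" by (rule has_derivative_linear[OF f])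
  have "f' v = f' (\<Sum>i\<in>UNIV. v $ i *\<^sub>R axis i 1)"
    by (rule arg_cong[where f = f']) (use basis_expansion[of v] in \<open>simp add: scalar_mult_eq_scaleR\<close>)
  also have "\<dots> = total_deriv f x v"
    by (simp add: total_deriv_def partial_deriv_eq[OF f x] linear_sum[OF lin] linear_scale[OF lin])
  finally show "total_deriv f x v = f' v" by simp
qed

lemma C1_on_cubeE:
  assumes "C1_on_cube f"
  obtains f' where "\<And>x. x \<in> cube \<Longrightarrow> (f has_derivative blinfun_apply (f' x)) (at x within cube)"
    "continuous_on cube f'" "\<And>x. x \<in> cube \<Longrightarrow> total_deriv f x = blinfun_apply (f' x)"
proof -
  obtain f' where f': "\<And>x. x \<in> cube \<Longrightarrow> (f has_derivative blinfun_apply (f' x)) (at x within cube)"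
    "continuous_on cube f'"
    using assms unfolding C1_on_cube_def by blast
  then show ?thesis
    using that total_deriv_eq by blast
qed

lemma linear_bounded_below_left_inverse:
  fixes f :: "'a::euclidean_space \<Rightarrow>\<^sub>L 'a"
  assumes "0 < B" "\<And>v. B * norm v \<le> norm (f v)"
  obtains g where "g o\<^sub>L f = id_blinfun"
proof -
  have lin: "linear (blinfun_apply f)"
    by (rule bounded_linear.linear[OF blinfun.bounded_linear_right])
  have "inj (blinfun_apply f)"
  proof (rule injI)
    fix x y assume "blinfun_apply f x = blinfun_apply f y"
    then have "B * norm (x - y) \<le> 0"
      using assms(2)[of "x - y"] by (simp add: blinfun.diff_right)
    then show "x = y"
      using assms(1) by (simp add: mult_le_0_iff)
  qed
  then obtain h where h: "linear h" "h \<circ> blinfun_apply f = id"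
    using linear_injective_left_inverse[OF lin] by blast
  then have "bounded_linear h" by (simp add: linear_conv_bounded_linear)
  then have "Blinfun h o\<^sub>L f = id_blinfun"
    using h(2) by (intro blinfun_eqI) (simp add: bounded_linear_Blinfun_apply pointfree_idE)
  then show ?thesis by (rule that)
qed

text \<open>Needed for the derivative of a local inverse. With \<open>w y\<close> the preimage of
  \<open>v\<close>, one has \<open>L z (w y - w z) = - (L y - L z) (w y)\<close>; here
  \<open>w y\<close> stays bounded near \<open>z\<close> and \<open>L z\<close> is bounded
  below.\<close>

lemma continuous_on_inverse_family:
  fixes L :: "'b::metric_space \<Rightarrow> 'a::euclidean_space \<Rightarrow>\<^sub>L 'a"
  assumes L: "continuous_on V L" and bij: "\<And>y. y \<in> V \<Longrightarrow> bij (blinfun_apply (L y))"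
  shows "continuous_on V (\<lambda>y. inv (blinfun_apply (L y)) v)"
  unfolding continuous_on_def
proof (intro ballI)
  fix z assume z: "z \<in> V"
  define w where "w y = inv (blinfun_apply (L y)) v" for y
  have Lw: "L y (w y) = v" if "y \<in> V" for y
    using bij[OF that] by (simp add: w_def bij_is_surj surj_f_inv_f)
  obtain B where B: "0 < B" "\<And>x. B * norm x \<le> norm (L z x)"
    using linear_inj_bounded_below_pos[OF bounded_linear.linear[OF blinfun.bounded_linear_right, of "L z"]]
      bij[OF z] by (auto simp: bij_is_inj)
  define \<epsilon> where "\<epsilon> y = norm (L y - L z)" for y
  have "(L \<longlongrightarrow> L z) (at z within V)"
    using L z by (simp add: continuous_on_def)
  then have "(\<epsilon> \<longlongrightarrow> 0) (at z within V)"
    unfolding \<epsilon>_def by (intro tendsto_norm_zero LIM_zero)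
  then have \<epsilon>: "(\<epsilon> \<longlongrightarrow> 0) (at z within V)" "\<forall>\<^sub>F y in at z within V. \<epsilon> y < B / 2"
    using B(1) order_tendstoD(2)[of \<epsilon> 0 _ "B / 2"] by auto
  have bound: "norm (w y - w z) \<le> \<epsilon> y * (2 * norm v / B / B)" if y: "y \<in> V" "\<epsilon> y < B / 2" for y
  proof -
    have le: "norm ((L y - L z) (w y)) \<le> \<epsilon> y * norm (w y)"
      unfolding \<epsilon>_def by (rule norm_blinfun)
    have "L z (w y) = v - (L y - L z) (w y)"
      using Lw[OF y(1)] by (simp add: minus_blinfun.rep_eq)
    then have "B * norm (w y) \<le> norm v + \<epsilon> y * norm (w y)"
      using B(2)[of "w y"] le norm_triangle_ineq4[of v "(L y - L z) (w y)"] by simp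
    moreover have "\<epsilon> y * norm (w y) \<le> B / 2 * norm (w y)"
      using y(2) by (intro mult_right_mono) auto
    ultimately have wy: "norm (w y) \<le> 2 * norm v / B"
      using B(1) by (simp add: pos_le_divide_eq mult.commute)
    have "L z (w y - w z) = - (L y - L z) (w y)"
      using Lw[OF y(1)] Lw[OF z] by (simp add: minus_blinfun.rep_eq blinfun.diff_right)
    then have "B * norm (w y - w z) \<le> \<epsilon> y * norm (w y)"
      using B(2)[of "w y - w z"] le by simp
    also have "\<dots> \<le> \<epsilon> y * (2 * norm v / B)"
      using wy by (intro mult_left_mono) (auto simp: \<epsilon>_def)
    finally show ?thesis
      using B(1) by (simp add: pos_le_divide_eq mult.commute)
  qed
  have "((\<lambda>y. w y - w z) \<longlongrightarrow> 0) (at z within V)"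
  proof (rule Lim_null_comparison)
    show "\<forall>\<^sub>F y in at z within V. norm (w y - w z) \<le> \<epsilon> y * (2 * norm v / B / B)"
      using \<epsilon>(2) unfolding eventually_at_filter by (rule eventually_mono) (use bound in blast)
    show "((\<lambda>y. \<epsilon> y * (2 * norm v / B / B)) \<longlongrightarrow> 0) (at z within V)"
      using \<epsilon>(1) by (rule tendsto_mult_left_zero)
  qed
  then show "(w \<longlongrightarrow> w z) (at z within V)"
    by (rule LIM_zero_cancel)
qed

text \<open>At such an interior point the base component of \<open>\<pi> (f x)\<close> is a local
  diffeomorphism for a C^1 surface, so the projected surface is locally a graph over
  \<open>real ^ 'n\<close>.\<close>

definition nondegenerate :: "('a \<Rightarrow> (real ^ 'n::finite) \<times> real) \<Rightarrow> (real ^ 'n \<Rightarrow> 'a::real_normed_vector) \<Rightarrow> real ^ 'n \<Rightarrow> bool" where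
  "nondegenerate \<pi> f x \<longleftrightarrow> (\<exists>B>0. \<forall>v. B * norm v \<le> norm (fst (\<pi> (total_deriv f x v))))"

text \<open>The inverse function theorem writes the projected surface near a nondegenerate point as
  the graph of \<open>u = b \<circ> g\<close>. There the exceptional set lies in the image under
  \<open>g\<close> of the null set of the graph case, and negligibility is a local property.\<close>

lemma (in hole_scheme) surface_hits_finitely_many_holes:
  fixes f :: "real ^ 'n \<Rightarrow> 'a::real_normed_vector"
  assumes \<pi>: "bounded_linear \<pi>" and f: "C1_on_cube f"
  shows "negligible {x \<in> box 0 1. nondegenerate \<pi> f x \<and> (\<exists>\<^sub>\<infinity>k. \<pi> (f x) \<in> H k)}" (is "negligible ?Z")
proof -
  obtain f' where f': "\<And>x. x \<in> cube \<Longrightarrow> (f has_derivative blinfun_apply (f' x)) (at x within cube)"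
    "continuous_on cube f'" "\<And>x. x \<in> cube \<Longrightarrow> total_deriv f x = blinfun_apply (f' x)"
    using C1_on_cubeE[OF f] by blast
  have sub: "box 0 1 \<subseteq> (cube :: (real ^ 'n) set)"
    by (simp add: cube_eq_cbox box_subset_cbox)
  have f'at: "(f has_derivative blinfun_apply (f' x)) (at x)" if "x \<in> box 0 1" for x
    using f'(1)[of x] has_derivative_subset[OF _ sub] that sub
    by (metis at_within_open open_box subsetD)
  have fst\<pi>: "bounded_linear (\<lambda>v. fst (\<pi> v))" and snd\<pi>: "bounded_linear (\<lambda>v. snd (\<pi> v))"
    using \<pi> bounded_linear_fst_comp bounded_linear_snd_comp by blast+
  define a where "a x = fst (\<pi> (f x))" for x
  define b where "b x = snd (\<pi> (f x))" for x
  define a' where "a' x = Blinfun (\<lambda>v. fst (\<pi> v)) o\<^sub>L f' x" for x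
  define b' where "b' x = Blinfun (\<lambda>v. snd (\<pi> v)) o\<^sub>L f' x" for x
  have a': "blinfun_apply (a' x) = (\<lambda>v. fst (\<pi> (f' x v)))" and b': "blinfun_apply (b' x) = (\<lambda>v. snd (\<pi> (f' x v)))" for x
    by (auto simp: a'_def b'_def bounded_linear_Blinfun_apply[OF fst\<pi>] bounded_linear_Blinfun_apply[OF snd\<pi>])
  have da: "(a has_derivative blinfun_apply (a' x)) (at x)" and db: "(b has_derivative blinfun_apply (b' x)) (at x)"
    if "x \<in> box 0 1" for x
    unfolding a_def[abs_def] b_def[abs_def] a' b'
    using bounded_linear.has_derivative[OF fst\<pi> f'at[OF that]] bounded_linear.has_derivative[OF snd\<pi> f'at[OF that]] by auto
  have ca: "continuous_on (box 0 1) a'" and cb: "continuous_on (box 0 1) b'"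
    unfolding a'_def b'_def using continuous_on_subset[OF f'(2) sub]
    by (intro continuous_intros; simp)+
  have "\<exists>U. openin (top_of_set ?Z) U \<and> x0 \<in> U \<and> negligible U" if x0: "x0 \<in> ?Z" for x0
  proof -
    have x0b: "x0 \<in> box 0 1" using x0 by simp
    obtain B where "0 < B" "\<And>v. B * norm v \<le> norm (a' x0 v)"
      using x0 f'(3)[of x0] sub unfolding nondegenerate_def a' by auto
    then obtain invf where "invf o\<^sub>L a' x0 = id_blinfun"
      using linear_bounded_below_left_inverse by blast
    then obtain U' V g g' where U': "open U'" "U' \<subseteq> box 0 1" "x0 \<in> U'" and V: "open V" "a x0 \<in> V"
      and hom: "homeomorphism U' V a g"
      and g: "\<And>y. y \<in> V \<Longrightarrow> (g has_derivative g' y) (at y)"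
        "\<And>y. y \<in> V \<Longrightarrow> g' y = inv (blinfun_apply (a' (g y)))"
        "\<And>y. y \<in> V \<Longrightarrow> bij (blinfun_apply (a' (g y)))"
      using inverse_function_theorem[OF open_box da ca x0b] by metis
    have gV: "g y \<in> U'" if "y \<in> V" for y
      using hom that by (auto simp: homeomorphism_def)
    have ga: "g (a x) = x" "a x \<in> V" if "x \<in> U'" for x
      using hom that by (auto simp: homeomorphism_def)
    have gc: "continuous_on V g"
      using hom by (simp add: homeomorphism_def)
    define u where "u y = b (g y)" for y
    define u' where "u' y v = b' (g y) (g' y v)" for y v
    have du: "(u has_derivative u' y) (at y)" if "y \<in> V" for y
      unfolding u_def[abs_def] u'_def[abs_def]
      using has_derivative_compose[OF g(1)[OF that] db] gV[OF that] U'(2) by blast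
    have cu: "continuous_on V (\<lambda>y. u' y v)" for v
    proof -
      have "continuous_on V (\<lambda>y. a' (g y))" "continuous_on V (\<lambda>y. b' (g y))"
        using gV U'(2) by (auto intro!: continuous_on_compose2[OF ca gc] continuous_on_compose2[OF cb gc])
      moreover from this have "continuous_on V (\<lambda>y. inv (blinfun_apply (a' (g y))) v)"
        using g(3) by (intro continuous_on_inverse_family)
      ultimately have "continuous_on V (\<lambda>y. blinfun_apply (b' (g y)) (inv (blinfun_apply (a' (g y))) v))"
        by (intro continuous_intros)
      then show ?thesis
        by (rule continuous_on_eq) (simp add: u'_def g(2))
    qed
    obtain r where r: "0 < r" "ball (a x0) r \<subseteq> V" "negligible {y \<in> ball (a x0) r. \<exists>\<^sub>\<infinity>k. (y, u y) \<in> H k}"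
      using graph_hits_finitely_many_holes[OF V du cu] by blast
    define W where "W = {y \<in> ball (a x0) r. \<exists>\<^sub>\<infinity>k. (y, u y) \<in> H k}"
    have "g differentiable_on W"
      using r(2) g(1) unfolding differentiable_on_def differentiable_def W_def
      by (blast intro: has_derivative_at_withinI)
    then have gW: "negligible (g ` W)"
      using r(3) unfolding W_def[symmetric] by (intro negligible_differentiable_image_negligible) auto
    define U where "U = U' \<inter> a -` ball (a x0) r"
    have "continuous_on U' a"
      using hom by (simp add: homeomorphism_def)
    then have "open U"
      unfolding U_def using U'(1) by (simp add: continuous_on_open_vimage Int_commute)
    moreover have "x0 \<in> U" using r(1) U'(3) by (simp add: U_def)
    moreover have "?Z \<inter> U \<subseteq> g ` W"
    proof
      fix x assume x: "x \<in> ?Z \<inter> U"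
      then have "x = g (a x)" "\<pi> (f x) = (a x, u (a x))"
        using ga by (auto simp: U_def u_def a_def b_def)
      then have "a x \<in> W"
        using x by (auto simp: W_def U_def)
      then show "x \<in> g ` W"
        using \<open>x = g (a x)\<close> by blast
    qed
    then have "negligible (?Z \<inter> U)"
      using gW negligible_subset by blast
    ultimately show ?thesis
      using x0 by (intro exI[of _ "?Z \<inter> U"]) (auto simp: openin_open)
  qed
  then show ?thesis
    by (subst locally_negligible_alt) blast
qed

section \<open>Hausdorff measure of Lipschitz images of null sets\<close>

lemma C1_on_cube_lipschitz:
  fixes f :: "real ^ 'n::finite \<Rightarrow> 'a::real_normed_vector"
  assumes "C1_on_cube f"
  obtains B where "0 < B" "\<And>x y. x \<in> cube \<Longrightarrow> y \<in> cube \<Longrightarrow> dist (f x) (f y) \<le> B * dist x y"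
proof -
  obtain f' where f': "\<And>x. x \<in> cube \<Longrightarrow> (f has_derivative blinfun_apply (f' x)) (at x within cube)"
    "continuous_on cube f'"
    using assms unfolding C1_on_cube_def by blast
  have "compact (f' ` cube)"
    by (intro compact_continuous_image f'(2)) (simp add: cube_eq_cbox)
  then obtain B where B: "0 < B" "\<And>x. x \<in> cube \<Longrightarrow> norm (f' x) \<le> B"
    using compact_imp_bounded bounded_pos by (metis image_eqI)
  have "convex (cube :: (real ^ 'n) set)" by (simp add: cube_eq_cbox)
  then have "norm (f x - f y) \<le> B * norm (x - y)" if "x \<in> cube" "y \<in> cube" for x y
    by (rule differentiable_bound[OF _ f'(1)]) (use B that in \<open>auto simp: norm_blinfun.rep_eq[symmetric]\<close>)
  then show ?thesis
    using that[OF B(1)] by (simp add: dist_norm)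
qed

lemma ediameter_le:
  assumes "\<And>x y. x \<in> S \<Longrightarrow> y \<in> S \<Longrightarrow> dist x y \<le> d"
  shows "ediameter S \<le> ennreal d"
  unfolding ediameter_def by (intro SUP_least ennreal_leI assms)

lemma ediameter_empty: "ediameter {} = 0"
  by (simp add: ediameter_def bot_ennreal)

text \<open>\<open>Z\<close> is covered by small cubes with disjoint interiors and small total
  volume. The image of a cube of side \<open>l\<close> has diameter at most \<open>B n l\<close>, so
  it contributes at most \<open>M\<close> times the volume of the cube.\<close>

lemma hausdorff_measure_lipschitz_image_null:
  fixes f :: "real ^ 'n::finite \<Rightarrow> 'a::metric_space"
  assumes Z: "negligible Z" "Z \<subseteq> cube" and A: "A \<subseteq> f ` Z"
    and B: "0 < B" "\<And>x y. x \<in> cube \<Longrightarrow> y \<in> cube \<Longrightarrow> dist (f x) (f y) \<le> B * dist x y"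
  shows "hausdorff_measure CARD('n) A = 0"
proof -
  define n where "n = CARD('n)"
  define M where "M = unit_ball_vol (real n) / 2 ^ n * (B * real n) ^ n"
  have M: "0 \<le> M" using B(1) by (simp add: M_def)
  have content: "hausdorff_content n \<delta> A \<le> ennreal \<epsilon>" if \<delta>: "0 < \<delta>" and \<epsilon>: "0 < \<epsilon>" for \<delta> \<epsilon>
  proof -
    have e: "0 < \<epsilon> / (M + 1)" using M \<epsilon> by simp
    have "Z \<in> sets lebesgue" using Z(1) by (rule negligible_imp_sets)
    from sets_lebesgue_outer_open[OF this e]
    obtain U where U: "open U" "Z \<subseteq> U" "U - Z \<in> lmeasurable" "emeasure lebesgue (U - Z) < ennreal (\<epsilon> / (M + 1))"
      by metis
    have "measure lebesgue (U - Z) < \<epsilon> / (M + 1)"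
      using U(3,4) e by (simp add: emeasure_eq_measure2 ennreal_less_iff)
    moreover have symm: "negligible ((U - Z) - U \<union> (U - (U - Z)))"
      by (rule negligible_subset[OF Z(1)]) auto
    ultimately have Um: "U \<in> lmeasurable" "measure lebesgue U < \<epsilon> / (M + 1)"
      using lmeasurable_negligible_symdiff[OF U(3) symm] measure_negligible_symdiff[OF U(3) symm] by auto
    have s: "0 < \<delta> / B" using \<delta> B(1) by simp
    have "Z \<subseteq> cbox 0 1" using Z(2) by (simp add: cube_eq_cbox)
    moreover have "box 0 (1 :: real ^ 'n) \<noteq> {}" by (simp add: interval_ne_empty_cart)
    ultimately obtain \<D> where \<D>: "countable \<D>" "\<Union>\<D> \<subseteq> cbox 0 1" "\<Union>\<D> \<subseteq> U" "Z \<subseteq> \<Union>\<D>"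
      "pairwise (\<lambda>A B. interior A \<inter> interior B = {}) \<D>"
      "\<And>D. D \<in> \<D> \<Longrightarrow> \<exists>u v k. D = cbox u v \<and>
        (\<forall>i. u $ i < v $ i \<and> v $ i - u $ i = ((1 :: real ^ 'n) $ i - 0 $ i) / 2 ^ k)"
      "\<And>D x y. D \<in> \<D> \<Longrightarrow> x \<in> D \<Longrightarrow> y \<in> D \<Longrightarrow> dist x y < \<delta> / B"
      using cover_by_small_cubes[OF _ U(2) _ U(1) s, of 0 1] by metis
    have D: "D \<subseteq> cube" "D \<subseteq> U" "interior D \<in> lmeasurable"
      "ediameter (f ` D) \<le> ennreal \<delta>"
      "ennreal (unit_ball_vol (real n) / 2 ^ n) * ediameter (f ` D) ^ n \<le> ennreal (M * measure lebesgue (interior D))"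
      if D: "D \<in> \<D>" for D
    proof -
      show sub: "D \<subseteq> cube" using \<D>(2) D by (auto simp: cube_eq_cbox)
      show "D \<subseteq> U" using \<D>(3) D by blast
      obtain u v m where uv: "D = cbox u v" "\<And>i. u $ i < v $ i"
        and m: "\<And>i. v $ i - u $ i = ((1 :: real ^ 'n) $ i - 0 $ i) / 2 ^ m"
        using \<D>(6)[OF D] by blast
      then have int: "interior D = box u v" by (simp add: interior_cbox)
      then show "interior D \<in> lmeasurable" by simp
      define l :: real where "l = 1 / 2 ^ m"
      have l: "0 < l" by (simp add: l_def)
      have side: "v $ i - u $ i = l" for i
        using m[of i] by (simp add: l_def)
      have "u $ i \<le> v $ i" for i using uv(2)[of i] by simp
      then have meas: "measure lebesgue (interior D) = l ^ n"
        unfolding int by (subst measure_box_cart(1)) (simp_all add: side n_def)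
      show "ediameter (f ` D) \<le> ennreal \<delta>"
      proof (rule ediameter_le)
        fix a b assume "a \<in> f ` D" "b \<in> f ` D"
        then obtain y z where yz: "y \<in> D" "z \<in> D" "a = f y" "b = f z" by blast
        have "B * dist y z \<le> \<delta>"
          using \<D>(7)[OF D yz(1,2)] B(1) by (simp add: pos_less_divide_eq mult.commute)
        moreover have "y \<in> cube" "z \<in> cube" using yz(1,2) sub by blast+
        ultimately show "dist a b \<le> \<delta>"
          using B(2)[of y z] yz(3,4) by simp
      qed
      have "ediameter (f ` D) \<le> ennreal (B * real n * l)"
      proof (rule ediameter_le)
        fix a b assume "a \<in> f ` D" "b \<in> f ` D"
        then obtain y z where yz: "y \<in> D" "z \<in> D" "a = f y" "b = f z" by blast
        have "dist y z \<le> (\<Sum>i\<in>UNIV. \<bar>(y - z) $ i\<bar>)"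
          unfolding dist_norm by (rule norm_le_l1_cart)
        also have "\<dots> \<le> (\<Sum>i\<in>(UNIV :: 'n set). l)"
        proof (rule sum_mono)
          fix i
          have "u $ i \<le> y $ i" "y $ i \<le> v $ i" "u $ i \<le> z $ i" "z $ i \<le> v $ i"
            using yz(1,2) by (auto simp: uv(1) mem_box_cart)
          then show "\<bar>(y - z) $ i\<bar> \<le> l" using side[of i] by simp
        qed
        also have "\<dots> = real n * l" by (simp add: n_def)
        finally have "B * dist y z \<le> B * (real n * l)"
          using B(1) by (intro mult_left_mono) auto
        moreover have "y \<in> cube" "z \<in> cube" using yz(1,2) sub by blast+
        ultimately show "dist a b \<le> B * real n * l"
          using B(2)[of y z] yz(3,4) by (simp add: mult.assoc)
      qed
      then have "ennreal (unit_ball_vol (real n) / 2 ^ n) * ediameter (f ` D) ^ n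
          \<le> ennreal (unit_ball_vol (real n) / 2 ^ n) * ennreal (B * real n * l) ^ n"
        by (intro mult_left_mono power_mono) auto
      also have "\<dots> = ennreal (unit_ball_vol (real n) / 2 ^ n * (B * real n * l) ^ n)"
      proof -
        have "0 \<le> B * real n * l" using B(1) l by simp
        then show ?thesis
          by (simp only: ennreal_power) (simp only: ennreal_mult[symmetric] unit_ball_vol_nonneg
              divide_nonneg_nonneg zero_le_power zero_le_numeral)
      qed
      also have "unit_ball_vol (real n) / 2 ^ n * (B * real n * l) ^ n = M * measure lebesgue (interior D)"
        by (simp add: M_def meas power_mult_distrib)
      finally show "ennreal (unit_ball_vol (real n) / 2 ^ n) * ediameter (f ` D) ^ n \<le> ennreal (M * measure lebesgue (interior D))" .
    qed
    \<comment> \<open>Indices that enumerate no cube get the empty set, which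
      \<open>hausdorff_content\<close> counts as zero; finite and infinite families are thus treated
      alike.\<close>
    define V where "V k = (if k \<in> to_nat_on \<D> ` \<D> then f ` from_nat_into \<D> k else {})" for k
    define w where "w k = (if k \<in> to_nat_on \<D> ` \<D> then M * measure lebesgue (interior (from_nat_into \<D> k)) else 0)" for k
    have VD: "V (to_nat_on \<D> K) = f ` K" "w (to_nat_on \<D> K) = M * measure lebesgue (interior K)" if "K \<in> \<D>" for K
      using that \<D>(1) by (simp_all add: V_def w_def)
    have V_cases: "(\<exists>K\<in>\<D>. k = to_nat_on \<D> K) \<or> V k = {} \<and> w k = 0" for k
      by (auto simp: V_def w_def)
    have w0: "0 \<le> w k" for k using M by (simp add: w_def)
    have cover: "A \<subseteq> (\<Union>k. V k)"
    proof
      fix a assume "a \<in> A"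
      then obtain z where "z \<in> Z" "a = f z" using A by blast
      then obtain K where "K \<in> \<D>" "z \<in> K" using \<D>(4) by blast
      then have "a \<in> V (to_nat_on \<D> K)" using VD(1) \<open>a = f z\<close> by blast
      then show "a \<in> (\<Union>k. V k)" by blast
    qed
    have diam: "ediameter (V k) \<le> ennreal \<delta>" for k
      using V_cases[of k] D(4) VD(1) by (auto simp: ediameter_empty)
    have summand_le: "(if V k = {} then 0 else ennreal (unit_ball_vol (real n) / 2 ^ n) * ediameter (V k) ^ n) \<le> ennreal (w k)" for k
      using V_cases[of k] D(5) VD by auto
    have partial: "(\<Sum>k<N. w k) \<le> \<epsilon>" for N
    proof -
      define E where "E = {K \<in> \<D>. to_nat_on \<D> K < N}"
      have inj: "inj_on (to_nat_on \<D>) E"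
        using inj_on_to_nat_on[OF \<D>(1)] by (rule inj_on_subset) (auto simp: E_def)
      have "to_nat_on \<D> ` E \<subseteq> {..<N}" by (auto simp: E_def)
      then have finE: "finite E" using inj finite_imageD finite_subset by blast
      have "(\<Sum>k<N. w k) = (\<Sum>k\<in>to_nat_on \<D> ` E. w k)"
      proof (intro sum.mono_neutral_right ballI)
        fix k assume k: "k \<in> {..<N} - to_nat_on \<D> ` E"
        then have "\<not> (\<exists>K\<in>\<D>. k = to_nat_on \<D> K)" by (auto simp: E_def)
        then show "w k = 0" using V_cases[of k] by blast
      qed (auto simp: E_def)
      also have "\<dots> = (\<Sum>K\<in>E. M * measure lebesgue (interior K))"
        using VD(2) by (subst sum.reindex[OF inj]) (auto simp: E_def)
      also have "\<dots> = M * measure lebesgue (\<Union>K\<in>E. interior K)"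
      proof -
        have "(\<Sum>K\<in>E. measure lebesgue (interior K)) = measure lebesgue (\<Union>K\<in>E. interior K)"
        proof (rule measure_UNION'[symmetric, OF finE])
          show "pairwise (\<lambda>i j. disjnt (interior i) (interior j)) E"
            unfolding disjnt_def by (rule pairwise_subset[OF \<D>(5)]) (auto simp: E_def)
        qed (use D(3) in \<open>auto simp: E_def\<close>)
        then show ?thesis by (simp add: sum_distrib_left[symmetric])
      qed
      also have "\<dots> \<le> M * measure lebesgue U"
      proof (intro mult_left_mono M measure_mono_fmeasurable[OF _ _ Um(1)])
        show "(\<Union>K\<in>E. interior K) \<subseteq> U"
          using D(2) interior_subset by (fastforce simp: E_def)
        show "(\<Union>K\<in>E. interior K) \<in> sets lebesgue"
          using finE D(3) by (intro sets.finite_UN) (auto simp: E_def intro: fmeasurableD)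
      qed
      also have "\<dots> \<le> M * (\<epsilon> / (M + 1))" using Um(2) M by (intro mult_left_mono) auto
      also have "\<dots> \<le> \<epsilon>" using M \<epsilon> by (simp add: field_simps)
      finally show ?thesis .
    qed
    have "hausdorff_content n \<delta> A \<le> (\<Sum>k. if V k = {} then 0 else ennreal (unit_ball_vol (real n) / 2 ^ n) * ediameter (V k) ^ n)"
      unfolding hausdorff_content_def by (rule INF_lower) (use cover diam in auto)
    also have "\<dots> \<le> (\<Sum>k. ennreal (w k))"
      by (intro suminf_le summand_le) auto
    also have "\<dots> \<le> ennreal \<epsilon>"
      by (rule suminf_le_const) (auto simp: sum_ennreal w0 intro!: ennreal_leI partial)
    finally show ?thesis .
  qed
  have "hausdorff_content n \<delta> A = 0" if "0 < \<delta>" for \<delta>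
  proof -
    have "hausdorff_content n \<delta> A \<le> 0"
      by (rule ennreal_le_epsilon) (use content[OF that] in simp)
    then show ?thesis by simp
  qed
  then show ?thesis
    unfolding hausdorff_measure_def n_def[symmetric] by (auto intro!: antisym SUP_least)
qed

section \<open>Perturbing surfaces to be affine\<close>

text \<open>The determinant of \<open>A + t\<close> is a polynomial in \<open>t\<close>. It is not
  the zero polynomial, because a \<open>t\<close> above the operator norm gives an injective map; so
  arbitrarily small positive \<open>t\<close> avoid its finitely many roots.\<close>

lemma exists_injective_shift:
  fixes A :: "real ^ 'n::finite \<Rightarrow> real ^ 'n"
  assumes A: "linear A" and \<delta>: "0 < \<delta>"
  obtains t where "0 < t" "t < \<delta>" "inj (\<lambda>v. A v + t *\<^sub>R v)"
proof -
  define M where "M = matrix A"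
  define P where "P = det (\<chi> i j. [: M $ i $ j, if i = j then 1 else 0 :] :: real poly ^ 'n ^ 'n)"
  have P: "poly P t = det (M + t *\<^sub>R mat 1)" for t
  proof -
    have entry: "poly [: M $ i $ j, if i = j then 1 else 0 :] t = (M + t *\<^sub>R mat 1) $ i $ j" for i j
      by (simp add: mat_def)
    show ?thesis
      unfolding P_def det_def poly_sum poly_mult poly_prod vec_lambda_beta entry by simp
  qed
  have inj: "inj (\<lambda>v. A v + t *\<^sub>R v) \<longleftrightarrow> poly P t \<noteq> 0" for t
  proof -
    have "(\<lambda>v. A v + t *\<^sub>R v) = (*v) (M + t *\<^sub>R mat 1)"
      using matrix_works[of A] A
      by (auto simp: M_def fun_eq_iff matrix_vector_mult_add_rdistrib scaleR_matrix_vector_assoc[symmetric]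
          linear_matrix_vector_mul_eq)
    then show ?thesis
      by (simp add: P invertible_det_nz[symmetric] matrix_left_invertible_injective[symmetric] invertible_left_inverse)
  qed
  obtain K where K: "\<And>v. norm (A v) \<le> norm v * K"
    using bounded_linear.bounded A linear_conv_bounded_linear by blast
  have "inj (\<lambda>v. A v + (\<bar>K\<bar> + 1) *\<^sub>R v)"
  proof (rule injI)
    fix x y assume "A x + (\<bar>K\<bar> + 1) *\<^sub>R x = A y + (\<bar>K\<bar> + 1) *\<^sub>R y"
    then have "(\<bar>K\<bar> + 1) *\<^sub>R (x - y) = - A (x - y)"
      by (simp add: linear_diff[OF A] algebra_simps)
    then have "norm ((\<bar>K\<bar> + 1) *\<^sub>R (x - y)) = norm (A (x - y))" by simp
    then have "(\<bar>K\<bar> + 1) * norm (x - y) \<le> norm (x - y) * K"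
      using K[of "x - y"] by simp
    moreover have "norm (x - y) * K \<le> norm (x - y) * \<bar>K\<bar>"
      by (intro mult_left_mono) auto
    moreover have "(\<bar>K\<bar> + 1) * norm (x - y) = norm (x - y) * \<bar>K\<bar> + norm (x - y)"
      by (simp add: distrib_right mult.commute)
    ultimately have "norm (x - y) \<le> 0" by linarith
    then show "x = y" by simp
  qed
  then have "P \<noteq> 0" using inj by auto
  then have "finite {t. poly P t = 0}" by (rule poly_roots_finite)
  moreover have "infinite {0<..<\<delta>}" using \<delta> by simp
  ultimately obtain t where "t \<in> {0<..<\<delta>}" "t \<notin> {t. poly P t = 0}"
    by (meson finite_subset subsetI)
  then show ?thesis
    using that inj by auto
qed

text \<open>Finds the slope of a hyperplane: the linear surface
  \<open>v \<mapsto> (A v, b v)\<close> lies in \<open>z = w \<bullet> y\<close>.\<close>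

lemma solve_adjoint:
  fixes A :: "real ^ 'n::finite \<Rightarrow> real ^ 'n" and b :: "real ^ 'n \<Rightarrow> real"
  assumes "linear A" "inj A" "linear b"
  obtains w where "\<And>v. w \<bullet> A v = b v"
proof -
  obtain h where h: "linear h" "h \<circ> A = id"
    using linear_injective_left_inverse[OF assms(1,2)] by blast
  define w where "w = adjoint (\<lambda>x. b (h x)) 1"
  have lin: "linear (\<lambda>x. b (h x))"
    using linear_compose[OF h(1) assms(3)] by (simp add: o_def)
  have "w \<bullet> A v = b v" for v
    using adjoint_clauses(2)[OF lin, of 1 "A v"] h(2) by (simp add: w_def pointfree_idE)
  then show ?thesis by (rule that)
qed

text \<open>On a finite-dimensional domain, continuity of \<open>x \<mapsto> f' x v\<close> for each
  \<open>v\<close> already gives continuity in the operator norm.\<close>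

lemma C1_on_cubeI:
  fixes f :: "real ^ 'n::finite \<Rightarrow> 'a::real_normed_vector"
  assumes "\<And>x. x \<in> cube \<Longrightarrow> (f has_derivative f' x) (at x within cube)"
    "\<And>v. continuous_on cube (\<lambda>x. f' x v)"
  shows "C1_on_cube f"
  unfolding C1_on_cube_def
proof (intro exI conjI ballI)
  have bl: "bounded_linear (f' x)" if "x \<in> cube" for x
    using assms(1)[OF that] by (rule has_derivative_bounded_linear)
  then show "(f has_derivative blinfun_apply (Blinfun (f' x))) (at x within cube)" if "x \<in> cube" for x
    using assms(1) that by (simp add: bounded_linear_Blinfun_apply)
  show "continuous_on cube (\<lambda>x. Blinfun (f' x))"
  proof (rule continuous_on_blinfun_componentwise)
    fix i
    show "continuous_on cube (\<lambda>x. blinfun_apply (Blinfun (f' x)) i)"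
      using assms(2)[of i] by (rule continuous_on_eq) (simp add: bounded_linear_Blinfun_apply bl)
  qed
qed

section \<open>Cutoffs on balls\<close>

definition cutoff :: "real \<Rightarrow> real \<Rightarrow> real" where
  "cutoff s0 s = pos_sq (1 - pos_sq ((s - s0) / (1 - s0)))"

definition cutoff' :: "real \<Rightarrow> real \<Rightarrow> real" where
  "cutoff' s0 s = - 4 * max 0 (1 - pos_sq ((s - s0) / (1 - s0))) * max 0 ((s - s0) / (1 - s0)) / (1 - s0)"

lemma cutoff:
  assumes s0: "s0 < 1"
  shows "(f has_derivative f') (at x within S) \<Longrightarrow>
      ((\<lambda>x. cutoff s0 (f x)) has_derivative (\<lambda>v. cutoff' s0 (f x) * f' v)) (at x within S)"
    and "s \<le> s0 \<Longrightarrow> cutoff s0 s = 1" "s \<le> s0 \<Longrightarrow> cutoff' s0 s = 0"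
    and "1 \<le> s \<Longrightarrow> cutoff s0 s = 0" "1 \<le> s \<Longrightarrow> cutoff' s0 s = 0"
    and "0 \<le> cutoff s0 s" "cutoff s0 s \<le> 1"
    and "\<bar>cutoff' s0 s\<bar> \<le> 4 / (1 - s0)"
proof -
  define w where "w = (s - s0) / (1 - s0)"
  show "((\<lambda>x. cutoff s0 (f x)) has_derivative (\<lambda>v. cutoff' s0 (f x) * f' v)) (at x within S)"
    if f: "(f has_derivative f') (at x within S)"
  proof -
    have w: "((\<lambda>x. (f x - s0) / (1 - s0)) has_derivative (\<lambda>v. f' v / (1 - s0))) (at x within S)"
      using bounded_linear.has_derivative[OF bounded_linear_divide has_derivative_diff[OF f has_derivative_const]]
      by simp
    show ?thesis
      unfolding cutoff_def cutoff'_def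
      by (rule has_derivative_eq_rhs[OF has_derivative_pos_sq[OF
              has_derivative_diff[OF has_derivative_const has_derivative_pos_sq[OF w]]]])
        (simp add: fun_eq_iff)
  qed
  have w: "s \<le> s0 \<Longrightarrow> w \<le> 0" "1 \<le> s \<Longrightarrow> 1 \<le> w"
    using s0 by (auto simp: w_def divide_le_eq le_divide_eq)
  have sq: "1 \<le> pos_sq w" if "1 \<le> w"
    using that power_mono[of 1 w 2] by (simp add: pos_sq_def)
  show "s \<le> s0 \<Longrightarrow> cutoff s0 s = 1" "s \<le> s0 \<Longrightarrow> cutoff' s0 s = 0"
    using w(1) by (auto simp: cutoff_def cutoff'_def w_def[symmetric] pos_sq_def)
  show "1 \<le> s \<Longrightarrow> cutoff s0 s = 0" "1 \<le> s \<Longrightarrow> cutoff' s0 s = 0"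
    using w(2) sq by (auto simp: cutoff_def cutoff'_def w_def[symmetric] pos_sq_def[of "1 - _"])
  show "0 \<le> cutoff s0 s" by (simp add: cutoff_def pos_sq_nonneg)
  have "(max 0 (1 - pos_sq w))\<^sup>2 \<le> 1\<^sup>2"
    using pos_sq_nonneg[of w] by (intro power_mono) auto
  then show "cutoff s0 s \<le> 1" by (simp add: cutoff_def w_def pos_sq_def[of "1 - _"])
  have "max 0 (1 - pos_sq w) * max 0 w \<le> 1"
  proof (cases "1 \<le> w")
    case True
    then show ?thesis using sq by simp
  next
    case False
    then show ?thesis using pos_sq_nonneg[of w] by (intro mult_le_one) auto
  qed
  then have "\<bar>4 * (max 0 (1 - pos_sq w) * max 0 w)\<bar> \<le> 4" by (simp add: abs_mult)
  then have "\<bar>4 * (max 0 (1 - pos_sq w) * max 0 w)\<bar> / (1 - s0) \<le> 4 / (1 - s0)"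
    using s0 by (intro divide_right_mono) auto
  then show "\<bar>cutoff' s0 s\<bar> \<le> 4 / (1 - s0)"
    using s0 by (simp add: cutoff'_def w_def[symmetric] mult.assoc)
qed

definition ball_cutoff :: "real \<Rightarrow> 'a::real_inner \<Rightarrow> real \<Rightarrow> 'a \<Rightarrow> real" where
  "ball_cutoff s0 c r x = cutoff s0 ((x - c) \<bullet> (x - c) / r\<^sup>2)"

definition ball_cutoff' :: "real \<Rightarrow> 'a::real_inner \<Rightarrow> real \<Rightarrow> 'a \<Rightarrow> 'a \<Rightarrow> real" where
  "ball_cutoff' s0 c r x v = cutoff' s0 ((x - c) \<bullet> (x - c) / r\<^sup>2) * (2 * ((x - c) \<bullet> v) / r\<^sup>2)"

text \<open>Using the squared distance keeps the cutoff differentiable at the centre. Its transition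
  takes the fraction \<open>\<kappa>\<close> of the radius, so its derivative is of order
  \<open>1 / r\<close>; this is harmless since the functions to be cut off will be of order
  \<open>r\<close>.\<close>

lemma ball_cutoff:
  assumes \<kappa>: "0 < \<kappa>" "\<kappa> \<le> 1" and r: "0 < r" and s0: "s0 = (1 - \<kappa>)\<^sup>2"
  shows "(ball_cutoff s0 c r has_derivative ball_cutoff' s0 c r x) (at x within S)"
    and "continuous_on UNIV (\<lambda>x. ball_cutoff' s0 c r x v)"
    and "x \<in> cball c ((1 - \<kappa>) * r) \<Longrightarrow> ball_cutoff s0 c r x = 1 \<and> ball_cutoff' s0 c r x v = 0"
    and "x \<notin> ball c r \<Longrightarrow> ball_cutoff s0 c r x = 0 \<and> ball_cutoff' s0 c r x v = 0"
    and "0 \<le> ball_cutoff s0 c r x" "ball_cutoff s0 c r x \<le> 1"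
    and "\<bar>ball_cutoff' s0 c r x v\<bar> \<le> 8 / (1 - s0) / r * norm v"
proof -
  have s1: "s0 < 1"
    unfolding s0 using power_strict_mono[of "1 - \<kappa>" 1 2] \<kappa> by simp
  define t where "t = (x - c) \<bullet> (x - c) / r\<^sup>2"
  have t: "t = (norm (x - c) / r)\<^sup>2" by (simp add: t_def power2_norm_eq_inner power_divide)
  have "((\<lambda>x. (x - c) \<bullet> (x - c) / r\<^sup>2) has_derivative (\<lambda>v. 2 * ((x - c) \<bullet> v) / r\<^sup>2)) (at x within S)"
  proof -
    have "((\<lambda>x. (x - c) \<bullet> (x - c)) has_derivative (\<lambda>v. 2 * ((x - c) \<bullet> v))) (at x within S)"
      by (auto intro!: derivative_eq_intros simp: inner_commute)
    from bounded_linear.has_derivative[OF bounded_linear_divide this] show ?thesis .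
  qed
  from cutoff(1)[OF s1 this] show "(ball_cutoff s0 c r has_derivative ball_cutoff' s0 c r x) (at x within S)"
    unfolding ball_cutoff_def[abs_def] ball_cutoff'_def[abs_def] .
  show "continuous_on UNIV (\<lambda>x. ball_cutoff' s0 c r x v)"
    unfolding ball_cutoff'_def cutoff'_def using s1 r by (intro continuous_intros) auto
  show "ball_cutoff s0 c r x = 1 \<and> ball_cutoff' s0 c r x v = 0" if "x \<in> cball c ((1 - \<kappa>) * r)"
  proof -
    have "norm (x - c) / r \<le> 1 - \<kappa>"
      using that r by (simp add: dist_norm norm_minus_commute divide_le_eq)
    then have "t \<le> s0" unfolding t s0 using r by (intro power_mono) auto
    then show ?thesis
      using cutoff(2,3)[OF s1] by (simp add: ball_cutoff_def ball_cutoff'_def t_def)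
  qed
  show "ball_cutoff s0 c r x = 0 \<and> ball_cutoff' s0 c r x v = 0" if "x \<notin> ball c r"
  proof -
    have "1 \<le> norm (x - c) / r"
      using that r by (simp add: dist_norm norm_minus_commute le_divide_eq)
    then have "1 \<le> t" unfolding t using power_mono[of 1 "norm (x - c) / r" 2] by simp
    then show ?thesis
      using cutoff(4,5)[OF s1] by (simp add: ball_cutoff_def ball_cutoff'_def t_def)
  qed
  show "0 \<le> ball_cutoff s0 c r x" "ball_cutoff s0 c r x \<le> 1"
    using cutoff(6,7)[OF s1] by (auto simp: ball_cutoff_def)
  show "\<bar>ball_cutoff' s0 c r x v\<bar> \<le> 8 / (1 - s0) / r * norm v"
  proof (cases "1 \<le> t")
    case True
    then show ?thesis
      using cutoff(5)[OF s1, of t] r s1 by (simp add: ball_cutoff'_def t_def)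
  next
    case False
    then have "(norm (x - c) / r)\<^sup>2 < 1\<^sup>2" by (simp add: t)
    then have "norm (x - c) / r < 1" by (rule power_less_imp_less_base) simp
    then have "norm (x - c) \<le> r" using r by (simp add: divide_less_eq)
    then have "\<bar>(x - c) \<bullet> v\<bar> \<le> r * norm v"
      using Cauchy_Schwarz_ineq2[of "x - c" v] by (meson mult_right_mono norm_ge_zero order_trans)
    then have "\<bar>2 * ((x - c) \<bullet> v) / r\<^sup>2\<bar> \<le> 2 * (r * norm v) / r\<^sup>2"
      using r by (simp add: abs_mult divide_right_mono)
    also have "\<dots> = 2 / r * norm v"
      using r by (simp add: power2_eq_square)
    finally have "\<bar>cutoff' s0 t\<bar> * \<bar>2 * ((x - c) \<bullet> v) / r\<^sup>2\<bar> \<le> 4 / (1 - s0) * (2 / r * norm v)"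
      using cutoff(8)[OF s1, of t] s1 by (intro mult_mono) auto
    then show ?thesis
      by (simp add: ball_cutoff'_def t_def abs_mult)
  qed
qed

lemma C1_distD:
  fixes f g :: "real ^ 'n::finite \<Rightarrow> 'a::real_normed_vector" and s :: real
  assumes "f \<in> C1_surfaces" "g \<in> C1_surfaces" "C1_dist f g \<le> s" "x \<in> cube"
  shows "norm (g x - f x) \<le> s" "norm (total_deriv g x v - total_deriv f x v) \<le> CARD('n) * s * norm v"
proof -
  have *: "norm (f x - g x) \<le> s" "norm (partial_deriv i f x - partial_deriv i g x) \<le> s" for i
    using assms C1_dist_le_iff[of f g s] by auto
  show "norm (g x - f x) \<le> s" using *(1) by (simp add: norm_minus_commute)
  have "total_deriv g x v - total_deriv f x v = (\<Sum>i\<in>UNIV. v $ i *\<^sub>R (partial_deriv i g x - partial_deriv i f x))"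
    by (simp add: total_deriv_def sum_subtractf scaleR_diff_right)
  also have "norm \<dots> \<le> (\<Sum>i\<in>(UNIV :: 'n set). norm v * s)"
  proof (rule sum_norm_le)
    fix i
    show "norm (v $ i *\<^sub>R (partial_deriv i g x - partial_deriv i f x)) \<le> norm v * s"
      using component_le_norm_cart[of v i] *(2)[of i]
      by (simp add: norm_minus_commute[of "partial_deriv i g x"] mult_mono)
  qed
  finally show "norm (total_deriv g x v - total_deriv f x v) \<le> CARD('n) * s * norm v"
    by (simp add: mult.commute mult.left_commute)
qed

section \<open>Good points, their stability, and affine models\<close>

context hole_scheme
begin

text \<open>The last clause keeps the tangent of the surface comparable with the \<open>k\<close>-th
  hyperplane. It later bounds \<open>norm (p k)\<close> at a fixed point, and thereby the porosity
  constant.\<close>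

definition good :: "('a::real_normed_vector \<Rightarrow> (real ^ 'n) \<times> real) \<Rightarrow> nat \<Rightarrow> (real ^ 'n \<Rightarrow> 'a) \<Rightarrow> (real ^ 'n) set" where
  "good \<pi> m f = {x \<in> box 0 1. nondegenerate \<pi> f x \<and>
     (\<exists>k\<ge>m. \<pi> (f x) \<in> rim (p k) (q k) k (J k) \<and>
       (\<forall>v. \<bar>snd (\<pi> (total_deriv f x v)) - p k \<bullet> fst (\<pi> (total_deriv f x v))\<bar> \<le> norm v))}"

text \<open>The exact situation that a perturbation can produce: the surface meets the hyperplane
  and is tangent to it. The constant \<open>B\<close> is explicit so that stability is uniform in
  \<open>x\<close>.\<close>

definition affine_at :: "('a::real_normed_vector \<Rightarrow> (real ^ 'n) \<times> real) \<Rightarrow> nat \<Rightarrow> real \<Rightarrow> (real ^ 'n \<Rightarrow> 'a) \<Rightarrow> real ^ 'n \<Rightarrow> bool" where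
  "affine_at \<pi> k B g x \<longleftrightarrow> x \<in> box 0 1 \<and> snd (\<pi> (g x)) = p k \<bullet> fst (\<pi> (g x)) + q k \<and>
    (\<exists>j\<in>J k. near_grid k j (1 / (4 * CARD('n))) (fst (\<pi> (g x)))) \<and>
    (\<forall>v. B * norm v \<le> norm (fst (\<pi> (total_deriv g x v)))) \<and>
    (\<forall>v. snd (\<pi> (total_deriv g x v)) = p k \<bullet> fst (\<pi> (total_deriv g x v)))"

lemma good_stable:
  fixes \<pi> :: "'a::real_normed_vector \<Rightarrow> (real ^ 'n) \<times> real"
  assumes \<pi>: "bounded_linear \<pi>" and k: "m \<le> k" and B: "0 < B"
  shows "\<exists>s>0. \<forall>f\<in>C1_surfaces. \<forall>g\<in>C1_surfaces. \<forall>x. C1_dist g f < s \<longrightarrow> affine_at \<pi> k B g x \<longrightarrow> x \<in> good \<pi> m f"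
proof -
  obtain K where K: "0 < K" "\<And>v. norm (\<pi> v) \<le> norm v * K"
    using bounded_linear.pos_bounded[OF \<pi>] by blast
  obtain b where b: "\<And>j. j \<in> J k \<Longrightarrow> j \<le> b"
    using finite_nat_set_iff_bounded_le[of "J k"] finite_J by auto
  define n where "n = real CARD('n)"
  have n: "1 \<le> n" unfolding n_def by simp
  define P where "P = 1 + norm (p k)"
  have P: "1 \<le> P" by (simp add: P_def)
  \<comment> \<open>The three bounds serve, in this order, the rim condition, nondegeneracy and the
    slope clause; \<open>b\<close> bounds the finite set \<open>J k\<close>, so one \<open>s\<close>
    works for all its scales.\<close>
  define s where "s = min (1 / (8 * n * 2 ^ b * P * K)) (min (B / (2 * n * K)) (1 / (P * K * n)))"
  have s: "0 < s"
    using B K(1) n P by (simp add: s_def)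
  have s1: "2 ^ b * (P * (K * s)) \<le> 1 / (8 * n)"
    and s2: "K * (n * s) \<le> B / 2" and s3: "P * (K * (n * s)) \<le> 1"
  proof -
    have "s \<le> 1 / (8 * n * 2 ^ b * P * K)" "s \<le> B / (2 * n * K)" "s \<le> 1 / (P * K * n)"
      by (auto simp: s_def)
    then show "2 ^ b * (P * (K * s)) \<le> 1 / (8 * n)" "K * (n * s) \<le> B / 2" "P * (K * (n * s)) \<le> 1"
      using K(1) n P by (simp_all add: pos_le_divide_eq mult_ac)
  qed
  show ?thesis
  proof (intro exI[of _ s] conjI s ballI allI impI)
    fix f g :: "real ^ 'n \<Rightarrow> 'a" and x
    assume fg: "f \<in> C1_surfaces" "g \<in> C1_surfaces" "C1_dist g f < s" and aff: "affine_at \<pi> k B g x"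
    have x: "x \<in> box 0 1" and plane: "snd (\<pi> (g x)) = p k \<bullet> fst (\<pi> (g x)) + q k"
      and near: "\<exists>j\<in>J k. near_grid k j (1 / (4 * CARD('n))) (fst (\<pi> (g x)))"
      and nd: "\<And>v. B * norm v \<le> norm (fst (\<pi> (total_deriv g x v)))"
      and slope: "\<And>v. snd (\<pi> (total_deriv g x v)) = p k \<bullet> fst (\<pi> (total_deriv g x v))"
      using aff unfolding affine_at_def by blast+
    have xc: "x \<in> cube" using x box_subset_cbox by (auto simp: cube_eq_cbox)
    define d where "d = \<pi> (f x) - \<pi> (g x)"
    define e where "e v = \<pi> (total_deriv f x v) - \<pi> (total_deriv g x v)" for v
    have "d = \<pi> (f x - g x)" "\<And>v. e v = \<pi> (total_deriv f x v - total_deriv g x v)"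
      by (simp_all add: d_def e_def linear_diff[OF bounded_linear.linear[OF \<pi>]])
    then have d: "norm d \<le> K * s" and e: "norm (e v) \<le> K * (n * s) * norm v" for v
      using K(2)[of "f x - g x"] K(2)[of "total_deriv f x v - total_deriv g x v"]
        C1_distD(1)[OF fg(2,1) less_imp_le[OF fg(3)] xc]
        C1_distD(2)[OF fg(2,1) less_imp_le[OF fg(3)] xc, of v] K(1)
      by (auto simp: n_def mult.commute mult.left_commute intro!: order_trans[OF K(2)])
    have fd: "norm (fst w) \<le> norm w" "\<bar>snd w\<bar> \<le> norm w" for w :: "(real ^ 'n) \<times> real"
      using norm_fst_le[of "fst w" "snd w"] norm_snd_le[of "snd w" "fst w"] by simp_all
    have off: "\<bar>snd w - p k \<bullet> fst w\<bar> \<le> P * norm w" for w :: "(real ^ 'n) \<times> real"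
    proof -
      have "\<bar>p k \<bullet> fst w\<bar> \<le> norm (p k) * norm w"
        using Cauchy_Schwarz_ineq2[of "p k" "fst w"] mult_left_mono[OF fd(1)[of w], of "norm (p k)"] by simp
      then show ?thesis
        using fd(2)[of w] by (simp add: P_def distrib_right)
    qed
    have "nondegenerate \<pi> f x"
      unfolding nondegenerate_def
    proof (intro exI conjI allI)
      show "0 < B / 2" using B by simp
      fix v
      have "norm (fst (\<pi> (total_deriv g x v))) \<le> norm (fst (\<pi> (total_deriv f x v))) + norm (fst (e v))"
        using norm_triangle_ineq4[of "fst (\<pi> (total_deriv f x v))" "fst (e v)"] by (simp add: e_def)
      moreover have "norm (fst (e v)) \<le> B / 2 * norm v"
        using fd(1)[of "e v"] e[of v] mult_right_mono[OF s2, of "norm v"] by simp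
      ultimately show "B / 2 * norm v \<le> norm (fst (\<pi> (total_deriv f x v)))"
        using nd[of v] by (simp add: field_simps)
    qed
    moreover have "\<bar>snd (\<pi> (total_deriv f x v)) - p k \<bullet> fst (\<pi> (total_deriv f x v))\<bar> \<le> norm v" for v
    proof -
      have "snd (\<pi> (total_deriv f x v)) - p k \<bullet> fst (\<pi> (total_deriv f x v)) = snd (e v) - p k \<bullet> fst (e v)"
        using slope[of v] by (simp add: e_def inner_diff_right)
      then have "\<bar>snd (\<pi> (total_deriv f x v)) - p k \<bullet> fst (\<pi> (total_deriv f x v))\<bar> \<le> P * norm (e v)"
        using off[of "e v"] by simp
      also have "\<dots> \<le> P * (K * (n * s) * norm v)"
        using e[of v] P by (intro mult_left_mono) auto
      also have "\<dots> \<le> 1 * norm v"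
        using mult_right_mono[OF s3, of "norm v"] by (simp add: mult.assoc)
      finally show ?thesis by simp
    qed
    moreover have "\<pi> (f x) \<in> rim (p k) (q k) k (J k)"
    proof -
      obtain j where j: "j \<in> J k" "near_grid k j (1 / (4 * CARD('n))) (fst (\<pi> (g x)))"
        using near by blast
      have "(2::real) ^ j \<le> 2 ^ b" using b[OF j(1)] by (intro power_increasing) auto
      then have "2 ^ j * (P * norm d) \<le> 2 ^ b * (P * (K * s))"
        using d P by (intro mult_mono mult_nonneg_nonneg) auto
      then have jd: "2 ^ j * (P * norm d) \<le> 1 / (8 * n)" using s1 by linarith
      have "norm d \<le> P * norm d" using mult_right_mono[OF P, of "norm d"] by simp
      then have "2 ^ j * norm d \<le> 2 ^ j * (P * norm d)" by simp
      moreover have "1 / (8 * n) \<le> 1 / (4 * n)" using n by (intro divide_left_mono) auto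
      ultimately have "2 ^ j * norm d \<le> 1 / (4 * n)" using jd by linarith
      then have "norm d \<le> 1 / (4 * n) / 2 ^ j" by (subst pos_le_divide_eq) (simp_all add: mult.commute)
      then have "\<bar>fst (\<pi> (f x)) $ i - fst (\<pi> (g x)) $ i\<bar> \<le> 1 / (4 * CARD('n)) / 2 ^ j" for i
        using component_le_norm_cart[of "fst d" i] fd(1)[of d] by (simp add: d_def n_def)
      from near_grid_perturb[OF j(2) this]
      have 1: "near_grid k j (1 / (2 * CARD('n))) (fst (\<pi> (f x)))" by simp
      have "offset (p k) (q k) (\<pi> (f x)) = snd d - p k \<bullet> fst d"
        using plane by (simp add: offset_def d_def inner_diff_right)
      then have "\<bar>2 ^ j * offset (p k) (q k) (\<pi> (f x))\<bar> \<le> 2 ^ j * (P * norm d)"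
        using off[of d] by (simp add: abs_mult)
      also have "\<dots> < 1 / 4"
        using jd n by (intro le_less_trans[OF jd]) (simp add: field_simps)
      finally show ?thesis
        unfolding rim_def using j(1) 1 by blast
    qed
    ultimately show "x \<in> good \<pi> m f"
      unfolding good_def using x k by blast
  qed
qed

text \<open>The off-grid sets \<open>Y k\<close> have summable measure, so almost no point lies in
  infinitely many of them, and an invertible affine map pulls this null set back to a null set. The
  tails \<open>W k\<close> decrease into the latter, which bounds the measure for all late
  \<open>k\<close> at once.\<close>

lemma affine_preimage_off_grid_small:
  fixes A :: "real ^ 'n \<Rightarrow> real ^ 'n"
  assumes A: "linear A" "inj A" and \<epsilon>: "0 < \<epsilon>"
  obtains k0 where "\<And>k. k0 \<le> k \<Longrightarrow> measure lebesgue {x \<in> cball c R.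
    \<forall>j\<in>J k. \<not> near_grid k j (1 / (4 * CARD('n))) (a + A (x - c))} < \<epsilon>"
proof -
  define N where "N k = (\<Union>j\<in>J k. {y :: real ^ 'n. near_grid k j (1 / (4 * CARD('n))) y})" for k
  define h where "h x = a + A (x - c)" for x
  define Y where "Y k = cbox (\<chi> i. - (2 ^ k)) (\<chi> i. 2 ^ k) - N k" for k
  define Z where "Z k = {x \<in> cball c R. \<forall>j\<in>J k. \<not> near_grid k j (1 / (4 * CARD('n))) (a + A (x - c))}" for k
  define W where "W k = (\<Union>l\<in>{k..}. Z l)" for k
  have openN: "open (N k)" for k
    unfolding N_def by (intro open_UN ballI open_near_grid)
  then have Nm: "N k \<in> sets lebesgue" for k
    by (intro sets_completionI_sets) simp
  have Y: "Y k \<in> lmeasurable" for k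
    unfolding Y_def by (intro fmeasurable_Diff lmeasurable_cbox Nm)
  have Ysmall: "measure lebesgue (Y k) \<le> (1 / 2) ^ k" for k
  proof -
    have "Y k = {y \<in> cbox (\<chi> i. - (2 ^ k)) (\<chi> i. 2 ^ k). \<forall>j\<in>J k. \<not> near_grid k j (1 / (4 * CARD('n))) y}"
      by (auto simp: Y_def N_def)
    then show ?thesis using off_grid_small[of k] by simp
  qed
  have "summable (\<lambda>k. measure lebesgue (Y k))"
    by (rule summable_comparison_test'[of "\<lambda>k. (1 / 2) ^ k" 0]) (use Ysmall in \<open>auto simp: summable_geometric\<close>)
  then have "limsup Y \<in> null_sets lebesgue"
  proof (rule borel_cantelli_limsup1[rotated 2])
    show "Y k \<in> sets lebesgue" for k using Y by (rule fmeasurableD)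
    show "emeasure lebesgue (Y k) < \<infinity>" for k
      using fmeasurableD2[OF Y[of k]] by (simp only: less_top infinity_ennreal_def)
  qed
  then have limsupY: "negligible (limsup Y)" by (simp add: negligible_iff_null_sets)
  obtain A' where A': "linear A'" "A' \<circ> A = id"
    using linear_injective_left_inverse[OF A] by blast
  have hinv: "c + A' (h x - a) = x" for x
    using A'(2) by (simp add: h_def pointfree_idE)
  have "(\<lambda>z. c + A' (z - a)) differentiable_on limsup Y"
  proof -
    have "(\<lambda>z. c + A' (z - a)) differentiable (at z within S)" for z S
    proof -
      have "(A' has_derivative A') (at y within T)" for y T
        using A'(1) by (simp add: linear_imp_has_derivative)
      from has_derivative_compose[OF has_derivative_diff[OF has_derivative_ident has_derivative_const] this]
      have "((\<lambda>z. A' (z - a)) has_derivative A') (at z within S)" by simp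
      from has_derivative_add[OF has_derivative_const this] show ?thesis
        unfolding differentiable_def by blast
    qed
    then show ?thesis by (simp add: differentiable_on_def)
  qed
  from negligible_differentiable_image_negligible[OF order_refl limsupY this]
  have null: "negligible ((\<lambda>z. c + A' (z - a)) ` limsup Y)" .
  have hc: "continuous_on UNIV h"
  proof -
    have "continuous_on UNIV A" using A(1) by (simp add: linear_continuous_on linear_conv_bounded_linear)
    then have "continuous_on UNIV (\<lambda>x. A (x - c))"
      by (rule continuous_on_compose2) (auto intro!: continuous_intros)
    then show ?thesis
      unfolding h_def by (intro continuous_on_add continuous_on_const)
  qed
  have Z: "Z k \<in> lmeasurable" for k
  proof -
    have "h -` N k \<in> sets lebesgue"
      using open_vimage[OF openN hc] by (intro sets_completionI_sets) simp
    moreover have "Z k = cball c R - h -` N k"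
      by (auto simp: Z_def h_def N_def)
    ultimately show ?thesis
      by (metis fmeasurable_Diff lmeasurable_cball)
  qed
  have W: "W k \<in> lmeasurable" for k
  proof (rule bounded_set_imp_lmeasurable)
    show "bounded (W k)"
      by (rule bounded_subset[OF bounded_cball[of c R]]) (auto simp: W_def Z_def)
    show "W k \<in> sets lebesgue"
      unfolding W_def using Z by (intro sets.countable_UN) (auto intro: fmeasurableD)
  qed
  obtain K where K: "0 < K" "\<And>v. norm (A v) \<le> norm v * K"
    using bounded_linear.pos_bounded A(1) linear_conv_bounded_linear by blast
  define L where "L = norm a + \<bar>R\<bar> * K"
  obtain k1 where k1: "L < 2 ^ k1" using real_arch_pow[of 2 L] by auto
  have ZY: "h x \<in> Y k" if "k1 \<le> k" "x \<in> Z k" for x k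
  proof -
    have "norm (x - c) \<le> \<bar>R\<bar>"
      using that(2) by (auto simp: Z_def dist_norm norm_minus_commute)
    then have "norm (x - c) * K \<le> \<bar>R\<bar> * K"
      using K(1) by (intro mult_right_mono) auto
    then have "norm (h x) \<le> L"
      using K(2)[of "x - c"] norm_triangle_ineq[of a "A (x - c)"] by (simp add: h_def L_def)
    moreover have "(2::real) ^ k1 \<le> 2 ^ k" using that(1) by (intro power_increasing) auto
    ultimately have "\<bar>h x $ i\<bar> \<le> 2 ^ k" for i
      using component_le_norm_cart[of "h x" i] k1 by linarith
    then have "- (2 ^ k) \<le> h x $ i \<and> h x $ i \<le> 2 ^ k" for i
      by (simp add: abs_le_iff minus_le_iff)
    then have "h x \<in> cbox (\<chi> i. - (2 ^ k)) (\<chi> i. 2 ^ k)" by (simp add: mem_box_cart)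
    then show ?thesis
      using that(2) by (simp add: Y_def Z_def N_def h_def)
  qed
  have "(\<Inter>k. W k) \<subseteq> (\<lambda>z. c + A' (z - a)) ` limsup Y"
  proof
    fix x assume x: "x \<in> (\<Inter>k. W k)"
    have "\<exists>l\<ge>k. h x \<in> Y l" for k
    proof -
      have "x \<in> W (max k k1)" using x by blast
      then show ?thesis using ZY by (auto simp: W_def)
    qed
    then have "h x \<in> limsup Y"
      unfolding limsup_INF_SUP by auto
    then show "x \<in> (\<lambda>z. c + A' (z - a)) ` limsup Y"
      using hinv[of x] by (metis imageI)
  qed
  then have W0: "measure lebesgue (\<Inter>k. W k) = 0"
    using null negligible_subset negligible_imp_measure0 by blast
  have "(\<lambda>k. measure lebesgue (W k)) \<longlonglongrightarrow> measure lebesgue (\<Inter>k. W k)"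
  proof (rule Lim_measure_decseq)
    show "range W \<subseteq> sets lebesgue"
      using W by (blast intro: fmeasurableD)
    show "decseq W"
      unfolding decseq_def W_def by (intro allI impI UN_mono) auto
    show "emeasure lebesgue (W k) \<noteq> \<infinity>" for k
      using fmeasurableD2[OF W] by simp
  qed
  then have "(\<lambda>k. measure lebesgue (W k)) \<longlonglongrightarrow> 0"
    unfolding W0 .
  from eventually_happens[OF order_tendstoD(2)[OF this \<epsilon>]]
  obtain k0 where k0: "measure lebesgue (W k0) < \<epsilon>"
    by (meson sequentially_bot)
  show ?thesis
  proof (rule that)
    fix k assume "k0 \<le> k"
    then have "measure lebesgue (Z k) \<le> measure lebesgue (W k0)"
      using W Z by (intro measure_mono_fmeasurable) (auto simp: W_def intro: fmeasurableD)
    then show "measure lebesgue {x \<in> cball c R.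
      \<forall>j\<in>J k. \<not> near_grid k j (1 / (4 * CARD('n))) (a + A (x - c))} < \<epsilon>"
      using k0 unfolding Z_def by (rule order.strict_trans1)
  qed
qed

text \<open>A small shift makes the base part injective; the linear model is then a graph of some
  slope \<open>w\<close>, and density provides arbitrarily late hyperplanes near it. The shift and
  the change of slope cost \<open>\<eta>\<close> each, whence the factor 2.\<close>

lemma exists_affine_model:
  fixes G :: "real ^ 'n \<Rightarrow> (real ^ 'n) \<times> real" and y :: "(real ^ 'n) \<times> real"
  assumes G: "linear G" and \<eta>: "0 < \<eta>" and r: "0 < r" and \<epsilon>: "0 < \<epsilon>"
  obtains A k B where "linear A" "m \<le> k" "0 < B" "\<And>v. B * norm v \<le> norm (A v)"
    "\<And>v. norm ((A v, p k \<bullet> A v) - G v) \<le> 2 * \<eta> * norm v" "\<bar>p k \<bullet> fst y + q k - snd y\<bar> \<le> \<eta> * r"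
    "measure lebesgue {x \<in> cball c R. \<forall>j\<in>J k. \<not> near_grid k j (1 / (4 * CARD('n))) (fst y + A (x - c))} < \<epsilon>"
proof -
  have G1: "linear (\<lambda>v. fst (G v))" and G2: "linear (\<lambda>v. snd (G v))"
    using linear_compose[OF G bounded_linear.linear[OF bounded_linear_fst]]
      linear_compose[OF G bounded_linear.linear[OF bounded_linear_snd]] by (simp_all add: o_def)
  obtain t where t: "0 < t" "t < \<eta>" "inj (\<lambda>v. fst (G v) + t *\<^sub>R v)"
    using exists_injective_shift[OF G1 \<eta>] by blast
  define A where "A v = fst (G v) + t *\<^sub>R v" for v
  have A: "linear A"
    unfolding A_def[abs_def] by (intro linear_compose_add G1 linear_scale_self)
  have injA: "inj A" using t(3) by (simp add: A_def[abs_def])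
  obtain B where B: "0 < B" "\<And>v. B * norm v \<le> norm (A v)"
    using linear_inj_bounded_below_pos[OF A injA] by blast
  obtain K where K: "0 < K" "\<And>v. norm (A v) \<le> norm v * K"
    using bounded_linear.pos_bounded A linear_conv_bounded_linear by blast
  obtain w where w: "\<And>v. w \<bullet> A v = snd (G v)"
    using solve_adjoint[OF A injA G2] by blast
  obtain k0 where k0: "\<And>k. k0 \<le> k \<Longrightarrow> measure lebesgue {x \<in> cball c R.
    \<forall>j\<in>J k. \<not> near_grid k j (1 / (4 * CARD('n))) (fst y + A (x - c))} < \<epsilon>"
    using affine_preimage_off_grid_small[OF A injA \<epsilon>, of c R "fst y"] by blast
  define U where "U = {(p', q'). norm (p' - w) * K < \<eta> \<and> \<bar>p' \<bullet> fst y + q' - snd y\<bar> < \<eta> * r}"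
  have "open U"
  proof -
    have "U = {x. norm (fst x - w) * K < \<eta>} \<inter> {x. \<bar>fst x \<bullet> fst y + snd x - snd y\<bar> < \<eta> * r}"
      by (auto simp: U_def)
    then show ?thesis
      by (auto intro!: open_Int open_Collect_less continuous_intros)
  qed
  moreover have "(w, snd y - w \<bullet> fst y) \<in> U"
    using \<eta> r by (simp add: U_def)
  ultimately obtain k where k: "max m k0 \<le> k" "(p k, q k) \<in> U"
    using dense[of U "max m k0"] by blast
  show ?thesis
  proof (rule that[OF A _ B])
    show "m \<le> k" using k(1) by simp
    show "\<bar>p k \<bullet> fst y + q k - snd y\<bar> \<le> \<eta> * r" using k(2) by (simp add: U_def)
    show "norm ((A v, p k \<bullet> A v) - G v) \<le> 2 * \<eta> * norm v" for v
    proof -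
      have "(A v, p k \<bullet> A v) - G v = (t *\<^sub>R v, (p k - w) \<bullet> A v)"
        by (simp add: prod_eq_iff A_def[of v] inner_diff_left w[symmetric])
      moreover have "norm (t *\<^sub>R v) \<le> \<eta> * norm v"
        using t by (simp add: mult_right_mono)
      moreover have "\<bar>(p k - w) \<bullet> A v\<bar> \<le> \<eta> * norm v"
      proof -
        have "\<bar>(p k - w) \<bullet> A v\<bar> \<le> norm (p k - w) * (norm v * K)"
          using Cauchy_Schwarz_ineq2[of "p k - w" "A v"] mult_left_mono[OF K(2)[of v], of "norm (p k - w)"] by simp
        also have "\<dots> = norm (p k - w) * K * norm v" by simp
        also have "\<dots> \<le> \<eta> * norm v" using k(2) by (intro mult_right_mono) (auto simp: U_def)
        finally show ?thesis .
      qed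
      ultimately show ?thesis
        using norm_Pair_le[of "t *\<^sub>R v" "(p k - w) \<bullet> A v"] by simp
    qed
    show "measure lebesgue {x \<in> cball c R. \<forall>j\<in>J k. \<not> near_grid k j (1 / (4 * CARD('n))) (fst y + A (x - c))} < \<epsilon>"
      using k(1) by (intro k0) simp
  qed
qed

end

text \<open>Vitali's theorem fills \<open>U\<close> up to a null set with countably many disjoint
  balls, and finitely many of these carry almost all the measure.\<close>

lemma finite_disjoint_balls_almost_cover:
  fixes U :: "'a::euclidean_space set"
  assumes U: "open U" "bounded U" and \<delta>: "0 < \<delta>" and \<epsilon>: "0 < \<epsilon>"
  obtains I where "finite I" "\<And>c r. (c, r) \<in> I \<Longrightarrow> 0 < r \<and> r < \<delta> \<and> ball c r \<subseteq> U"
    "pairwise (\<lambda>i j. disjnt (ball (fst i) (snd i)) (ball (fst j) (snd j))) I"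
    "measure lebesgue U - \<epsilon> < measure lebesgue (\<Union>i\<in>I. ball (fst i) (snd i))"
proof -
  define b where "b i = ball (fst i) (snd i)" for i :: "'a \<times> real"
  define K where "K = {i :: 'a \<times> real. 0 < snd i \<and> snd i < \<delta> \<and> b i \<subseteq> U}"
  obtain C where C: "countable C" "C \<subseteq> K" "pairwise (\<lambda>i j. disjnt (b i) (b j)) C"
    "negligible (U - (\<Union>i\<in>C. b i))"
  proof (rule Vitali_covering_theorem_balls[of U K fst snd])
    fix x d assume x: "x \<in> U" and d: "0 < (d::real)"
    obtain e where e: "0 < e" "ball x e \<subseteq> U"
      using U(1) x by (meson open_contains_ball)
    define r where "r = min (e / 2) (min (d / 2) (\<delta> / 2))"
    have "0 < r" "r < e" "r < d" "r < \<delta>" using e d \<delta> by (auto simp: r_def)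
    moreover from this have "b (x, r) \<subseteq> U" using e by (auto simp: b_def)
    ultimately show "\<exists>i. i \<in> K \<and> x \<in> ball (fst i) (snd i) \<and> snd i < d"
      by (intro exI[of _ "(x, r)"]) (simp add: K_def)
  qed (auto simp: b_def)
  have UC: "(\<Union>i\<in>C. b i) \<subseteq> U" using C(2) by (auto simp: K_def)
  have lm: "\<Union>(b ` C) \<in> lmeasurable"
    using U(2) UC by (intro lmeasurable_open) (auto simp: b_def intro: bounded_subset)
  have "measure lebesgue U = measure lebesgue (\<Union>(b ` C))"
  proof (rule measure_negligible_symdiff[OF lm])
    show "negligible (\<Union>(b ` C) - U \<union> (U - \<Union>(b ` C)))"
      using C(4) UC by (simp add: Diff_eq_empty_iff[THEN iffD2])
  qed
  moreover obtain D where D: "D \<subseteq> b ` C" "finite D" "measure lebesgue (\<Union>(b ` C)) - \<epsilon> < measure lebesgue (\<Union>D)"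
  proof (rule measure_countable_Union_approachable[of "b ` C" \<epsilon> "measure lebesgue (\<Union>(b ` C))"])
    show "d \<in> lmeasurable" if "d \<in> b ` C" for d using that by (auto simp: b_def)
    show "measure lebesgue (\<Union>D') \<le> measure lebesgue (\<Union>(b ` C))" if "D' \<subseteq> b ` C" "finite D'" for D'
    proof (rule measure_mono_fmeasurable[OF _ _ lm])
      show "\<Union>D' \<subseteq> \<Union>(b ` C)" using that(1) by (rule Union_mono)
      have "open (\<Union>D')" using that(1) by (auto simp: b_def intro!: open_Union)
      then show "\<Union>D' \<in> sets lebesgue" by (intro sets_completionI_sets) simp
    qed
  qed (use C(1) \<epsilon> in auto)
  obtain I where I: "I \<subseteq> C" "finite I" "D = b ` I"
    using finite_subset_image[OF D(2,1)] by blast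
  show ?thesis
  proof (rule that[OF I(2)])
    show "0 < r \<and> r < \<delta> \<and> ball c r \<subseteq> U" if "(c, r) \<in> I" for c r
    proof -
      have "(c, r) \<in> K" using that I(1) C(2) by blast
      then show ?thesis by (simp add: K_def b_def)
    qed
    show "pairwise (\<lambda>i j. disjnt (ball (fst i) (snd i)) (ball (fst j) (snd j))) I"
      using C(3) I(1) unfolding b_def by (rule pairwise_subset)
    show "measure lebesgue U - \<epsilon> < measure lebesgue (\<Union>i\<in>I. ball (fst i) (snd i))"
      using D(3) calculation unfolding I(3) b_def by simp
  qed
qed

context hole_scheme
begin

text \<open>On finitely many small disjoint balls the projected surface is bent to an affine model,
  through \<open>\<sigma>\<close>, with a small change in C^1. On the cores the projection is
  exactly affine and \<open>good_stable\<close> applies. Three losses of at most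
  \<open>\<epsilon>1 / 4\<close> occur: outside the balls, outside the cores, and off the
  grids.\<close>

theorem perturb_to_good:
  fixes \<pi> :: "'a::real_normed_vector \<Rightarrow> (real ^ 'n) \<times> real" and f0 :: "real ^ 'n \<Rightarrow> 'a"
  assumes \<pi>: "bounded_linear \<pi>" and \<sigma>: "bounded_linear \<sigma>" and \<pi>\<sigma>: "\<And>v. \<pi> (\<sigma> v) = v"
    and f0: "f0 \<in> C1_surfaces" and \<eta>: "0 < \<eta>" and \<epsilon>: "0 < \<epsilon>"
  obtains g s T where "g \<in> C1_surfaces" "C1_dist f0 g < \<eta>" "0 < s" "T \<in> lmeasurable" "T \<subseteq> box 0 1"
    "measure lebesgue (box 0 1 - T) < \<epsilon>"
    "\<And>f. f \<in> C1_surfaces \<Longrightarrow> C1_dist g f < s \<Longrightarrow> T \<subseteq> good \<pi> m f"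
proof -
  define n where "n = CARD('n)"
  obtain K where K: "0 < K" "\<And>v. norm (\<pi> v) \<le> norm v * K"
    using bounded_linear.pos_bounded[OF \<pi>] by blast
  obtain L where L: "0 < L" "\<And>v. norm (\<sigma> v) \<le> norm v * L"
    using bounded_linear.pos_bounded[OF \<sigma>] by blast
  note lin\<pi> = bounded_linear.linear[OF \<pi>] and lin\<sigma> = bounded_linear.linear[OF \<sigma>]
  have "C1_on_cube f0" using f0 by (simp add: C1_surfaces_def)
  then obtain f0' where f0': "\<And>x. x \<in> cube \<Longrightarrow> (f0 has_derivative blinfun_apply (f0' x)) (at x within cube)"
    "continuous_on cube f0'" "\<And>x. x \<in> cube \<Longrightarrow> total_deriv f0 x = blinfun_apply (f0' x)"
    using C1_on_cubeE by blast
  have box_cube: "box 0 1 \<subseteq> (cube :: (real ^ 'n) set)"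
    by (simp add: cube_eq_cbox box_subset_cbox)

  define \<epsilon>1 where "\<epsilon>1 = min \<epsilon> 1"
  have \<epsilon>1: "0 < \<epsilon>1" "\<epsilon>1 \<le> 1" "\<epsilon>1 \<le> \<epsilon>" using \<epsilon> by (auto simp: \<epsilon>1_def)
  \<comment> \<open>Makes \<open>n \<kappa> = \<epsilon>1 / 4\<close>; Bernoulli's inequality turns
    this into the relative volume lost by shrinking the balls.\<close>
  define \<kappa> where "\<kappa> = \<epsilon>1 / (4 * real n)"
  have n1: "1 \<le> real n" by (simp add: n_def)
  have \<kappa>: "0 < \<kappa>" "\<kappa> \<le> 1" "real n * \<kappa> = \<epsilon>1 / 4"
    using \<epsilon>1 n1 by (auto simp: \<kappa>_def divide_le_eq)
  have bernoulli: "1 - \<epsilon>1 / 4 \<le> (1 - \<kappa>) ^ n"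
    using Bernoulli_inequality[of "- \<kappa>" n] \<kappa> by simp
  define s0 where "s0 = (1 - \<kappa>)\<^sup>2"
  have s1: "s0 < 1"
    unfolding s0_def using power_strict_mono[of "1 - \<kappa>" 1 2] \<kappa> by simp
  define C where "C = 8 / (1 - s0)"
  have C: "0 \<le> C" using s1 by (simp add: C_def)
  \<comment> \<open>Covers the error in the values, at most \<open>4 \<eta>' L\<close>, and the
    error in the derivatives, at most \<open>(3 + 4 C) \<eta>' L\<close>; both are then at most
    \<open>\<eta> / 2\<close>.\<close>
  define \<eta>' where "\<eta>' = \<eta> / (2 * L * (4 + 4 * C))"
  have \<eta>': "0 < \<eta>'" using \<eta> L C by (simp add: \<eta>'_def)
  have L\<eta>: "L * (\<eta>' * (4 + 4 * C)) = \<eta> / 2" using L C by (simp add: \<eta>'_def)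

  have "uniformly_continuous_on cube f0'"
    by (intro compact_uniformly_continuous f0'(2)) (simp add: cube_eq_cbox)
  then obtain \<delta>0 where \<delta>0: "0 < \<delta>0"
    "\<And>x y. x \<in> cube \<Longrightarrow> y \<in> cube \<Longrightarrow> dist y x < \<delta>0 \<Longrightarrow> dist (f0' y) (f0' x) < \<eta>' / K"
    using \<eta>' K(1) unfolding uniformly_continuous_on_def by (metis divide_pos_pos)
  \<comment> \<open>Radii below \<open>\<delta>0\<close> control the oscillation of
    \<open>f0'\<close>; radii below 1 turn the bound \<open>4 \<eta>' r\<close> for \<open>w\<close>
    into one for the supremum norm.\<close>
  define \<delta> where "\<delta> = min \<delta>0 1"
  have \<delta>: "0 < \<delta>" using \<delta>0 by (simp add: \<delta>_def)

  have \<epsilon>4: "0 < \<epsilon>1 / 4" using \<epsilon>1 by simp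
  obtain I :: "((real ^ 'n) \<times> real) set" where I: "finite I" "\<And>c r. (c, r) \<in> I \<Longrightarrow> 0 < r \<and> r < \<delta> \<and> ball c r \<subseteq> box 0 1"
    "pairwise (\<lambda>i j. disjnt (ball (fst i) (snd i)) (ball (fst j) (snd j))) I"
    "measure lebesgue (box 0 1 :: (real ^ 'n) set) - \<epsilon>1 / 4 < measure lebesgue (\<Union>i\<in>I. ball (fst i) (snd i))"
    by (rule finite_disjoint_balls_almost_cover[OF open_box bounded_box \<delta> \<epsilon>4]) (rule that)
  have Ir: "0 < snd i" "snd i < \<delta>0" "snd i < 1" "ball (fst i) (snd i) \<subseteq> box 0 1" "fst i \<in> cube" if "i \<in> I" for i
  proof -
    show *: "0 < snd i" "snd i < \<delta>0" "snd i < 1" "ball (fst i) (snd i) \<subseteq> box 0 1"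
      using I(2)[of "fst i" "snd i"] that by (auto simp: \<delta>_def)
    then have "fst i \<in> box 0 1" by (meson centre_in_ball subsetD)
    then show "fst i \<in> cube" using box_cube by blast
  qed
  define \<epsilon>2 where "\<epsilon>2 = \<epsilon>1 / (4 * (real (card I) + 1))"
  have \<epsilon>2: "0 < \<epsilon>2" using \<epsilon>1 by (simp add: \<epsilon>2_def)

  define F where "F x = \<pi> (f0 x)" for x
  define F' where "F' x v = \<pi> (f0' x v)" for x v
  have linF': "linear (F' x)" for x
    unfolding F'_def[abs_def] using linear_compose[OF bounded_linear.linear[OF blinfun.bounded_linear_right] lin\<pi>]
    by (simp add: o_def)

  define model where "model i A k B \<longleftrightarrow> linear A \<and> m \<le> k \<and> 0 < B \<and> (\<forall>v. B * norm v \<le> norm (A v)) \<and>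
      (\<forall>v. norm ((A v, p k \<bullet> A v) - F' (fst i) v) \<le> 2 * \<eta>' * norm v) \<and>
      \<bar>p k \<bullet> fst (F (fst i)) + q k - snd (F (fst i))\<bar> \<le> \<eta>' * snd i \<and>
      measure lebesgue {x \<in> cball (fst i) ((1 - \<kappa>) * snd i).
        \<forall>j\<in>J k. \<not> near_grid k j (1 / (4 * CARD('n))) (fst (F (fst i)) + A (x - fst i))} < \<epsilon>2"
    for i and A :: "real ^ 'n \<Rightarrow> real ^ 'n" and k B
  have "\<exists>A k B. model i A k B" if i: "i \<in> I" for i
  proof -
    obtain A k B where "linear A" "m \<le> k" "0 < B" "\<And>v. B * norm v \<le> norm (A v)"
      "\<And>v. norm ((A v, p k \<bullet> A v) - F' (fst i) v) \<le> 2 * \<eta>' * norm v"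
      "\<bar>p k \<bullet> fst (F (fst i)) + q k - snd (F (fst i))\<bar> \<le> \<eta>' * snd i"
      "measure lebesgue {x \<in> cball (fst i) ((1 - \<kappa>) * snd i).
        \<forall>j\<in>J k. \<not> near_grid k j (1 / (4 * CARD('n))) (fst (F (fst i)) + A (x - fst i))} < \<epsilon>2"
      by (rule exists_affine_model[OF linF' \<eta>' Ir(1)[OF i] \<epsilon>2]) (rule that)
    then have "model i A k B" unfolding model_def by (intro conjI allI)
    then show ?thesis by blast
  qed
  then obtain A k B where model: "\<And>i. i \<in> I \<Longrightarrow> model i (A i) (k i) (B i)"
    by metis
  have A: "linear (A i)" and k: "m \<le> k i" and B: "0 < B i" "\<And>v. B i * norm v \<le> norm (A i v)"
    and AF: "\<And>v. norm ((A i v, p (k i) \<bullet> A i v) - F' (fst i) v) \<le> 2 * \<eta>' * norm v"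
    and at_c: "\<bar>p (k i) \<bullet> fst (F (fst i)) + q (k i) - snd (F (fst i))\<bar> \<le> \<eta>' * snd i"
    and small: "measure lebesgue {x \<in> cball (fst i) ((1 - \<kappa>) * snd i).
        \<forall>j\<in>J (k i). \<not> near_grid (k i) j (1 / (4 * CARD('n))) (fst (F (fst i)) + A i (x - fst i))} < \<epsilon>2"
    if "i \<in> I" for i
    using model[OF that] unfolding model_def by blast+

  define a where "a i x = fst (F (fst i)) + A i (x - fst i)" for i x
  define h where "h i x = (a i x, p (k i) \<bullet> a i x + q (k i))" for i x
  define H' where "H' i v = (A i v, p (k i) \<bullet> A i v)" for i v
  define w where "w i x = h i x - F x" for i x
  define w' where "w' i x v = H' i v - F' x v" for i x v
  define \<psi> where "\<psi> i = ball_cutoff s0 (fst i) (snd i)" for i :: "(real ^ 'n) \<times> real"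
  define \<psi>' where "\<psi>' i = ball_cutoff' s0 (fst i) (snd i)" for i :: "(real ^ 'n) \<times> real"
  have da: "(a i has_derivative A i) (at x within S)" if "i \<in> I" for i x S
  proof -
    have "(A i has_derivative A i) (at y within T)" for y T
      using A[OF that] by (simp add: linear_imp_has_derivative)
    from has_derivative_compose[OF has_derivative_diff[OF has_derivative_ident has_derivative_const] this]
    have "((\<lambda>x. A i (x - fst i)) has_derivative A i) (at x within S)" by simp
    from has_derivative_add[OF has_derivative_const this] show ?thesis
      unfolding a_def[abs_def] by simp
  qed
  have dh: "(h i has_derivative H' i) (at x within S)" if "i \<in> I" for i x S
    unfolding h_def[abs_def] H'_def[abs_def]
    using da[OF that] by (auto intro!: derivative_eq_intros)
  have dF: "(F has_derivative F' x) (at x within cube)" if "x \<in> cube" for x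
    unfolding F_def[abs_def] F'_def[abs_def] using f0'(1)[OF that]
    by (rule bounded_linear.has_derivative[OF \<pi>])
  have dw: "(w i has_derivative w' i x) (at x within cube)" if "i \<in> I" "x \<in> cube" for i x
    unfolding w_def[abs_def] w'_def[abs_def] by (intro has_derivative_diff dh dF that)
  have cut: "(\<psi> i has_derivative \<psi>' i x) (at x within S)" "continuous_on UNIV (\<lambda>x. \<psi>' i x v)"
    "x \<in> cball (fst i) ((1 - \<kappa>) * snd i) \<Longrightarrow> \<psi> i x = 1 \<and> \<psi>' i x v = 0"
    "x \<notin> ball (fst i) (snd i) \<Longrightarrow> \<psi> i x = 0 \<and> \<psi>' i x v = 0"
    "0 \<le> \<psi> i x" "\<psi> i x \<le> 1" "\<bar>\<psi>' i x v\<bar> \<le> C / snd i * norm v" if i: "i \<in> I" for i x v S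
    using ball_cutoff[OF \<kappa>(1,2) Ir(1)[OF i] s0_def, where c = "fst i"]
    unfolding \<psi>_def \<psi>'_def C_def by blast+

  \<comment> \<open>Twice \<open>\<eta>'\<close> comes from the affine model, once from the
    oscillation of the derivative over the ball.\<close>
  have w'_le: "norm (w' i x v) \<le> 3 * \<eta>' * norm v" if "i \<in> I" "x \<in> ball (fst i) (snd i)" for i x v
  proof -
    have x: "x \<in> cube" using that Ir(4) box_cube by blast
    have "dist x (fst i) < \<delta>0" using that Ir(2) by (simp add: dist_commute) (meson less_trans)
    then have "norm (f0' x - f0' (fst i)) < \<eta>' / K"
      using \<delta>0(2)[OF Ir(5)[OF that(1)] x] by (simp add: dist_norm)
    then have "norm ((f0' x - f0' (fst i)) v) \<le> \<eta>' / K * norm v"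
      using norm_blinfun[of "f0' x - f0' (fst i)" v] by (meson less_imp_le mult_right_mono norm_ge_zero order_trans)
    then have "norm ((f0' x - f0' (fst i)) v) * K \<le> \<eta>' / K * norm v * K"
      using K(1) by (intro mult_right_mono) auto
    moreover have "\<eta>' / K * norm v * K = \<eta>' * norm v"
      using K(1) by simp
    ultimately have "norm (F' x v - F' (fst i) v) \<le> \<eta>' * norm v"
      using K(2)[of "(f0' x - f0' (fst i)) v"]
      by (simp add: F'_def linear_diff[OF lin\<pi>, symmetric] minus_blinfun.rep_eq)
    moreover have "w' i x v = (H' i v - F' (fst i) v) - (F' x v - F' (fst i) v)"
      by (simp add: w'_def)
    ultimately show ?thesis
      using AF[OF that(1), of v] norm_triangle_ineq4[of "H' i v - F' (fst i) v" "F' x v - F' (fst i) v"]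
      by (simp add: H'_def)
  qed
  \<comment> \<open>At the centre the base points agree and the heights differ by at most
    \<open>\<eta>'\<close> times the radius; the mean value inequality adds three times as
    much.\<close>
  have w_le: "norm (w i x) \<le> 4 * \<eta>' * snd i" if "i \<in> I" "x \<in> ball (fst i) (snd i)" for i x
  proof -
    have sub: "ball (fst i) (snd i) \<subseteq> cube" using Ir(4)[OF that(1)] box_cube by blast
    have "norm (w i x - w i (fst i)) \<le> 3 * \<eta>' * norm (x - fst i)"
    proof (rule differentiable_bound[OF convex_ball])
      show "(w i has_derivative w' i y) (at y within ball (fst i) (snd i))" if "y \<in> ball (fst i) (snd i)" for y
        using dw[OF \<open>i \<in> I\<close>, of y] that sub by (blast intro: has_derivative_subset)
      show "onorm (w' i y) \<le> 3 * \<eta>'" if "y \<in> ball (fst i) (snd i)" for y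
        using w'_le[OF \<open>i \<in> I\<close> that] by (intro onorm_le) simp
    qed (use that Ir(1) in auto)
    also have "\<dots> \<le> 3 * \<eta>' * snd i"
      using that \<eta>' by (intro mult_left_mono) (auto simp: dist_norm norm_minus_commute)
    finally have "norm (w i x - w i (fst i)) \<le> 3 * \<eta>' * snd i" .
    moreover have "w i (fst i) = (0, p (k i) \<bullet> fst (F (fst i)) + q (k i) - snd (F (fst i)))"
      using linear_0[OF A[OF that(1)]] by (simp add: w_def h_def a_def prod_eq_iff)
    then have "norm (w i (fst i)) \<le> \<eta>' * snd i"
      using at_c[OF that(1)] by simp
    ultimately show ?thesis
      using norm_triangle_ineq[of "w i x - w i (fst i)" "w i (fst i)"] by simp
  qed

  \<comment> \<open>Because \<open>\<pi> (\<sigma> v) = v\<close>, the correction moves the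
    projection exactly onto \<open>h i x\<close> wherever the cutoff equals 1.\<close>
  define g1 where "g1 x = f0 x + (\<Sum>i\<in>I. \<psi> i x *\<^sub>R \<sigma> (w i x))" for x
  define G' where "G' x v = f0' x v + (\<Sum>i\<in>I. \<psi> i x *\<^sub>R \<sigma> (w' i x v) + \<psi>' i x v *\<^sub>R \<sigma> (w i x))" for x v
  define g where "g = restrict g1 cube"
  have dg1: "(g1 has_derivative G' x) (at x within cube)" if x: "x \<in> cube" for x
    unfolding g1_def[abs_def] G'_def[abs_def]
  proof (intro has_derivative_add has_derivative_sum f0'(1) x)
    fix i assume i: "i \<in> I"
    have "((\<lambda>x. \<sigma> (w i x)) has_derivative (\<lambda>v. \<sigma> (w' i x v))) (at x within cube)"
      by (rule bounded_linear.has_derivative[OF \<sigma> dw[OF i x]])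
    from has_derivative_scaleR[OF cut(1)[OF i] this]
    show "((\<lambda>x. \<psi> i x *\<^sub>R \<sigma> (w i x)) has_derivative
        (\<lambda>v. \<psi> i x *\<^sub>R \<sigma> (w' i x v) + \<psi>' i x v *\<^sub>R \<sigma> (w i x))) (at x within cube)" .
  qed
  have dg: "(g has_derivative G' x) (at x within cube)" if x: "x \<in> cube" for x
    using dg1[OF x] by (rule has_derivative_transform[OF x, rotated]) (simp add: g_def)
  have contG: "continuous_on cube (\<lambda>x. G' x v)" for v
  proof -
    have f0'c: "continuous_on cube (\<lambda>x. f0' x v)" by (intro continuous_intros f0'(2))
    have wc: "continuous_on cube (w i)" if "i \<in> I" for i
      using dw[OF that] by (rule has_derivative_continuous_on)
    have w'c: "continuous_on cube (\<lambda>x. w' i x v)" for i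
      unfolding w'_def F'_def
      by (intro continuous_on_diff continuous_on_const bounded_linear.continuous_on[OF \<pi>] f0'c)
    have \<psi>c: "continuous_on cube (\<psi> i)" if "i \<in> I" for i
      using cut(1)[OF that] by (rule has_derivative_continuous_on)
    have \<psi>'c: "continuous_on cube (\<lambda>x. \<psi>' i x v)" if "i \<in> I" for i
      using cut(2)[OF that] by (rule continuous_on_subset) simp
    show ?thesis
      unfolding G'_def
      by (intro continuous_on_add continuous_on_sum continuous_on_scaleR f0'c \<psi>c \<psi>'c
          bounded_linear.continuous_on[OF \<sigma>] wc w'c)
  qed
  have g: "g \<in> C1_surfaces"
    unfolding C1_surfaces_def using C1_on_cubeI[OF dg contG] by (simp add: g_def)
  have tdg: "total_deriv g x = G' x" if "x \<in> cube" for x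
    by (rule total_deriv_eq[OF dg[OF that] that])

  \<comment> \<open>The balls are disjoint, so at most one summand acts at a point and the estimates
    are independent of the number of balls.\<close>
  have single: "sum t I = t i" if i: "i \<in> I" "x \<in> ball (fst i) (snd i)"
    and t0: "\<And>j. j \<in> I \<Longrightarrow> x \<notin> ball (fst j) (snd j) \<Longrightarrow> t j = 0" for i x and t :: "(real ^ 'n) \<times> real \<Rightarrow> 'a"
  proof -
    have "t j = 0" if j: "j \<in> I - {i}" for j
    proof -
      have "disjnt (ball (fst i) (snd i)) (ball (fst j) (snd j))"
        by (rule pairwiseD[OF I(3) i(1)]) (use j in auto)
      then have "x \<notin> ball (fst j) (snd j)"
        using i(2) by (meson disjnt_iff)
      then show ?thesis using t0[of j] j by simp
    qed
    then have "sum t {i} = sum t I"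
      using I(1) i(1) by (intro sum.mono_neutral_left) auto
    then show ?thesis by simp
  qed
  have cut0: "\<psi> j x *\<^sub>R z + \<psi>' j x v *\<^sub>R z' = 0" "\<psi> j x *\<^sub>R z = 0" if "j \<in> I" "x \<notin> ball (fst j) (snd j)" for j x v and z z' :: 'a
    using cut(4)[OF that(1) that(2)] by auto

  have "C1_dist f0 g \<le> \<eta> / 2"
    unfolding C1_dist_le_iff[OF f0 g]
  proof (intro ballI conjI allI)
    fix x :: "real ^ 'n" and l assume x: "x \<in> cube"
    have gx: "g x = g1 x" using x by (simp add: g_def)
    have pd: "partial_deriv l f0 x = f0' x (axis l 1)" "partial_deriv l g x = G' x (axis l 1)"
      by (rule partial_deriv_eq[OF f0'(1)[OF x] x], rule partial_deriv_eq[OF dg[OF x] x])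
    have small1: "L * (4 * \<eta>') \<le> \<eta> / 2" and small2: "L * (\<eta>' * (3 + 4 * C)) \<le> \<eta> / 2"
      unfolding L\<eta>[symmetric] using L \<eta>' C by (auto intro!: mult_left_mono)
    show "norm (f0 x - g x) \<le> \<eta> / 2" "norm (partial_deriv l f0 x - partial_deriv l g x) \<le> \<eta> / 2"
    proof (atomize (full), cases "\<exists>i\<in>I. x \<in> ball (fst i) (snd i)")
      case False
      then have out: "x \<notin> ball (fst i) (snd i)" if "i \<in> I" for i
        using that by blast
      have "(\<Sum>i\<in>I. \<psi> i x *\<^sub>R \<sigma> (w i x)) = 0"
        by (intro sum.neutral ballI cut0(2) out; assumption)
      moreover have "(\<Sum>i\<in>I. \<psi> i x *\<^sub>R \<sigma> (w' i x v) + \<psi>' i x v *\<^sub>R \<sigma> (w i x)) = 0" for v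
        by (intro sum.neutral ballI cut0(1) out; assumption)
      ultimately show "norm (f0 x - g x) \<le> \<eta> / 2 \<and> norm (partial_deriv l f0 x - partial_deriv l g x) \<le> \<eta> / 2"
        using \<eta> by (simp add: gx g1_def pd G'_def)
    next
      case True
      then obtain i where i: "i \<in> I" "x \<in> ball (fst i) (snd i)" by blast
      have r: "0 < snd i" "snd i < 1" using Ir[OF i(1)] by auto
      have "(\<Sum>i\<in>I. \<psi> i x *\<^sub>R \<sigma> (w i x)) = \<psi> i x *\<^sub>R \<sigma> (w i x)"
        "(\<Sum>i\<in>I. \<psi> i x *\<^sub>R \<sigma> (w' i x v) + \<psi>' i x v *\<^sub>R \<sigma> (w i x)) = \<psi> i x *\<^sub>R \<sigma> (w' i x v) + \<psi>' i x v *\<^sub>R \<sigma> (w i x)" for v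
        by (rule single[OF i], rule cut0(2), assumption+, rule single[OF i], rule cut0(1), assumption+)
      then have "g x - f0 x = \<psi> i x *\<^sub>R \<sigma> (w i x)"
        "partial_deriv l g x - partial_deriv l f0 x =
           \<psi> i x *\<^sub>R \<sigma> (w' i x (axis l 1)) + \<psi>' i x (axis l 1) *\<^sub>R \<sigma> (w i x)"
        unfolding gx g1_def pd G'_def by simp_all
      then have eqs: "norm (f0 x - g x) = norm (\<psi> i x *\<^sub>R \<sigma> (w i x))"
        "norm (partial_deriv l f0 x - partial_deriv l g x) =
           norm (\<psi> i x *\<^sub>R \<sigma> (w' i x (axis l 1)) + \<psi>' i x (axis l 1) *\<^sub>R \<sigma> (w i x))"
        by (metis norm_minus_commute)+
      have \<sigma>w: "norm (\<sigma> (w i x)) \<le> 4 * \<eta>' * snd i * L"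
        by (rule order_trans[OF L(2) mult_right_mono[OF w_le[OF i]]]) (use L(1) in simp)
      have "norm (\<psi> i x *\<^sub>R \<sigma> (w i x)) \<le> 1 * (4 * \<eta>' * snd i * L)"
        unfolding norm_scaleR using cut(5,6)[OF i(1), of x] \<sigma>w by (intro mult_mono) auto
      also have "\<dots> \<le> L * (4 * \<eta>')"
      proof -
        have "snd i * (4 * \<eta>' * L) \<le> 1 * (4 * \<eta>' * L)"
          using r L(1) \<eta>' by (intro mult_right_mono) auto
        then show ?thesis by (simp only: mult_1_left mult_ac)
      qed
      finally have 1: "norm (\<psi> i x *\<^sub>R \<sigma> (w i x)) \<le> \<eta> / 2" using small1 by simp
      have "norm (w' i x (axis l 1)) \<le> 3 * \<eta>'"
        using w'_le[OF i, of "axis l 1"] by simp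
      then have "norm (\<sigma> (w' i x (axis l 1))) \<le> 3 * \<eta>' * L"
        by (intro order_trans[OF L(2) mult_right_mono]) (use L(1) in simp_all)
      then have "norm (\<psi> i x *\<^sub>R \<sigma> (w' i x (axis l 1))) \<le> 1 * (3 * \<eta>' * L)"
        unfolding norm_scaleR using cut(5,6)[OF i(1), of x] by (intro mult_mono) auto
      moreover have "norm (\<psi>' i x (axis l 1) *\<^sub>R \<sigma> (w i x)) \<le> C / snd i * (4 * \<eta>' * snd i * L)"
        unfolding norm_scaleR using cut(7)[OF i(1), of x "axis l 1"] \<sigma>w C r
        by (intro mult_mono) auto
      moreover have "C / snd i * (4 * \<eta>' * snd i * L) = C * (4 * \<eta>' * L)"
        using r by simp
      moreover have "L * (\<eta>' * (3 + 4 * C)) = 1 * (3 * \<eta>' * L) + C * (4 * \<eta>' * L)"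
        by (simp add: algebra_simps)
      ultimately have "norm (\<psi> i x *\<^sub>R \<sigma> (w' i x (axis l 1)) + \<psi>' i x (axis l 1) *\<^sub>R \<sigma> (w i x))
          \<le> L * (\<eta>' * (3 + 4 * C))"
        using norm_triangle_ineq[of "\<psi> i x *\<^sub>R \<sigma> (w' i x (axis l 1))" "\<psi>' i x (axis l 1) *\<^sub>R \<sigma> (w i x)"]
        by linarith
      then show "norm (f0 x - g x) \<le> \<eta> / 2 \<and> norm (partial_deriv l f0 x - partial_deriv l g x) \<le> \<eta> / 2"
        unfolding eqs using 1 small2 by linarith
    qed
  qed
  then have dist: "C1_dist f0 g < \<eta>" using \<eta> by simp

  define core where "core i = cball (fst i) ((1 - \<kappa>) * snd i)" for i :: "(real ^ 'n) \<times> real"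
  define T where "T i = {x \<in> core i. \<exists>j\<in>J (k i). near_grid (k i) j (1 / (4 * CARD('n))) (a i x)}" for i
  have core_ball: "core i \<subseteq> ball (fst i) (snd i)" if "i \<in> I" for i
  proof -
    have "(1 - \<kappa>) * snd i < 1 * snd i"
      using Ir(1)[OF that] \<kappa>(1) by (intro mult_strict_right_mono) auto
    then show ?thesis by (auto simp: core_def)
  qed
  have on_core: "\<pi> (g x) = h i x" "\<pi> (total_deriv g x v) = H' i v" if "i \<in> I" "x \<in> core i" for i x v
  proof -
    have xb: "x \<in> ball (fst i) (snd i)" using core_ball that by blast
    then have x: "x \<in> cube" using Ir(4)[OF that(1)] box_cube by blast
    have c: "\<psi> i x = 1" "\<psi>' i x v = 0" for v
      using cut(3)[OF that(1), of x] that(2) by (auto simp: core_def)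
    have "(\<Sum>i\<in>I. \<psi> i x *\<^sub>R \<sigma> (w i x)) = \<psi> i x *\<^sub>R \<sigma> (w i x)"
      "(\<Sum>i\<in>I. \<psi> i x *\<^sub>R \<sigma> (w' i x v) + \<psi>' i x v *\<^sub>R \<sigma> (w i x)) = \<psi> i x *\<^sub>R \<sigma> (w' i x v) + \<psi>' i x v *\<^sub>R \<sigma> (w i x)"
      by (rule single[OF that(1) xb], rule cut0(2), assumption+, rule single[OF that(1) xb], rule cut0(1), assumption+)
    then have "(\<Sum>i\<in>I. \<psi> i x *\<^sub>R \<sigma> (w i x)) = \<sigma> (w i x)"
      "(\<Sum>i\<in>I. \<psi> i x *\<^sub>R \<sigma> (w' i x v) + \<psi>' i x v *\<^sub>R \<sigma> (w i x)) = \<sigma> (w' i x v)"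
      by (simp_all add: c)
    note sums = this
    have "g x = f0 x + \<sigma> (w i x)"
      using sums x by (simp add: g_def g1_def)
    moreover have "total_deriv g x v = f0' x v + \<sigma> (w' i x v)"
      unfolding tdg[OF x] G'_def using sums by simp
    ultimately show "\<pi> (g x) = h i x" "\<pi> (total_deriv g x v) = H' i v"
      by (simp_all only: linear_add[OF lin\<pi>] \<pi>\<sigma>) (simp_all add: w_def w'_def F_def F'_def)
  qed
  have "\<exists>s. 0 < s \<and> (\<forall>f\<in>C1_surfaces. C1_dist g f < s \<longrightarrow> T i \<subseteq> good \<pi> m f)" if i: "i \<in> I" for i
  proof -
    obtain s where s: "0 < s" "\<forall>f\<in>C1_surfaces. \<forall>g\<in>C1_surfaces. \<forall>x.
        C1_dist g f < s \<longrightarrow> affine_at \<pi> (k i) (B i) g x \<longrightarrow> x \<in> good \<pi> m f"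
      using good_stable[OF \<pi> k[OF i] B(1)[OF i]] by blast
    have "affine_at \<pi> (k i) (B i) g x" if x: "x \<in> T i" for x
    proof -
      have xc: "x \<in> core i" using x by (simp add: T_def)
      then have "x \<in> box 0 1" using core_ball[OF i] Ir(4)[OF i] by blast
      then show ?thesis
        using x B(2)[OF i] unfolding affine_at_def by (simp add: on_core[OF i xc] h_def H'_def T_def)
    qed
    then have "\<forall>f\<in>C1_surfaces. C1_dist g f < s \<longrightarrow> T i \<subseteq> good \<pi> m f"
      using s(2) g by blast
    then show ?thesis using s(1) by blast
  qed
  then obtain s where s: "\<And>i. i \<in> I \<Longrightarrow> 0 < s i"
    "\<And>i f. i \<in> I \<Longrightarrow> f \<in> C1_surfaces \<Longrightarrow> C1_dist g f < s i \<Longrightarrow> T i \<subseteq> good \<pi> m f"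
    by metis
  define s_min where "s_min = Min (insert 1 (s ` I))"
  have smin: "0 < s_min" "\<And>i. i \<in> I \<Longrightarrow> s_min \<le> s i"
    unfolding s_min_def using I(1) s(1) by auto

  have Tm: "T i \<in> lmeasurable" and Tlow: "(1 - \<kappa>) ^ n * measure lebesgue (ball (fst i) (snd i)) - \<epsilon>2 \<le> measure lebesgue (T i)"
    if i: "i \<in> I" for i
  proof -
    have "continuous_on UNIV (a i)"
      using da[OF i] by (rule has_derivative_continuous_on)
    moreover have "open (\<Union>j\<in>J (k i). {y :: real ^ 'n. near_grid (k i) j (1 / (4 * CARD('n))) y})"
      by (intro open_UN ballI open_near_grid)
    ultimately have "open (a i -` (\<Union>j\<in>J (k i). {y. near_grid (k i) j (1 / (4 * CARD('n))) y}))"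
      by (simp add: open_vimage)
    then have m: "a i -` (\<Union>j\<in>J (k i). {y. near_grid (k i) j (1 / (4 * CARD('n))) y}) \<in> sets lebesgue"
      by (intro sets_completionI_sets) simp
    have core: "core i \<in> lmeasurable" by (simp add: core_def)
    have Teq: "T i = core i \<inter> a i -` (\<Union>j\<in>J (k i). {y. near_grid (k i) j (1 / (4 * CARD('n))) y})"
      by (auto simp: T_def)
    show Tm: "T i \<in> lmeasurable"
      unfolding Teq using core m by (rule fmeasurable_Int_fmeasurable)
    have "measure lebesgue (core i - T i) = measure lebesgue (core i) - measure lebesgue (T i)"
      using core Tm by (intro measurable_measure_Diff) (auto simp: T_def intro: fmeasurableD)
    moreover have "core i - T i = {x \<in> cball (fst i) ((1 - \<kappa>) * snd i).
        \<forall>j\<in>J (k i). \<not> near_grid (k i) j (1 / (4 * CARD('n))) (fst (F (fst i)) + A i (x - fst i))}"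
      by (auto simp: T_def core_def a_def)
    then have "measure lebesgue (core i - T i) < \<epsilon>2" using small[OF i] by simp
    moreover have "measure lebesgue (core i) = (1 - \<kappa>) ^ n * measure lebesgue (ball (fst i) (snd i))"
      using Ir(1)[OF i] \<kappa>(2) by (simp add: core_def content_ball content_cball power_mult_distrib n_def)
    ultimately show "(1 - \<kappa>) ^ n * measure lebesgue (ball (fst i) (snd i)) - \<epsilon>2 \<le> measure lebesgue (T i)"
      by linarith
  qed
  have Tball: "T i \<subseteq> ball (fst i) (snd i)" if "i \<in> I" for i
    using core_ball[OF that] by (auto simp: T_def)
  show ?thesis
  proof (rule that[OF g dist smin(1)])
    show TI: "(\<Union>i\<in>I. T i) \<in> lmeasurable"
      using I(1) Tm by (intro fmeasurable.finite_UN) auto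
    show Tbox: "(\<Union>i\<in>I. T i) \<subseteq> box 0 1"
      using Tball Ir(4) by blast
    show "(\<Union>i\<in>I. T i) \<subseteq> good \<pi> m f" if "f \<in> C1_surfaces" "C1_dist g f < s_min" for f
      using s(2)[OF _ that(1)] that(2) smin(2) by (meson UN_least order_less_le_trans)
    have one: "measure lebesgue (box 0 1 :: (real ^ 'n) set) = 1"
      by (subst measure_box_cart(1)) auto
    have "measure lebesgue (\<Union>i\<in>I. ball (fst i) (snd i)) = (\<Sum>i\<in>I. measure lebesgue (ball (fst i) (snd i)))"
      by (rule measure_UNION'[OF I(1) _ I(3)]) auto
    then have balls: "1 - \<epsilon>1 / 4 < (\<Sum>i\<in>I. measure lebesgue (ball (fst i) (snd i)))"
      using I(4) one by simp
    have "real (card I) * \<epsilon>2 \<le> \<epsilon>1 / 4"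
      using \<epsilon>1(1) by (simp add: \<epsilon>2_def field_simps)
    moreover have "(1 - \<epsilon>1 / 4) * (1 - \<epsilon>1 / 4) \<le> (1 - \<kappa>) ^ n * (\<Sum>i\<in>I. measure lebesgue (ball (fst i) (snd i)))"
      using bernoulli balls \<epsilon>1 \<kappa>(2) by (intro mult_mono) auto
    moreover have "1 - \<epsilon>1 / 2 \<le> (1 - \<epsilon>1 / 4) * (1 - \<epsilon>1 / 4)"
      using zero_le_square[of "\<epsilon>1 / 4"] by (simp add: algebra_simps)
    ultimately have "1 - 3 * \<epsilon>1 / 4 \<le> (1 - \<kappa>) ^ n * (\<Sum>i\<in>I. measure lebesgue (ball (fst i) (snd i))) - real (card I) * \<epsilon>2"
      by linarith
    also have "\<dots> = (\<Sum>i\<in>I. (1 - \<kappa>) ^ n * measure lebesgue (ball (fst i) (snd i)) - \<epsilon>2)"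
      by (simp add: sum_subtractf sum_distrib_left)
    also have "\<dots> \<le> (\<Sum>i\<in>I. measure lebesgue (T i))"
      by (intro sum_mono Tlow)
    also have "\<dots> = measure lebesgue (\<Union>i\<in>I. T i)"
    proof (rule measure_UNION'[OF I(1) Tm, symmetric])
      show "pairwise (\<lambda>i j. disjnt (T i) (T j)) I"
        using I(3) Tball unfolding pairwise_def by (meson disjnt_subset1 disjnt_subset2)
    qed
    finally have "1 - 3 * \<epsilon>1 / 4 \<le> measure lebesgue (\<Union>i\<in>I. T i)" .
    moreover have "measure lebesgue (box 0 1 - (\<Union>i\<in>I. T i)) = 1 - measure lebesgue (\<Union>i\<in>I. T i)"
      using TI Tbox one by (subst measurable_measure_Diff) (auto intro: fmeasurableD)
    ultimately show "measure lebesgue (box 0 1 - (\<Union>i\<in>I. T i)) < \<epsilon>"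
      using \<epsilon>1 by linarith
  qed
qed

end

section \<open>The decomposition\<close>

context hole_scheme
begin

text \<open>Porosity asks for one constant for the whole set, and the size of the balls that fit
  into the holes depends on the slope; hence the bound \<open>\<Lambda>\<close>. Countably many
  pairs \<open>(m, \<Lambda>)\<close> exhaust the points of interest.\<close>

definition porous_part :: "('a::real_normed_vector \<Rightarrow> (real ^ 'n) \<times> real) \<Rightarrow> nat \<Rightarrow> nat \<Rightarrow> 'a set" where
  "porous_part \<pi> m \<Lambda> = {x. (\<forall>k\<ge>m. \<pi> x \<notin> H k) \<and>
     (\<exists>\<^sub>\<infinity>k. norm (p k) \<le> \<Lambda> \<and> \<pi> x \<in> rim (p k) (q k) k (J k))}"

text \<open>Above a point of the rim at distance \<open>4 / 2 ^ j\<close> there is a ball of comparable radius in the hole.\<close>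
lemma directionally_porous_part:
  assumes \<pi>: "bounded_linear \<pi>" and \<sigma>: "\<And>v. \<pi> (\<sigma> v) = v"
  shows "directionally_porous (porous_part \<pi> m \<Lambda>)"
proof -
  define n where "n = real CARD('n)"
  have n: "1 \<le> n" by (simp add: n_def)
  note lin = bounded_linear.linear[OF \<pi>]
  \<comment> \<open>One direction serves all points: the lift of the vertical axis.\<close>
  define e where "e = \<sigma> (0, 1)"
  have "\<pi> e \<noteq> 0" unfolding e_def \<sigma> by (simp add: zero_prod_def)
  then have e: "0 < norm e" using linear_0[OF lin] by auto
  obtain K where K: "0 < K" "\<And>v. norm (\<pi> v) \<le> norm v * K"
    using bounded_linear.pos_bounded[OF \<pi>] by blast
  \<comment> \<open>With \<open>h = 2 ^ (- j)\<close>, a displacement of size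
    \<open>\<theta> h\<close> in the projection changes base coordinates by at most
    \<open>h / (2 n)\<close> and \<open>2 ^ j * offset\<close> by at most \<open>1 / 4\<close>;
    these are the differences between the tolerances of rim and hole.\<close>
  define \<theta> where "\<theta> = 1 / (4 * n * (1 + real \<Lambda>))"
  have \<theta>: "0 < \<theta>" using n by (simp add: \<theta>_def)
  have \<theta>1: "(1 + real \<Lambda>) * \<theta> \<le> 1 / 4" and \<theta>2: "\<theta> \<le> 1 / (2 * n)"
  proof -
    have P: "0 < 1 + real \<Lambda>" by simp
    then have "(1 + real \<Lambda>) * \<theta> = 1 / (4 * n)"
      by (simp only: \<theta>_def times_divide_eq_right mult_1_right) simp
    also have "\<dots> \<le> 1 / 4" using n by (intro divide_left_mono) auto
    finally show "(1 + real \<Lambda>) * \<theta> \<le> 1 / 4" .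
    have "n * 1 \<le> n * (1 + real \<Lambda>)" using n by (intro mult_left_mono) auto
    then show "\<theta> \<le> 1 / (2 * n)"
      unfolding \<theta>_def using n by (intro divide_left_mono mult_pos_pos) auto
  qed
  define \<rho> where "\<rho> = min (1 / 2) (\<theta> / (4 * K * norm e))"
  have \<rho>: "0 < \<rho>" "\<rho> < 1" using \<theta> K(1) e by (auto simp: \<rho>_def)
  have \<rho>K: "\<rho> * (4 * norm e) * K \<le> \<theta>"
  proof -
    have "\<rho> \<le> \<theta> / (4 * K * norm e)" by (simp add: \<rho>_def)
    then show ?thesis using K(1) e by (simp add: pos_le_divide_eq mult_ac)
  qed
  show ?thesis
    unfolding directionally_porous_def
  proof (rule exI[of _ \<rho>], intro conjI \<rho> ballI, rule exI[of _ "e /\<^sub>R norm e"], intro conjI allI impI)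
    fix x assume x: "x \<in> porous_part \<pi> m \<Lambda>"
    show "norm (e /\<^sub>R norm e) = 1" using e by simp
    fix \<delta> :: real assume \<delta>: "0 < \<delta>"
    obtain k0 where k0: "(1 / 2 :: real) ^ k0 < \<delta> / (4 * norm e)"
      using real_arch_pow_inv[of "\<delta> / (4 * norm e)" "1 / 2"] \<delta> e by auto
    obtain k where k: "max m k0 \<le> k" "norm (p k) \<le> \<Lambda>" "\<pi> x \<in> rim (p k) (q k) k (J k)"
      using x unfolding porous_part_def INFM_nat_le by blast
    then obtain j where j: "j \<in> J k" "near_grid k j (1 / (2 * CARD('n))) (fst (\<pi> x))"
      "\<bar>2 ^ j * offset (p k) (q k) (\<pi> x)\<bar> < 1 / 4"
      unfolding rim_def by blast
    define h :: real where "h = (1 / 2) ^ j"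
    have h: "0 < h" "2 ^ j * h = 1" by (simp_all add: h_def power_mult_distrib[symmetric])
    have "h \<le> (1 / 2) ^ k0"
      unfolding h_def using J_ge[OF j(1)] k(1) by (intro power_decreasing) auto
    then have "h < \<delta> / (4 * norm e)" using k0 by linarith
    moreover have "0 < 4 * norm e" using e by simp
    ultimately have "h * (4 * norm e) < \<delta>" by (simp only: pos_less_divide_eq)
    then have small: "4 * h * norm e < \<delta>" by (simp add: mult_ac)
    define t where "t = 4 * h * norm e"
    have t: "0 < t" "t < \<delta>" using h e small by (auto simp: t_def)
    have te: "t *\<^sub>R (e /\<^sub>R norm e) = (4 * h) *\<^sub>R e"
      using e by (simp add: t_def)
    show "\<exists>t. 0 < \<bar>t\<bar> \<and> \<bar>t\<bar> < \<delta> \<and> ball (x + t *\<^sub>R (e /\<^sub>R norm e)) (\<rho> * \<bar>t\<bar>) \<inter> porous_part \<pi> m \<Lambda> = {}"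
    proof (intro exI[of _ t] conjI)
      show "0 < \<bar>t\<bar>" "\<bar>t\<bar> < \<delta>" using t by auto
      have "\<pi> y \<in> H k" if y: "y \<in> ball (x + t *\<^sub>R (e /\<^sub>R norm e)) (\<rho> * \<bar>t\<bar>)" for y
      proof -
        define d where "d = \<pi> (y - (x + (4 * h) *\<^sub>R e))"
        have "norm (y - (x + (4 * h) *\<^sub>R e)) \<le> \<rho> * t"
          using y t unfolding te by (simp add: dist_norm norm_minus_commute)
        then have "norm (y - (x + (4 * h) *\<^sub>R e)) * K \<le> \<rho> * t * K"
          using K(1) by (intro mult_right_mono) auto
        also have "\<dots> = \<rho> * (4 * norm e) * K * h" by (simp add: t_def)
        also have "\<dots> \<le> \<theta> * h" using \<rho>K h by (intro mult_right_mono) auto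
        finally have d: "norm d \<le> \<theta> * h"
          unfolding d_def by (rule order_trans[OF K(2)])
        have \<pi>y: "\<pi> y = \<pi> x + (0, 4 * h) + d"
        proof -
          have "\<pi> ((4 * h) *\<^sub>R e) = (0, 4 * h)"
            by (simp add: linear_scale[OF lin] e_def \<sigma>)
          then show ?thesis by (simp add: d_def linear_diff[OF lin] linear_add[OF lin])
        qed
        have nf: "norm (fst d) \<le> norm d" "\<bar>snd d\<bar> \<le> norm d"
          using norm_fst_le[of "fst d" "snd d"] norm_snd_le[of "snd d" "fst d"] by simp_all
        have "\<bar>fst (\<pi> y) $ i - fst (\<pi> x) $ i\<bar> \<le> 1 / (2 * n) / 2 ^ j" for i
        proof -
          have "\<bar>fst d $ i\<bar> \<le> \<theta> * h"
            using component_le_norm_cart[of "fst d" i] nf(1) d by linarith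
          also have "\<dots> \<le> 1 / (2 * n) * h" using \<theta>2 h by (intro mult_right_mono) auto
          finally show ?thesis by (simp add: \<pi>y h_def power_divide)
        qed
        from near_grid_perturb[OF j(2) this]
        have "near_grid k j (1 / CARD('n)) (fst (\<pi> y))"
          by (simp add: n_def)
        moreover have "\<bar>2 ^ j * offset (p k) (q k) (\<pi> y) - 4\<bar> < 1 / 2"
        proof -
          have "2 ^ j * offset (p k) (q k) (\<pi> y) - 4
              = 2 ^ j * offset (p k) (q k) (\<pi> x) + 2 ^ j * (snd d - p k \<bullet> fst d)"
            using h(2) by (simp add: \<pi>y offset_def inner_add_right algebra_simps)
          moreover have "\<bar>snd d - p k \<bullet> fst d\<bar> \<le> 1 / 4 * h"
          proof -
            have "\<bar>p k \<bullet> fst d\<bar> \<le> real \<Lambda> * norm d"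
              using Cauchy_Schwarz_ineq2[of "p k" "fst d"] k(2) nf(1)
              by (meson mult_mono norm_ge_zero of_nat_0_le_iff order_trans)
            then have "\<bar>snd d - p k \<bullet> fst d\<bar> \<le> (1 + real \<Lambda>) * norm d"
              using nf(2) by (simp add: distrib_right)
            also have "\<dots> \<le> (1 + real \<Lambda>) * (\<theta> * h)" using d by (intro mult_left_mono) auto
            also have "\<dots> \<le> 1 / 4 * h"
              using mult_right_mono[OF \<theta>1, of h] h(1) by (simp only: mult.assoc)
            finally show ?thesis .
          qed
          then have "2 ^ j * \<bar>snd d - p k \<bullet> fst d\<bar> \<le> 2 ^ j * (1 / 4 * h)"
            by (intro mult_left_mono) auto
          then have "\<bar>2 ^ j * (snd d - p k \<bullet> fst d)\<bar> \<le> 1 / 4"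
            using h(2) by (simp add: abs_mult)
          ultimately show ?thesis using j(3) by linarith
        qed
        ultimately show ?thesis
          unfolding H_def hole_def using j(1) by blast
      qed
      then show "ball (x + t *\<^sub>R (e /\<^sub>R norm e)) (\<rho> * \<bar>t\<bar>) \<inter> porous_part \<pi> m \<Lambda> = {}"
        using k(1) unfolding porous_part_def by auto
    qed
  qed
qed

text \<open>If \<open>p k\<close> is the base part of the projected derivative in direction
  \<open>v\<close>, the slope clause gives \<open>\<bar>p k\<bar>\<^sup>2 \<le> (C + 1)
  \<bar>v\<bar> \<le> (C + 1) \<bar>p k\<bar> / B\<close>. Here \<open>B\<close> and
  \<open>C\<close> depend on the point but not on \<open>k\<close>.\<close>

lemma good_slopes_bounded:
  fixes \<pi> :: "'a::real_normed_vector \<Rightarrow> (real ^ 'n) \<times> real"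
  assumes \<pi>: "bounded_linear \<pi>" and x: "\<And>m. x \<in> good \<pi> m f"
  obtains \<Lambda> :: nat where "\<exists>\<^sub>\<infinity>k. norm (p k) \<le> \<Lambda> \<and> \<pi> (f x) \<in> rim (p k) (q k) k (J k)"
proof -
  have lintd: "linear (total_deriv f x)"
    by (rule linearI) (simp_all add: total_deriv_def scaleR_add_left sum.distrib scaleR_sum_right)
  then have lin: "linear (\<lambda>v. \<pi> (total_deriv f x v))"
    using linear_compose[OF _ bounded_linear.linear[OF \<pi>]] by (simp add: o_def)
  have lin1: "linear (\<lambda>v. fst (\<pi> (total_deriv f x v)))"
    using linear_compose[OF lin bounded_linear.linear[OF bounded_linear_fst]] by (simp add: o_def)
  obtain B where B: "0 < B" "\<And>v. B * norm v \<le> norm (fst (\<pi> (total_deriv f x v)))"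
    using x[of 0] unfolding good_def nondegenerate_def by blast
  have "inj (\<lambda>v. fst (\<pi> (total_deriv f x v)))"
  proof (subst linear_injective_0[OF lin1], intro allI impI)
    fix v assume "fst (\<pi> (total_deriv f x v)) = 0"
    then have "B * norm v \<le> 0" using B(2)[of v] by simp
    then show "v = 0" using B(1) by (simp add: mult_le_0_iff)
  qed
  then have surj: "surj (\<lambda>v. fst (\<pi> (total_deriv f x v)))"
    using linear_injective_imp_surjective[OF lin1] by simp
  obtain C where C: "0 < C" "\<And>v. norm (\<pi> (total_deriv f x v)) \<le> norm v * C"
    using bounded_linear.pos_bounded lin linear_conv_bounded_linear by blast
  define \<Lambda> where "\<Lambda> = nat \<lceil>(C + 1) / B\<rceil>"
  have bound: "norm (p k) \<le> \<Lambda>"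
    if slope: "\<And>v. \<bar>snd (\<pi> (total_deriv f x v)) - p k \<bullet> fst (\<pi> (total_deriv f x v))\<bar> \<le> norm v" for k
  proof (cases "p k = 0")
    case False
    obtain v where v: "p k = fst (\<pi> (total_deriv f x v))"
      using surjD[OF surj, of "p k"] by blast
    have "\<bar>snd (\<pi> (total_deriv f x v))\<bar> \<le> norm v * C"
      using C(2)[of v] norm_snd_le[of "snd (\<pi> (total_deriv f x v))" "fst (\<pi> (total_deriv f x v))"] by simp
    then have "p k \<bullet> p k \<le> norm v * (C + 1)"
      using slope[of v] unfolding v[symmetric] by (simp add: algebra_simps)
    then have "B * (norm (p k) * norm (p k)) \<le> B * norm v * (C + 1)"
      using B(1) by (simp add: power2_norm_eq_inner[symmetric] power2_eq_square)
    also have "\<dots> \<le> norm (p k) * (C + 1)"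
      using B(2)[of v] C(1) unfolding v[symmetric] by (intro mult_right_mono) auto
    finally have "norm (p k) * (B * norm (p k)) \<le> norm (p k) * (C + 1)"
      by (simp add: mult_ac)
    then have "B * norm (p k) \<le> C + 1"
      using False by simp
    then have "norm (p k) \<le> (C + 1) / B"
      using B(1) by (simp add: pos_le_divide_eq mult.commute)
    then show ?thesis unfolding \<Lambda>_def by linarith
  qed simp
  show ?thesis
  proof (rule that[of \<Lambda>])
    show "\<exists>\<^sub>\<infinity>k. norm (p k) \<le> \<Lambda> \<and> \<pi> (f x) \<in> rim (p k) (q k) k (J k)"
      unfolding INFM_nat_le
    proof
      fix m
      obtain k where k: "m \<le> k" "\<pi> (f x) \<in> rim (p k) (q k) k (J k)"
        "\<And>v. \<bar>snd (\<pi> (total_deriv f x v)) - p k \<bullet> fst (\<pi> (total_deriv f x v))\<bar> \<le> norm v"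
        using x[of m] unfolding good_def by blast
      then show "\<exists>k\<ge>m. norm (p k) \<le> \<Lambda> \<and> \<pi> (f x) \<in> rim (p k) (q k) k (J k)"
        using bound[OF k(3)] by blast
    qed
  qed
qed

end

lemma nowhere_dense_in_C1I:
  fixes S :: "(real ^ 'n::finite \<Rightarrow> 'a::real_normed_vector) set"
  assumes S: "S \<subseteq> C1_surfaces"
    and avoid: "\<And>f \<eta>. f \<in> C1_surfaces \<Longrightarrow> 0 < \<eta> \<Longrightarrow> \<exists>g s. g \<in> C1_surfaces \<and> C1_dist f g < \<eta> \<and> 0 < s \<and>
      (\<forall>h\<in>S. \<not> C1_dist g h < s)"
  shows "nowhere_dense_in C1_topology S"
proof -
  interpret M: Metric_space "C1_surfaces :: (real ^ 'n \<Rightarrow> 'a) set" C1_dist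
    by (rule Metric_space_C1)
  have "f \<notin> C1_topology interior_of (C1_topology closure_of S)" for f
  proof
    assume f: "f \<in> C1_topology interior_of (C1_topology closure_of S)"
    define U where "U = C1_topology interior_of (C1_topology closure_of S)"
    have "openin M.mtopology U" by (simp add: U_def C1_topology_def)
    then obtain \<eta> where \<eta>: "f \<in> C1_surfaces" "0 < \<eta>" "M.mball f \<eta> \<subseteq> U"
      using f unfolding M.openin_mtopology U_def by blast
    obtain g s where g: "g \<in> C1_surfaces" "C1_dist f g < \<eta>" "0 < s" "\<forall>h\<in>S. \<not> C1_dist g h < s"
      using avoid[OF \<eta>(1,2)] by blast
    have "g \<in> U" using \<eta> g(1,2) by (auto simp: M.mball_def)
    then have "g \<in> C1_topology closure_of S"
      unfolding U_def by (rule subsetD[OF interior_of_subset])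
    moreover have "openin C1_topology (M.mball g s)" by (simp add: C1_topology_def)
    moreover have "g \<in> M.mball g s" using g by simp
    ultimately obtain h where "h \<in> S" "h \<in> M.mball g s"
      unfolding in_closure_of by blast
    then show False using g(4) by (auto simp: M.mball_def)
  qed
  then show ?thesis
    unfolding nowhere_dense_in_def using S by (auto simp: C1_topology_def)
qed

text \<open>The parameters that may fail form a null set: the boundary of the cube, points that are
  not good for some \<open>m\<close>, and nondegenerate points over which infinitely many holes are
  met. The Lipschitz map \<open>f\<close> sends this set to one of measure zero.\<close>

lemma (in hole_scheme) surface_mostly_porous:
  fixes f :: "real ^ 'n \<Rightarrow> 'a::real_normed_vector"
  assumes \<pi>: "bounded_linear \<pi>" and f: "f \<in> C1_surfaces"
    and good: "\<And>m \<epsilon>. 0 < \<epsilon> \<Longrightarrow> \<exists>T\<in>lmeasurable. T \<subseteq> good \<pi> m f \<and> measure lebesgue (box 0 1 - T) < \<epsilon>"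
  shows "hausdorff_measure CARD('n) (f ` cube - (\<Union>m \<Lambda>. porous_part \<pi> m \<Lambda>)) = 0"
proof -
  have C1: "C1_on_cube f" using f by (simp add: C1_surfaces_def)
  define Z1 where "Z1 = {x \<in> box 0 1. nondegenerate \<pi> f x \<and> (\<exists>\<^sub>\<infinity>k. \<pi> (f x) \<in> H k)}"
  define Z where "Z = (cube - box 0 1) \<union> (\<Union>m. box 0 1 - good \<pi> m f) \<union> Z1"
  have "negligible (cube - box 0 1 :: (real ^ 'n) set)"
    unfolding cube_eq_cbox by (rule negligible_frontier_interval)
  moreover have "negligible (box 0 1 - good \<pi> m f)" for m
    unfolding negligible_outer
  proof (intro allI impI)
    fix \<epsilon> :: real assume "0 < \<epsilon>"
    then obtain T where "T \<in> lmeasurable" "T \<subseteq> good \<pi> m f" "measure lebesgue (box 0 1 - T) < \<epsilon>"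
      using good by blast
    then show "\<exists>T. box 0 1 - good \<pi> m f \<subseteq> T \<and> T \<in> lmeasurable \<and> measure lebesgue T < \<epsilon>"
      by (intro exI[of _ "box 0 1 - T"]) (auto intro: fmeasurable.Diff)
  qed
  moreover have "negligible Z1"
    unfolding Z1_def by (rule surface_hits_finitely_many_holes[OF \<pi> C1])
  ultimately have "negligible Z"
    unfolding Z_def by (intro negligible_Un negligible_countable_Union) auto
  moreover have "Z \<subseteq> cube"
  proof -
    have "box 0 1 \<subseteq> (cube :: (real ^ 'n) set)" by (simp add: cube_eq_cbox box_subset_cbox)
    then show ?thesis unfolding Z_def Z1_def by blast
  qed
  moreover have "f ` cube - (\<Union>m \<Lambda>. porous_part \<pi> m \<Lambda>) \<subseteq> f ` Z"
  proof
    fix y assume y: "y \<in> f ` cube - (\<Union>m \<Lambda>. porous_part \<pi> m \<Lambda>)"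
    then obtain x where x: "x \<in> cube" "y = f x" by blast
    have "x \<in> Z"
    proof (rule ccontr)
      assume xZ: "x \<notin> Z"
      then have xb: "x \<in> box 0 1" and xg: "\<And>m. x \<in> good \<pi> m f" and "x \<notin> Z1"
        using x(1) unfolding Z_def by blast+
      moreover have "nondegenerate \<pi> f x" using xg[of 0] by (simp add: good_def)
      ultimately have "\<not> (\<exists>\<^sub>\<infinity>k. \<pi> (f x) \<in> H k)" unfolding Z1_def by blast
      then obtain m where m: "\<forall>k\<ge>m. \<pi> (f x) \<notin> H k"
        unfolding INFM_nat_le by blast
      obtain \<Lambda> :: nat where "\<exists>\<^sub>\<infinity>k. norm (p k) \<le> \<Lambda> \<and> \<pi> (f x) \<in> rim (p k) (q k) k (J k)"
        using good_slopes_bounded[OF \<pi> xg] by blast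
      then have "y \<in> porous_part \<pi> m \<Lambda>"
        using m unfolding porous_part_def x(2) by blast
      then show False using y by blast
    qed
    then show "y \<in> f ` Z" using x(2) by blast
  qed
  ultimately show ?thesis
    using C1_on_cube_lipschitz[OF C1] hausdorff_measure_lipschitz_image_null by metis
qed

text \<open>The dimension hypothesis is guarded because \<open>dim\<close> takes the value 0 on an
  infinite-dimensional space.\<close>

theorem theorem1p5:
  assumes "separable_space (euclidean :: 'a::banach topology)"
    and "2 < CARD('n::finite)"
    and "(\<exists>B :: 'a set. finite B \<and> span B = UNIV) \<longrightarrow> CARD('n) < dim (UNIV :: 'a set)"
  shows "\<exists>Q N :: 'a set. sigma_directionally_porous Q \<and> Gamma_null TYPE('n) N \<and> UNIV = Q \<union> N"
proof -
  have "span B \<noteq> UNIV" if "finite B" "card B \<le> CARD('n)" for B :: "'a set"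
  proof
    assume "span B = UNIV"
    then have "CARD('n) < dim (span B)" using assms(3) that(1) by auto
    also have "\<dots> \<le> card B" using dim_le_card'[OF that(1)] by simp
    finally show False using that(2) by simp
  qed
  then obtain \<pi> :: "'a \<Rightarrow> (real ^ 'n) \<times> real" and \<sigma>
    where \<pi>: "bounded_linear \<pi>" and \<sigma>: "bounded_linear \<sigma>" and \<pi>\<sigma>: "\<And>v. \<pi> (\<sigma> v) = v"
    using exists_projection[where 'a = 'a and 'n = 'n] by metis
  obtain p :: "nat \<Rightarrow> real ^ 'n" and q J where "hole_scheme p q J"
    using exists_hole_scheme[OF assms(2)] by blast
  then interpret hole_scheme p q J .
  define Q where "Q = (\<Union>m \<Lambda>. porous_part \<pi> m \<Lambda>)"
  have "sigma_directionally_porous Q"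
    unfolding sigma_directionally_porous_def
  proof (intro exI conjI ballI)
    show "countable (range (\<lambda>(m, \<Lambda>). porous_part \<pi> m \<Lambda>))" by simp
    show "directionally_porous P" if "P \<in> range (\<lambda>(m, \<Lambda>). porous_part \<pi> m \<Lambda>)" for P
      using that directionally_porous_part[OF \<pi> \<pi>\<sigma>] by auto
    show "Q = \<Union>(range (\<lambda>(m, \<Lambda>). porous_part \<pi> m \<Lambda>))" by (auto simp: Q_def)
  qed
  moreover have "Gamma_null TYPE('n) (- Q)"
  proof -
    define C where "C = (C1_surfaces :: (real ^ 'n \<Rightarrow> 'a) set)"
    define R where "R = {f \<in> C. hausdorff_measure CARD('n) (f ` cube \<inter> - Q) = 0}"
    \<comment> \<open>Restricting to \<open>C - R\<close> makes the union of the sets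
      \<open>A m i\<close> equal to the exceptional set, as \<open>meager_in\<close> demands an
      exact union. Near every surface, \<open>perturb_to_good\<close> provides a ball that misses
      \<open>A m i\<close>.\<close>
    define A where "A m i = {f \<in> C - R. \<not> (\<exists>T\<in>lmeasurable. T \<subseteq> good \<pi> m f \<and>
      measure lebesgue (box 0 1 - T) < 1 / real (Suc i))}" for m i
    interpret M: Metric_space C C1_dist
      unfolding C_def by (rule Metric_space_C1)
    have top: "topspace C1_topology = C" by (simp add: C1_topology_def C_def[symmetric])
    have nd: "nowhere_dense_in C1_topology (A m i)" for m i
    proof (rule nowhere_dense_in_C1I)
      show "A m i \<subseteq> C1_surfaces" by (auto simp: A_def C_def)
      fix f :: "real ^ 'n \<Rightarrow> 'a" and \<eta> :: real assume f: "f \<in> C1_surfaces" "0 < \<eta>"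
      have "0 < 1 / real (Suc i)" by simp
      from perturb_to_good[OF \<pi> \<sigma> \<pi>\<sigma> f this, of m] obtain g s T where
        g: "g \<in> C1_surfaces" "C1_dist f g < \<eta>" "0 < s" "T \<in> lmeasurable"
        "measure lebesgue (box 0 1 - T) < 1 / real (Suc i)"
        "\<And>h. h \<in> C1_surfaces \<Longrightarrow> C1_dist g h < s \<Longrightarrow> T \<subseteq> good \<pi> m h"
        by metis
      have "\<not> C1_dist g h < s" if "h \<in> A m i" for h
        using that g(4-6) unfolding A_def C_def by blast
      then show "\<exists>g s. g \<in> C1_surfaces \<and> C1_dist f g < \<eta> \<and> 0 < s \<and> (\<forall>h\<in>A m i. \<not> C1_dist g h < s)"
        using g(1-3) by blast
    qed
    have "f \<in> R" if f: "f \<in> C" and "\<And>m i. f \<notin> A m i" for f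
    proof (rule ccontr)
      assume fR: "f \<notin> R"
      have "\<exists>T\<in>lmeasurable. T \<subseteq> good \<pi> m f \<and> measure lebesgue (box 0 1 - T) < \<epsilon>" if \<epsilon>: "0 < \<epsilon>" for m \<epsilon>
      proof -
        obtain i where i: "1 / real (Suc i) < \<epsilon>"
          using nat_approx_posE[OF \<epsilon>] by blast
        have "f \<notin> A m i" by fact
        then obtain T where "T \<in> lmeasurable" "T \<subseteq> good \<pi> m f" "measure lebesgue (box 0 1 - T) < 1 / real (Suc i)"
          using f fR unfolding A_def by blast
        then show ?thesis using i by (meson order_less_trans)
      qed
      then have "hausdorff_measure CARD('n) (f ` cube - Q) = 0"
        unfolding Q_def using f by (intro surface_mostly_porous[OF \<pi>]) (auto simp: C_def)
      then show False using f fR by (simp add: R_def Diff_eq)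
    qed
    note in_R = this
    have "C - R \<subseteq> (\<Union>m i. A m i)"
    proof
      fix f assume f: "f \<in> C - R"
      then have "\<exists>m i. f \<in> A m i" using in_R[of f] by blast
      then show "f \<in> (\<Union>m i. A m i)" by blast
    qed
    moreover have "A m i \<subseteq> C - R" for m i
      unfolding A_def by (rule Collect_restrict)
    then have "(\<Union>m i. A m i) \<subseteq> C - R" by (intro UN_least)
    moreover have "(\<Union>m i. A m i) = \<Union>(range (\<lambda>(m, i). A m i))" by auto
    ultimately have "C - R = \<Union>(range (\<lambda>(m, i). A m i))" by simp
    then have "meager_in C1_topology (C - R)"
      unfolding meager_in_def using nd by (intro exI[of _ "range (\<lambda>(m, i). A m i)"]) auto
    then have "residual_in C1_topology R"
      unfolding residual_in_def top by (auto simp: R_def)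
    then show ?thesis
      unfolding Gamma_null_def R_def C_def .
  qed
  ultimately show ?thesis
    by (intro exI[of _ Q] exI[of _ "- Q"]) auto
qed

end
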